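(* Let $\mathbf n=(n_1,\dots,n_r)\in(\frac12\mathbb N)^r$ with total weight $n=\sum_in_i\in\mathbb N$, and let $p_1,\dots,p_r\in\mathbb C$ have pairwise distinct classes in $E_\tau$. If the generalized Lamé equation $$w''=\Big(\sum_{i=1}^rn_i(n_i+1)\wp(z-p_i)+\sum_{i=1}^rA_i\zeta(z-p_i)+B\Big)w,\qquad A_i,B\in\mathbb C,\ \sum_{i=1}^rA_i=0,$$ has only log-free solutions, then one of its solutions is given by the generalized Hermite–Halphen ansatz, possibly with lower total weight (i.e. of some type $\mathbf n'$, with the same poles $\mathbf p$, of total weight $n'\in\mathbb Z$ with $0\le n'\le n$).
   Context: $\mathbb N=\{1,2,\dots\}$. $\Im\tau>0$, $\Lambda_\tau=\mathbb Z+\mathbb Z\tau$, $E_\tau=\mathbb C/\Lambda_\tau$, $[z]$ the class of $z$; $\wp,\zeta,\sigma$ are the Weierstrass functions of $\Lambda_\tau$. "Log-free" means that the local expansions of solutions at the points $p_i$ contain no logarithmic terms. Generalized Hermite–Halphen ansatz of type $\mathbf m=(m_1,\dots,m_r)\in(\mathbb C\setminus\{0\})^r$ with total weight $m=\sum m_i\in\mathbb Z_{\ge0}$: if $m>0$, a function $$w_{\mathbf m,\mathbf p;\mathbf a}(z)=e^{hz}\frac{\prod_{\mu=1}^m\sigma(z-a_\mu)}{\prod_{i=1}^r\sigma(z-p_i)^{m_i}},\qquad h=\frac1m\sum_{\mu=1}^m\sum_{i=1}^rm_i\zeta(a_\mu-p_i),$$ where $\mathbf a=(a_\mu)\in\mathbb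 C^m$ with $[a_\mu]$ pairwise distinct and $[a_\mu]\ne[p_i]$ for all $\mu,i$; if $m=0$, a function $w_{\mathbf m,\mathbf p;h}(z)=e^{hz}/\prod_{i=1}^r\sigma(z-p_i)^{m_i}$ with $h\in\mathbb C$ a free parameter. *)

theory Defs
  imports "HOL-Analysis.Analysis"
begin

section \<open>Weierstrass functions of the lattice \<open>\<int> + \<int>\<tau>\<close>\<close>

definition lattice :: "complex \<Rightarrow> complex set" where
  "lattice \<tau> = {of_int a + of_int b * \<tau> | a b. True}"

text \<open>\<open>[z] = [w]\<close> in \<open>\<complex> / (\<int> + \<int>\<tau>)\<close>.\<close>

definition same_class :: "complex \<Rightarrow> complex \<Rightarrow> complex \<Rightarrow> bool" where
  "same_class \<tau> z w \<longleftrightarrow> z - w \<in> lattice \<tau>"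

definition wp :: "complex \<Rightarrow> complex \<Rightarrow> complex" where
  "wp \<tau> z = 1 / z^2 + (\<Sum>\<^sub>\<infinity>\<omega>\<in>lattice \<tau> - {0}. 1 / (z - \<omega>)^2 - 1 / \<omega>^2)"

definition wzeta :: "complex \<Rightarrow> complex \<Rightarrow> complex" where
  "wzeta \<tau> z = 1 / z + (\<Sum>\<^sub>\<infinity>\<omega>\<in>lattice \<tau> - {0}. 1 / (z - \<omega>) + 1 / \<omega> + z / \<omega>^2)"

text \<open>
  The product over \<open>\<omega> \<noteq> 0\<close> is the limit of the finite subproducts, i.e. the
  multiplicative analogue of \<^const>\<open>infsum\<close>.
\<close>

definition wsigma :: "complex \<Rightarrow> complex \<Rightarrow> complex" where
  "wsigma \<tau> z = z * Lim (finite_subsets_at_top (lattice \<tau> - {0}))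
     (\<lambda>F. \<Prod>\<omega>\<in>F. (1 - z / \<omega>) * exp (z / \<omega> + z^2 / (2 * \<omega>^2)))"


section \<open>The generalized Lame equation\<close>

definition solves_on :: "complex set \<Rightarrow> (complex \<Rightarrow> complex) \<Rightarrow> (complex \<Rightarrow> complex) \<Rightarrow> bool" where
  "solves_on U Q w \<longleftrightarrow> w holomorphic_on U \<and> (\<forall>z\<in>U. deriv (deriv w) z = Q z * w z)"

definition lame_potential ::
  "complex \<Rightarrow> nat \<Rightarrow> (nat \<Rightarrow> real) \<Rightarrow> (nat \<Rightarrow> complex) \<Rightarrow> (nat \<Rightarrow> complex) \<Rightarrow> complex \<Rightarrow> complex \<Rightarrow> complex"
where
  "lame_potential \<tau> r n p A B z =
     (\<Sum>i=1..r. of_real (n i * (n i + 1)) * wp \<tau> (z - p i))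
     + (\<Sum>i=1..r. A i * wzeta \<tau> (z - p i)) + B"

definition slit_disc :: "complex \<Rightarrow> real \<Rightarrow> complex set" where
  "slit_disc c \<epsilon> = {z \<in> ball c \<epsilon>. z - c \<notin> \<real>\<^sub>\<le>\<^sub>0}"

text \<open>
  Solutions near a singular point \<open>c\<close> are multivalued; they are represented by their
  branches on slit discs, where \<open>(z - c) powr \<rho>\<close> is holomorphic. The local expansion of a
  solution of a second-order equation is log-free if it consists of (at most) two
  convergent power series in \<open>z - c\<close>, multiplied by powers of \<open>z - c\<close>. The exponents
  are not prescribed. The expansion is only required on some smaller slit disc, since
  the given one may contain further singular points.
\<close>

definition log_free_at :: "(complex \<Rightarrow> complex) \<Rightarrow> complex \<Rightarrow> bool" where
  "log_free_at Q c \<longleftrightarrow>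
     (\<forall>\<epsilon>>0. \<forall>w. solves_on (slit_disc c \<epsilon>) Q w \<longrightarrow>
        (\<exists>\<rho>1 \<rho>2 f1 f2. f1 analytic_on {c} \<and> f2 analytic_on {c} \<and>
           (\<exists>\<delta>>0. \<delta> \<le> \<epsilon> \<and> (\<forall>z\<in>slit_disc c \<delta>.
              w z = (z - c) powr \<rho>1 * f1 z + (z - c) powr \<rho>2 * f2 z))))"


section \<open>The generalized Hermite--Halphen ansatz\<close>

text \<open>
  Admissible data of type \<open>m\<close> and total weight \<open>M\<close>. For \<open>M = 0\<close> the \<open>a \<mu>\<close> do not occur
  and \<open>h\<close> is free; for \<open>M > 0\<close> it is determined by the \<open>a \<mu>\<close>.
\<close>

definition hh_data ::
  "complex \<Rightarrow> nat \<Rightarrow> (nat \<Rightarrow> complex) \<Rightarrow> (nat \<Rightarrow> complex) \<Rightarrow> nat \<Rightarrow> (nat \<Rightarrow> complex) \<Rightarrow> complex \<Rightarrow> bool"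
where
  "hh_data \<tau> r m p M a h \<longleftrightarrow>
     (\<forall>i\<in>{1..r}. m i \<noteq> 0) \<and>
     (\<Sum>i=1..r. m i) = of_nat M \<and>
     (\<forall>\<mu>\<in>{1..M}. \<forall>\<nu>\<in>{1..M}. \<mu> \<noteq> \<nu> \<longrightarrow> \<not> same_class \<tau> (a \<mu>) (a \<nu>)) \<and>
     (\<forall>\<mu>\<in>{1..M}. \<forall>i\<in>{1..r}. \<not> same_class \<tau> (a \<mu>) (p i)) \<and>
     (M > 0 \<longrightarrow> h = 1 / of_nat M * (\<Sum>\<mu>=1..M. \<Sum>i=1..r. m i * wzeta \<tau> (a \<mu> - p i)))"

text \<open>
  For non-integral \<open>m i\<close> the ansatz is multivalued. Its branches on \<open>U\<close> are given by holomorphic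
  branches \<open>L i\<close> of the logarithm of \<open>\<sigma>(z - p i)\<close>, with \<open>\<sigma>(z - p i)\<close> to the power \<open>m i\<close>
  being \<open>exp (m i * L i z)\<close>.
\<close>

definition hh_branch_on ::
  "complex \<Rightarrow> nat \<Rightarrow> (nat \<Rightarrow> complex) \<Rightarrow> (nat \<Rightarrow> complex) \<Rightarrow> nat \<Rightarrow> (nat \<Rightarrow> complex) \<Rightarrow> complex \<Rightarrow>
   complex set \<Rightarrow> (complex \<Rightarrow> complex) \<Rightarrow> bool"
where
  "hh_branch_on \<tau> r m p M a h U w \<longleftrightarrow>
     (\<exists>L. (\<forall>i\<in>{1..r}. L i holomorphic_on U \<and> (\<forall>z\<in>U. exp (L i z) = wsigma \<tau> (z - p i))) \<and>
          (\<forall>z\<in>U. w z = exp (h * z) * (\<Prod>\<mu>=1..M. wsigma \<tau> (z - a \<mu>)) / (\<Prod>i=1..r. exp (m i * L i z))))"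

text \<open>
  A multivalued function solves the equation if all its branches, on all simply connected
  domains avoiding the poles, do. The existence of branches is included so that the condition
  cannot hold vacuously.
\<close>

definition hh_solves ::
  "complex \<Rightarrow> nat \<Rightarrow> (nat \<Rightarrow> complex) \<Rightarrow> (nat \<Rightarrow> complex) \<Rightarrow> nat \<Rightarrow> (nat \<Rightarrow> complex) \<Rightarrow> complex \<Rightarrow>
   (complex \<Rightarrow> complex) \<Rightarrow> bool"
where
  "hh_solves \<tau> r m p M a h Q \<longleftrightarrow>
     (\<forall>U. open U \<and> simply_connected U \<and> (\<forall>z\<in>U. \<forall>i\<in>{1..r}. \<not> same_class \<tau> z (p i)) \<longrightarrow>
        (\<exists>w. hh_branch_on \<tau> r m p M a h U w) \<and>
        (\<forall>w. hh_branch_on \<tau> r m p M a h U w \<longrightarrow> solves_on U Q w))"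

end

theory Submission
  imports Defs "HOL-Complex_Analysis.Complex_Analysis"
begin

text \<open>
  Let \<open>G = \<Sum>\<^sub>i n\<^sub>i \<zeta>(z - p\<^sub>i)\<close>. The equation is log-free, so at \<open>p\<^sub>i\<close> every solution \<open>w\<close> is
  \<open>(z - p\<^sub>i)\<close> to the power \<open>-n\<^sub>i\<close> times a holomorphic function, and \<open>y = w \<Prod>\<^sub>i \<sigma>(z - p\<^sub>i)\<close> (with
  exponents \<open>n\<^sub>i\<close>) extends to an entire solution of \<open>y'' = 2 G y' + (Q + G' - G\<^sup>2) y\<close>. On the
  two-dimensional space of these solutions the operators \<open>y(z) \<mapsto> y(z + \<omega>) exp(- n \<eta>(\<omega>) z)\<close> for
  \<open>\<omega> = 1\<close> and \<open>\<omega> = \<tau>\<close> commute, because \<open>n\<close> is an integer and \<open>\<eta>(1) \<tau> - \<eta>(\<tau>)\<close> is a multiple of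
  \<open>2 \<pi> \<i>\<close>. A common eigenvector is a theta function of degree \<open>n\<close>, hence an exponential times a
  product of \<open>n\<close> translates of \<open>\<sigma>\<close>. By the indicial equation its order at \<open>p\<^sub>i\<close> is \<open>0\<close> or
  \<open>2 n\<^sub>i + 1\<close>; in the second case \<open>n\<^sub>i\<close> is replaced by \<open>-n\<^sub>i - 1\<close>. All other zeros \<open>a\<^sub>\<mu>\<close> are simple,
  and there \<open>w'' = 0\<close>; summing these conditions over \<open>\<mu>\<close> gives the formula for \<open>h\<close>.
\<close>

section \<open>The equation \<open>w'' = Q w\<close>\<close>

text \<open>The exponents at a pole are - \<open>n i\<close> and \<open>n i\<close> + 1. They differ
  by the natural number 2 \<open>n i\<close> + 1, so every power series solution has the shape
  \<open>(z - p i) powr (- n i)\<close> times a holomorphic function. \<open>log_free_at\<close> may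
  offer two unrelated exponents; powers whose exponents differ by a non-integer are independent over
  germs of holomorphic functions, so each summand then solves the equation by itself and its
  exponent is an indicial root. The obstacle is multivaluedness: if \<open>n i\<close> is not an
  integer, w and the product of sigma powers both change sign around the pole, and only y is
  single-valued. The linear algebra therefore takes place among entire solutions y, and w returns at
  the end through branches of logarithms of sigma. Continuation to the whole plane rests on the
  radius of convergence of one Taylor series. For the common eigenvector it suffices that the space
  is nonzero and of dimension at most 2. In the formula for h the interaction terms
  \<open>zeta (a mu - a nu)\<close> cancel in pairs because zeta is odd.\<close>

lemma deriv_deriv_eqI:
  assumes S: "open S" "z \<in> S"
    and f: "\<And>z. z \<in> S \<Longrightarrow> (f has_field_derivative f1 z) (at z)"
    and f1: "(f1 has_field_derivative f2) (at z)"
  shows "deriv (deriv f) z = f2"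
proof -
  have "(deriv f has_field_derivative f2) (at z)"
    by (rule has_field_derivative_transform_within_open[OF f1 S]) (simp add: DERIV_imp_deriv[OF f])
  thus ?thesis by (rule DERIV_imp_deriv)
qed

lemma solves_onI:
  assumes S: "open S"
    and w: "\<And>z. z \<in> S \<Longrightarrow> (w has_field_derivative w1 z) (at z)"
    and w1: "\<And>z. z \<in> S \<Longrightarrow> (w1 has_field_derivative Q z * w z) (at z)"
  shows "solves_on S Q w"
  unfolding solves_on_def
proof
  show "w holomorphic_on S" unfolding holomorphic_on_open[OF S] using w by blast
  show "\<forall>z\<in>S. deriv (deriv w) z = Q z * w z"
    using deriv_deriv_eqI[OF S _ w w1] by blast
qed

lemma solves_onD:
  assumes "solves_on S Q w" "open S" "z \<in> S"
  shows "(w has_field_derivative deriv w z) (at z)"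
    and "(deriv w has_field_derivative Q z * w z) (at z)"
  using assms holomorphic_derivI[of w S z] holomorphic_derivI[OF holomorphic_deriv[of w S], of z]
  by (auto simp: solves_on_def)

lemma solves_on_subset: "solves_on S Q w \<Longrightarrow> T \<subseteq> S \<Longrightarrow> solves_on T Q w"
  unfolding solves_on_def using holomorphic_on_subset by blast

lemma solves_on_cong:
  assumes "open S" "\<And>z. z \<in> S \<Longrightarrow> w z = v z"
  shows "solves_on S Q w \<longleftrightarrow> solves_on S Q v"
proof -
  have *: "solves_on S Q v" if "solves_on S Q w" and eq: "\<And>z. z \<in> S \<Longrightarrow> w z = v z" for w v
  proof (rule solves_onI[OF assms(1)])
    fix z assume z: "z \<in> S"
    show "(v has_field_derivative deriv w z) (at z)"
      by (rule has_field_derivative_transform_within_open[OF solves_onD(1)[OF that(1) assms(1) z] assms(1) z])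
         (rule eq)
    show "(deriv w has_field_derivative Q z * v z) (at z)"
      using solves_onD(2)[OF that(1) assms(1) z] eq[OF z] by simp
  qed
  show ?thesis using *[of w v] *[of v w] assms(2) by auto
qed

section \<open>Existence of solutions on star-shaped domains\<close>

lemma starlike_primitive:
  fixes f :: "complex \<Rightarrow> complex"
  assumes S: "open S" "a \<in> S" "\<And>z. z \<in> S \<Longrightarrow> closed_segment a z \<subseteq> S"
    and f: "f holomorphic_on S"
  shows "\<exists>g. g a = 0 \<and> (\<forall>z\<in>S. (g has_field_derivative f z) (at z))"
proof -
  have "starlike S" unfolding starlike_def using S by blast
  then obtain g where g: "\<forall>z\<in>S. (g has_field_derivative f z) (at z)"
    using holomorphic_starlike_primitive[of S f "{}"] f S(1)
    by (auto simp: holomorphic_on_imp_continuous_on holomorphic_on_open field_differentiable_def)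
  show ?thesis
    by (rule exI[of _ "\<lambda>z. g z - g a"]) (use g in \<open>auto intro!: derivative_eq_intros\<close>)
qed

text \<open>Along the segment the derivative of \<open>g\<close> is bounded by C |z - a|^(k+1) t^k,
  and integration over t yields the factor 1/(k+1). A plain mean value estimate would lose this
  factor, and with it the factorials in the Picard iteration.\<close>

lemma primitive_bound:
  fixes f g :: "complex \<Rightarrow> complex"
  assumes seg: "\<And>t. t \<in> {0..1} \<Longrightarrow> a + of_real t * (z - a) \<in> K"
    and g: "g a = 0" "\<And>z. z \<in> K \<Longrightarrow> (g has_field_derivative f z) (at z)"
    and f: "\<And>z. z \<in> K \<Longrightarrow> norm (f z) \<le> C * norm (z - a) ^ k"
  shows "norm (g z) \<le> C * norm (z - a) ^ Suc k / real (Suc k)"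
proof -
  define x where "x = (\<lambda>t::real. a + of_real t * (z - a))"
  have xd: "(x has_vector_derivative (z - a)) (at t)" for t
    unfolding x_def[abs_def] by (auto intro!: derivative_eq_intros)
  have d: "((\<lambda>t. g (x t)) has_vector_derivative (z - a) * f (x t)) (at t)" if "t \<in> {0..1}" for t
    using field_vector_diff_chain_at[OF xd g(2)] seg[OF that] by (simp add: x_def o_def)
  let ?c = "C * norm (z - a) ^ Suc k"
  have "norm (g (x 1) - g (x 0)) \<le> ?c * 1 ^ Suc k / real (Suc k) - ?c * 0 ^ Suc k / real (Suc k)"
  proof (rule differentiable_bound_general[where f' = "\<lambda>t. (z - a) * f (x t)" and \<phi>' = "\<lambda>t. ?c * t ^ k"
       and f = "\<lambda>t. g (x t)" and \<phi> = "\<lambda>t. ?c * t ^ Suc k / real (Suc k)"])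
    show "continuous_on {0..1} (\<lambda>t. g (x t))"
      by (intro continuous_at_imp_continuous_on ballI has_vector_derivative_continuous[OF d])
    show "continuous_on {0..1} (\<lambda>t. ?c * t ^ Suc k / real (Suc k))"
      by (intro continuous_intros) auto
    fix t :: real assume t: "0 < t" "t < 1"
    show "((\<lambda>t. g (x t)) has_vector_derivative (z - a) * f (x t)) (at t)" using d t by simp
    have "((\<lambda>t. ?c * t ^ Suc k / real (Suc k)) has_field_derivative ?c * (real (Suc k) * t ^ k) / real (Suc k)) (at t)"
      by (rule derivative_eq_intros refl | simp)+
    thus "((\<lambda>t. ?c * t ^ Suc k / real (Suc k)) has_vector_derivative ?c * t ^ k) (at t)"
      by (simp add: has_real_derivative_iff_has_vector_derivative mult_ac)
    have xt: "x t \<in> K" using seg[of t] t by (simp add: x_def)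
    have "norm (f (x t)) \<le> C * (t * norm (z - a)) ^ k"
      using f[OF xt] t by (simp add: x_def norm_mult)
    hence "norm (z - a) * norm (f (x t)) \<le> norm (z - a) * (C * (t * norm (z - a)) ^ k)"
      by (intro mult_left_mono) auto
    thus "norm ((z - a) * f (x t)) \<le> ?c * t ^ k"
      by (simp add: norm_mult power_mult_distrib mult_ac)
  qed auto
  thus ?thesis using g(1) by (simp add: x_def)
qed

text \<open>\<open>K\<close> is the union of the segments from \<open>a\<close> to a closed disc
  around \<open>z\<close>. Compactness bounds the coefficient \<open>Q\<close> on it, and since
  \<open>K\<close> is star-shaped about \<open>a\<close>, estimates can be integrated along segments
  without leaving it.\<close>

lemma starlike_compact_nbhd:
  fixes S :: "complex set"
  assumes S: "open S" "z \<in> S" "\<And>z. z \<in> S \<Longrightarrow> closed_segment a z \<subseteq> S"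
  obtains d K where "d > 0" "compact K" "K \<subseteq> S" "ball z d \<subseteq> K"
    "\<And>z t. z \<in> K \<Longrightarrow> t \<in> {0..1} \<Longrightarrow> a + of_real t * (z - a) \<in> K"
proof -
  obtain d where d: "d > 0" "cball z d \<subseteq> S" using S open_contains_cball by blast
  define F where "F = (\<lambda>(t::real, z). a + of_real t * (z - a))"
  define K where "K = F ` ({0..1} \<times> cball z d)"
  show ?thesis
  proof (rule that[OF d(1)])
    show "compact K" unfolding K_def F_def split_def
      by (intro compact_continuous_image continuous_intros compact_Times) auto
    show "K \<subseteq> S"
    proof
      fix x assume "x \<in> K"
      then obtain t y where ty: "t \<in> {0..1}" "y \<in> cball z d" "x = a + of_real t * (y - a)"
        by (auto simp: K_def F_def)
      have "x = (1 - t) *\<^sub>R a + t *\<^sub>R y" by (simp add: ty(3) scaleR_conv_of_real algebra_simps)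
      hence "x \<in> closed_segment a y" using ty(1) by (auto simp: in_segment)
      thus "x \<in> S" using S(3)[of y] ty(2) d(2) by blast
    qed
    show "ball z d \<subseteq> K"
    proof
      fix y assume "y \<in> ball z d"
      thus "y \<in> K" unfolding K_def by (intro image_eqI[of _ _ "(1, y)"]) (auto simp: F_def)
    qed
    fix x t assume "x \<in> K" "t \<in> {0..1::real}"
    then obtain s y where sy: "s \<in> {0..1}" "y \<in> cball z d" "x = a + of_real s * (y - a)"
      by (auto simp: K_def F_def)
    show "a + of_real t * (x - a) \<in> K" unfolding K_def
      using sy \<open>t \<in> {0..1}\<close>
      by (intro image_eqI[of _ _ "(t * s, y)"]) (auto simp: F_def mult_le_one)
  qed
qed

text \<open>Picard iteration along the segments from the centre; the iterates are bounded by the terms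
  of an exponential series on compact star-shaped sets.\<close>

lemma ode_existence:
  assumes S: "open S" "a \<in> S" "\<And>z. z \<in> S \<Longrightarrow> closed_segment a z \<subseteq> S"
    and Q: "Q holomorphic_on S"
  shows "\<exists>w. solves_on S Q w \<and> w a = \<alpha> \<and> deriv w a = \<beta>"
proof -
  define prim where "prim = (\<lambda>f. SOME g. g a = 0 \<and> (\<forall>z\<in>S. (g has_field_derivative f z) (at z)))"
  have prim: "prim f a = 0" "\<And>z. z \<in> S \<Longrightarrow> (prim f has_field_derivative f z) (at z)"
    if "f holomorphic_on S" for f
    using someI_ex[OF starlike_primitive[OF S that]] by (auto simp: prim_def)
  have prim_hol: "prim f holomorphic_on S" if "f holomorphic_on S" for f
    unfolding holomorphic_on_open[OF S(1)] using prim(2)[OF that] by blast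
  \<comment> \<open>The \<open>u n\<close> are the increments of the iteration, so the solution is
    their sum. \<open>u 0\<close> carries both initial values; all later increments vanish at
    \<open>a\<close> together with their first derivative.\<close>
  define u where "u = (\<lambda>n. ((\<lambda>f. prim (prim (\<lambda>z. Q z * f z))) ^^ n) (\<lambda>z. \<alpha> + \<beta> * (z - a)))"
  define v where "v = (\<lambda>n. prim (\<lambda>z. Q z * u n z))"
  have u0: "u 0 = (\<lambda>z. \<alpha> + \<beta> * (z - a))" and uS: "u (Suc n) = prim (v n)" for n
    by (simp_all add: u_def v_def)
  have hol: "u n holomorphic_on S \<and> v n holomorphic_on S" for n
  proof (induction n)
    case 0
    have "u 0 holomorphic_on S" unfolding u0 by (intro holomorphic_intros)
    thus ?case unfolding v_def using Q by (auto intro!: prim_hol holomorphic_intros)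
  next
    case (Suc n)
    hence "u (Suc n) holomorphic_on S" unfolding uS by (intro prim_hol) auto
    thus ?case unfolding v_def using Q by (auto intro!: prim_hol holomorphic_intros)
  qed
  have Qu: "(\<lambda>z. Q z * u n z) holomorphic_on S" for n
    using hol Q by (intro holomorphic_intros) auto
  \<comment> \<open>The derivative series is the series of the \<open>v n\<close> shifted by one
    place, with the constant beta in front.\<close>
  define u' where "u' = (\<lambda>n. case n of 0 \<Rightarrow> (\<lambda>_. \<beta>) | Suc m \<Rightarrow> v m)"
  have du: "(u n has_field_derivative u' n z) (at z)" if "z \<in> S" for n z
  proof (cases n)
    case 0
    thus ?thesis by (auto simp: u0 u'_def intro!: derivative_eq_intros)
  next
    case (Suc m)
    thus ?thesis using prim(2)[of "v m"] hol that by (auto simp: uS u'_def)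
  qed
  have dv: "(v n has_field_derivative Q z * u n z) (at z)" if "z \<in> S" for n z
    unfolding v_def by (rule prim(2)[OF Qu that])
  have bounds: "\<exists>d h. 0 < d \<and> summable h \<and> (\<forall>n. \<forall>y\<in>ball z d. norm (u n y) \<le> h n \<and> norm (v n y) \<le> h n)"
    if z: "z \<in> S" for z
  proof -
    obtain d K where K: "d > 0" "compact K" "K \<subseteq> S" "ball z d \<subseteq> K"
      "\<And>z t. z \<in> K \<Longrightarrow> t \<in> {0..1} \<Longrightarrow> a + of_real t * (z - a) \<in> K"
      using starlike_compact_nbhd[OF S(1) z S(3)] by metis
    have "bounded (Q ` K)"
      using K Q by (intro compact_imp_bounded compact_continuous_image)
        (auto intro: holomorphic_on_imp_continuous_on holomorphic_on_subset)
    then obtain M where M: "M > 0" "\<And>z. z \<in> K \<Longrightarrow> norm (Q z) \<le> M"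
      unfolding bounded_pos by auto
    have "bounded ((\<lambda>z. z - a) ` K)"
      using K by (intro compact_imp_bounded compact_continuous_image continuous_intros)
    then obtain \<rho> where \<rho>: "\<rho> > 0" "\<And>z. z \<in> K \<Longrightarrow> norm (z - a) \<le> \<rho>"
      unfolding bounded_pos by auto
    define C where "C = norm \<alpha> + norm \<beta> * \<rho>"
    have C: "C \<ge> 0" using \<rho> by (simp add: C_def)
    have step: "norm (v n z) \<le> C * M ^ Suc n * norm (z - a) ^ Suc (2 * n) / fact n"
      if z: "z \<in> K" and IH: "\<And>z. z \<in> K \<Longrightarrow> norm (u n z) \<le> C * M ^ n * norm (z - a) ^ (2 * n) / fact n" for n z
    proof -
      have "norm (v n z) \<le> (C * M ^ Suc n / fact n) * norm (z - a) ^ Suc (2 * n) / real (Suc (2 * n))"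
      proof (rule primitive_bound[where K = K and f = "\<lambda>z. Q z * u n z"])
        show "v n a = 0" unfolding v_def by (rule prim(1)[OF Qu])
        show "(v n has_field_derivative Q z * u n z) (at z)" if "z \<in> K" for z
          using dv K(3) that by auto
        show "norm (Q z * u n z) \<le> C * M ^ Suc n / fact n * norm (z - a) ^ (2 * n)" if "z \<in> K" for z
        proof -
          have "norm (Q z * u n z) \<le> M * (C * M ^ n * norm (z - a) ^ (2 * n) / fact n)"
            unfolding norm_mult using M IH[OF that] that by (intro mult_mono) auto
          thus ?thesis by (simp add: mult_ac)
        qed
      qed (use K(5) z in auto)
      \<comment> \<open>The factor 2n + 1 is dropped here, and 2n + 2 is replaced by n + 1 at the
        next integration; what remains still produces 1 / n!.\<close>
      also have "\<dots> \<le> (C * M ^ Suc n / fact n) * norm (z - a) ^ Suc (2 * n) / 1"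
        using C M(1) by (intro divide_left_mono) auto
      finally show ?thesis by (simp add: field_simps)
    qed
    have ub: "norm (u n z) \<le> C * M ^ n * norm (z - a) ^ (2 * n) / fact n" if "z \<in> K" for n z
      using that
    proof (induction n arbitrary: z)
      case 0
      have "norm (u 0 z) \<le> norm \<alpha> + norm \<beta> * norm (z - a)"
        unfolding u0 by (rule order_trans[OF norm_triangle_ineq]) (simp add: norm_mult)
      also have "\<dots> \<le> C" unfolding C_def using \<rho>(2)[OF 0] by (intro add_left_mono mult_left_mono) auto
      finally show ?case by simp
    next
      case (Suc n)
      have "norm (u (Suc n) z) \<le> (C * M ^ Suc n / fact n) * norm (z - a) ^ Suc (Suc (2 * n)) / real (Suc (Suc (2 * n)))"
      proof (rule primitive_bound[where K = K and f = "v n"])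
        show "u (Suc n) a = 0" unfolding uS using hol by (intro prim(1)) auto
        show "(u (Suc n) has_field_derivative v n z) (at z)" if "z \<in> K" for z
          using du[of z "Suc n"] K(3) that by (auto simp: u'_def)
        show "norm (v n z) \<le> C * M ^ Suc n / fact n * norm (z - a) ^ Suc (2 * n)" if "z \<in> K" for z
          using step[OF that Suc.IH] by (simp add: mult_ac)
      qed (use K(5) Suc.prems in auto)
      also have "\<dots> \<le> (C * M ^ Suc n / fact n) * norm (z - a) ^ Suc (Suc (2 * n)) / real (Suc n)"
        using C M(1) by (intro divide_left_mono) auto
      also have "\<dots> = C * M ^ Suc n * norm (z - a) ^ (2 * Suc n) / fact (Suc n)"
        by (simp add: field_simps)
      finally show ?case .
    qed
    define h where "h = (\<lambda>n. max C (C * M * \<rho>) * (inverse (fact n) * (M * \<rho> ^ 2) ^ n))"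
    have "summable h" unfolding h_def by (intro summable_mult summable_exp)
    moreover have "norm (u n y) \<le> h n \<and> norm (v n y) \<le> h n" if "y \<in> ball z d" for n y
    proof
      have y: "y \<in> K" using that K(4) by auto
      have P: "norm (y - a) ^ (2 * n) \<le> \<rho> ^ (2 * n)" using \<rho> y by (intro power_mono) auto
      have nn: "0 \<le> inverse (fact n) * (M * \<rho> ^ 2) ^ n" using M(1) by simp
      have "norm (u n y) \<le> C * M ^ n * \<rho> ^ (2 * n) / fact n"
        by (rule order_trans[OF ub[OF y]]) (use C M(1) P in \<open>intro divide_right_mono mult_left_mono; auto\<close>)
      also have "\<dots> = C * (inverse (fact n) * (M * \<rho> ^ 2) ^ n)"
        by (simp add: power_mult_distrib power_mult[symmetric] field_simps)
      also have "\<dots> \<le> h n" unfolding h_def using nn by (intro mult_right_mono) auto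
      finally show "norm (u n y) \<le> h n" .
      have "norm (y - a) ^ Suc (2 * n) \<le> \<rho> ^ Suc (2 * n)" using \<rho> y by (intro power_mono) auto
      hence "C * M ^ Suc n * norm (y - a) ^ Suc (2 * n) / fact n \<le> C * M ^ Suc n * \<rho> ^ Suc (2 * n) / fact n"
        using C M(1) by (intro divide_right_mono mult_left_mono) auto
      with step[OF y ub] have "norm (v n y) \<le> C * M ^ Suc n * \<rho> ^ Suc (2 * n) / fact n"
        by (rule order_trans)
      also have "\<dots> = C * M * \<rho> * (inverse (fact n) * (M * \<rho> ^ 2) ^ n)"
        by (simp add: power_mult_distrib power_mult[symmetric] field_simps)
      also have "\<dots> \<le> h n" unfolding h_def using nn by (intro mult_right_mono) auto
      finally show "norm (v n y) \<le> h n" .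
    qed
    ultimately show ?thesis using K(1) by blast
  qed
  have "\<exists>g g'. \<forall>x \<in> S. ((\<lambda>n. u n x) sums g x) \<and> ((\<lambda>n. u' n x) sums g' x) \<and> (g has_field_derivative g' x) (at x)"
  proof (rule series_and_derivative_comparison_local[OF S(1) du])
    fix x assume "x \<in> S"
    then obtain d h where "0 < d" "summable h" "\<forall>n. \<forall>y\<in>ball x d. norm (u n y) \<le> h n \<and> norm (v n y) \<le> h n"
      using bounds by blast
    thus "\<exists>d h. 0 < d \<and> summable h \<and> (\<forall>\<^sub>F n in sequentially. \<forall>y\<in>ball x d \<inter> S. norm (u n y) \<le> h n)"
      by (intro exI[of _ d] exI[of _ h]) (auto intro!: always_eventually)
  qed
  then obtain g g' where g: "\<And>x. x \<in> S \<Longrightarrow> (\<lambda>n. u n x) sums g x" "\<And>x. x \<in> S \<Longrightarrow> (\<lambda>n. u' n x) sums g' x"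
     "\<And>x. x \<in> S \<Longrightarrow> (g has_field_derivative g' x) (at x)" by blast
  have "\<exists>h h'. \<forall>x \<in> S. ((\<lambda>n. v n x) sums h x) \<and> ((\<lambda>n. Q x * u n x) sums h' x) \<and> (h has_field_derivative h' x) (at x)"
  proof (rule series_and_derivative_comparison_local[OF S(1) dv])
    fix x assume "x \<in> S"
    then obtain d h where "0 < d" "summable h" "\<forall>n. \<forall>y\<in>ball x d. norm (u n y) \<le> h n \<and> norm (v n y) \<le> h n"
      using bounds by blast
    thus "\<exists>d h. 0 < d \<and> summable h \<and> (\<forall>\<^sub>F n in sequentially. \<forall>y\<in>ball x d \<inter> S. norm (v n y) \<le> h n)"
      by (intro exI[of _ d] exI[of _ h]) (auto intro!: always_eventually)
  qed
  then obtain h h' where h: "\<And>x. x \<in> S \<Longrightarrow> (\<lambda>n. v n x) sums h x" "\<And>x. x \<in> S \<Longrightarrow> (\<lambda>n. Q x * u n x) sums h' x"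
     "\<And>x. x \<in> S \<Longrightarrow> (h has_field_derivative h' x) (at x)" by blast
  have g': "g' x = \<beta> + h x" if "x \<in> S" for x
  proof -
    have "(\<lambda>n. u' (Suc n) x) sums (g' x - u' 0 x)"
      using g(2)[OF that] by (subst sums_Suc_iff) simp
    hence "(\<lambda>n. v n x) sums (g' x - \<beta>)" by (simp add: u'_def)
    from sums_unique2[OF this h(1)[OF that]] show ?thesis by (simp add: algebra_simps)
  qed
  have h': "h' x = Q x * g x" if "x \<in> S" for x
    using sums_unique2[OF h(2)[OF that] sums_mult[OF g(1)[OF that]]] .
  have "u n a = (if n = 0 then \<alpha> else 0)" for n
    using hol prim(1) by (cases n) (auto simp: u0 uS)
  hence "(\<lambda>n. if n = 0 then \<alpha> else 0) sums g a" using g(1)[OF S(2)] by simp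
  hence ga: "g a = \<alpha>" using sums_single[of 0 "\<lambda>_. \<alpha>"] sums_unique2 by blast
  have "v n a = 0" for n unfolding v_def by (rule prim(1)[OF Qu])
  hence "(\<lambda>n. 0) sums h a" using h(1)[OF S(2)] by simp
  hence ha: "h a = 0" using sums_unique2 sums_zero by blast
  have "solves_on S Q g"
  proof (rule solves_onI[OF S(1)])
    fix z assume z: "z \<in> S"
    show "(g has_field_derivative \<beta> + h z) (at z)" using g(3)[OF z] g'[OF z] by simp
    show "((\<lambda>z. \<beta> + h z) has_field_derivative Q z * g z) (at z)"
      using h(3)[OF z] h'[OF z] by (auto intro!: derivative_eq_intros)
  qed
  moreover have "deriv g a = \<beta>" using g(3)[OF S(2)] g'[OF S(2)] ha by (simp add: DERIV_imp_deriv)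
  ultimately show ?thesis using ga by blast
qed

section \<open>Wronskians and the space of solutions\<close>

lemma wronskian_constant:
  assumes S: "open S" "connected S" and w: "solves_on S Q w1" "solves_on S Q w2"
  shows "\<exists>C. \<forall>z\<in>S. w1 z * deriv w2 z - deriv w1 z * w2 z = C"
proof -
  have "(\<lambda>z. w1 z * deriv w2 z - deriv w1 z * w2 z) constant_on S"
  proof (rule has_field_derivative_0_imp_constant_on[OF _ S(2,1)])
    fix z assume z: "z \<in> S"
    note d1 = solves_onD[OF w(1) S(1) z] and d2 = solves_onD[OF w(2) S(1) z]
    show "((\<lambda>z. w1 z * deriv w2 z - deriv w1 z * w2 z) has_field_derivative 0) (at z)"
      by (rule DERIV_cong[OF DERIV_diff[OF DERIV_mult[OF d1(1) d2(2)] DERIV_mult[OF d1(2) d2(1)]]])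
         (simp add: algebra_simps)
  qed
  thus ?thesis by (auto simp: constant_on_def)
qed

text \<open>Cramer's rule: the coefficients are quotients of Wronskians, which are constant because
  the equation has no first-order term. \<open>D\<close> may be smaller than \<open>S\<close>, since
  local solutions are compared with a basis given on a larger domain.\<close>

lemma solution_combination:
  assumes S: "open S" "connected S" and w: "solves_on S Q w1" "solves_on S Q w2"
    and a: "a \<in> S" "w1 a * deriv w2 a - deriv w1 a * w2 a \<noteq> 0"
    and D: "open D" "connected D" "D \<subseteq> S" and wD: "solves_on D Q w"
  shows "\<exists>c1 c2. \<forall>z\<in>D. w z = c1 * w1 z + c2 * w2 z"
proof -
  obtain C where C: "\<And>z. z \<in> S \<Longrightarrow> w1 z * deriv w2 z - deriv w1 z * w2 z = C"
    using wronskian_constant[OF S w] by blast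
  have C0: "C \<noteq> 0" using C a by auto
  note wD12 = solves_on_subset[OF w(1) D(3)] solves_on_subset[OF w(2) D(3)]
  obtain A B where A: "\<And>z. z \<in> D \<Longrightarrow> w z * deriv w1 z - deriv w z * w1 z = A"
    and B: "\<And>z. z \<in> D \<Longrightarrow> w z * deriv w2 z - deriv w z * w2 z = B"
    using wronskian_constant[OF D(1,2) wD wD12(1)] wronskian_constant[OF D(1,2) wD wD12(2)] by blast
  have "w z = (B / C) * w1 z + (- A / C) * w2 z" if "z \<in> D" for z
  proof -
    have "B * w1 z - A * w2 z = w z * C"
      unfolding A[OF that, symmetric] B[OF that, symmetric] C[OF subsetD[OF D(3) that], symmetric]
      by (simp add: algebra_simps)
    thus ?thesis using C0 by (simp add: field_simps)
  qed
  thus ?thesis by blast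
qed

section \<open>Log-free singular points\<close>

lemma slit_disc_eq: "slit_disc c \<epsilon> = ball c \<epsilon> \<inter> (\<lambda>z. z - c) -` (- \<real>\<^sub>\<le>\<^sub>0)"
  by (auto simp: slit_disc_def)

lemma solves_on_eqI:
  assumes "solves_on S Q w" "open S" "\<And>z. z \<in> S \<Longrightarrow> v z = w z"
  shows "solves_on S Q v"
  using solves_on_cong[of S v w Q] assms by blast

lemma open_slit_disc: "open (slit_disc c \<epsilon>)"
  unfolding slit_disc_eq
  by (intro open_Int open_ball open_vimage continuous_intros open_Compl closed_nonpos_Reals_complex)

lemma slit_disc_subset_ball: "slit_disc c \<epsilon> \<subseteq> ball c \<epsilon> - {c}"
  by (auto simp: slit_disc_def)

lemma slit_disc_mono: "\<delta> \<le> \<epsilon> \<Longrightarrow> slit_disc c \<delta> \<subseteq> slit_disc c \<epsilon>"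
  by (auto simp: slit_disc_def)

lemma slit_disc_centre: "\<epsilon> > 0 \<Longrightarrow> c + of_real (\<epsilon> / 2) \<in> slit_disc c \<epsilon>"
  by (auto simp: slit_disc_def dist_norm complex_nonpos_Reals_iff norm_divide)

text \<open>The centre of the star lies on the ray opposite to the slit. A point of the segment can
  be on the slit only if z - c is real; then z - c is positive, and so is every convex
  combination.\<close>

lemma slit_disc_starlike:
  assumes z: "z \<in> slit_disc c \<epsilon>" and \<epsilon>: "\<epsilon> > 0"
  shows "closed_segment (c + of_real (\<epsilon> / 2)) z \<subseteq> slit_disc c \<epsilon>"
proof
  fix x assume "x \<in> closed_segment (c + of_real (\<epsilon> / 2)) z"
  then obtain u where u: "0 \<le> u" "u \<le> 1" "x = (1 - u) *\<^sub>R (c + of_real (\<epsilon> / 2)) + u *\<^sub>R z"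
    by (auto simp: in_segment)
  have "closed_segment (c + of_real (\<epsilon> / 2)) z \<subseteq> ball c \<epsilon>"
    using z \<epsilon> slit_disc_centre[OF \<epsilon>, of c] slit_disc_subset_ball[of c \<epsilon>]
    by (intro closed_segment_subset) auto
  hence xb: "x \<in> ball c \<epsilon>" using \<open>x \<in> closed_segment (c + of_real (\<epsilon> / 2)) z\<close> by blast
  have xc: "x - c = of_real ((1 - u) * (\<epsilon> / 2)) + of_real u * (z - c)"
    by (simp add: u(3) scaleR_conv_of_real algebra_simps)
  have nz: "z - c \<notin> \<real>\<^sub>\<le>\<^sub>0" using z by (simp add: slit_disc_def)
  have "x - c \<notin> \<real>\<^sub>\<le>\<^sub>0"
  proof
    assume "x - c \<in> \<real>\<^sub>\<le>\<^sub>0"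
    hence re: "(1 - u) * (\<epsilon> / 2) + u * Re (z - c) \<le> 0" and im: "u * Im (z - c) = 0"
      unfolding xc by (auto simp: complex_nonpos_Reals_iff)
    show False
    proof (cases "u = 0")
      case True thus ?thesis using re \<epsilon> by simp
    next
      case False
      hence "Im (z - c) = 0" "u > 0" using im u by auto
      hence "Re (z - c) > 0" using nz by (auto simp: complex_nonpos_Reals_iff)
      moreover have "(1 - u) * (\<epsilon> / 2) \<ge> 0" using u \<epsilon> by simp
      ultimately show False using re \<open>u > 0\<close> by (smt (verit) mult_pos_pos)
    qed
  qed
  thus "x \<in> slit_disc c \<epsilon>" using xb by (simp add: slit_disc_def)
qed

lemma connected_slit_disc: "connected (slit_disc c \<epsilon>)"
proof (cases "\<epsilon> > 0")
  case True
  have "starlike (slit_disc c \<epsilon>)"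
    unfolding starlike_def using slit_disc_centre[OF True] slit_disc_starlike[OF _ True] by blast
  thus ?thesis by (rule starlike_imp_connected)
next
  case False
  hence "ball c \<epsilon> = {}" by simp
  thus ?thesis by (simp only: slit_disc_eq Int_empty_left connected_empty)
qed

text \<open>The identity theorem. It carries identities obtained by dividing out powers of z - c
  over to the centre, where they are to be evaluated.\<close>

lemma eq_on_ball_if_eq_on_slit_disc:
  assumes "f holomorphic_on ball c \<delta>" "g holomorphic_on ball c \<delta>"
    "\<And>z. z \<in> slit_disc c \<delta> \<Longrightarrow> f z = g z" "z \<in> ball c \<delta>"
  shows "f z = g z"
proof -
  have "\<delta> > 0" using assms(4) by (auto intro: le_less_trans[OF zero_le_dist])
  thus ?thesis
    using slit_disc_centre[of \<delta> c] slit_disc_subset_ball[of c \<delta>]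
    by (intro analytic_continuation_open[OF open_slit_disc open_ball _ connected_ball _ assms(1,2,3,4)]) auto
qed

text \<open>The order \<open>m\<close> may be 0, so that vanishing and non-vanishing at the centre
  are treated alike afterwards.\<close>

lemma zero_factorization:
  assumes f: "f holomorphic_on ball c \<delta>" and nz: "\<exists>z\<in>ball c \<delta>. f z \<noteq> 0"
  obtains m g r where "0 < r" "r \<le> \<delta>" "g holomorphic_on ball c r"
    "\<And>z. z \<in> ball c r \<Longrightarrow> f z = (z - c) ^ m * g z" "\<And>z. z \<in> ball c r \<Longrightarrow> g z \<noteq> 0"
proof -
  have \<delta>: "\<delta> > 0" using nz by (auto intro: le_less_trans[OF zero_le_dist])
  show ?thesis
  proof (cases "f c = 0")
    case True
    have "\<not> f constant_on ball c \<delta>" using nz True \<delta> by (auto simp: constant_on_def) (metis centre_in_ball mem_ball)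
    then obtain g r n where g: "0 < n" "0 < r"  "ball c r \<subseteq> ball c \<delta>" "g holomorphic_on ball c r"
      "\<And>w. w \<in> ball c r \<Longrightarrow> f w = (w - c) ^ n * g w" "\<And>w. w \<in> ball c r \<Longrightarrow> g w \<noteq> 0"
      using holomorphic_factor_zero_nonconstant[OF f open_ball connected_ball _ True] \<delta>
      by (metis centre_in_ball)
    moreover have "g holomorphic_on ball c (min r \<delta>)" by (rule holomorphic_on_subset[OF g(4)]) auto
    ultimately show ?thesis using that[of "min r \<delta>" g n] \<delta> by auto
  next
    case False
    have "continuous (at c) f" using f \<delta> holomorphic_on_imp_continuous_on continuous_on_eq_continuous_at
      by (metis centre_in_ball open_ball)
    then obtain e where e: "e > 0" "\<And>z. dist c z < e \<Longrightarrow> f z \<noteq> 0"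
      using continuous_at_avoid[of c f 0] False by blast
    show ?thesis
      by (rule that[of "min e \<delta>" f 0]) (use e \<delta> f in \<open>auto intro: holomorphic_on_subset\<close>)
  qed
qed

section \<open>Solutions with a power factor and the indicial equation\<close>

lemma has_field_derivative_powr_mult:
  fixes z c \<rho> :: complex
  assumes z: "z - c \<notin> \<real>\<^sub>\<le>\<^sub>0" and f: "(f has_field_derivative f') (at z)"
  shows "((\<lambda>z. (z - c) powr \<rho> * f z) has_field_derivative
           (z - c) powr \<rho> * (\<rho> / (z - c) * f z + f')) (at z)"
proof -
  have zc: "z - c \<noteq> 0" using z by auto
  have "((\<lambda>z. z powr \<rho>) has_field_derivative \<rho> * (z - c) powr (\<rho> - 1)) (at (z - c))"
    by (rule has_field_derivative_powr[OF z])
  hence "((\<lambda>z. (z - c) powr \<rho>) has_field_derivative \<rho> * (z - c) powr (\<rho> - 1) * 1) (at z)"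
    by (rule DERIV_chain2) (auto intro!: derivative_eq_intros)
  from DERIV_mult[OF this f] show ?thesis
    by (rule DERIV_cong) (use zc in \<open>simp add: powr_diff algebra_simps\<close>)
qed

text \<open>The equation \<open>w'' = (\<kappa> / (z - c)\<^sup>2 + q / (z - c)) w\<close> for \<open>w = (z - c)\<^bsup>\<rho>\<^esup> f\<close>, multiplied by
  \<open>(z - c)\<^bsup>2 - \<rho>\<^esup>\<close>.\<close>

definition frobenius_op ::
  "complex \<Rightarrow> complex \<Rightarrow> (complex \<Rightarrow> complex) \<Rightarrow> complex \<Rightarrow> (complex \<Rightarrow> complex) \<Rightarrow> complex \<Rightarrow> complex" where
  "frobenius_op \<rho> \<kappa> q c f z =
     \<rho> * (\<rho> - 1) * f z + 2 * \<rho> * (z - c) * deriv f z + (z - c) ^ 2 * deriv (deriv f) z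
     - (\<kappa> + (z - c) * q z) * f z"

lemma holomorphic_frobenius_op:
  assumes "f holomorphic_on ball c \<delta>" "q holomorphic_on ball c \<delta>"
  shows "frobenius_op \<rho> \<kappa> q c f holomorphic_on ball c \<delta>"
  unfolding frobenius_op_def by (intro holomorphic_intros assms open_ball)

text \<open>The residual is an exact formula for arbitrary holomorphic \<open>f\<close>: with two
  exponents present, only the sum of two residuals is known to vanish.\<close>

lemma
  assumes f: "f holomorphic_on ball c \<delta>"
  shows powr_solution_residual:
    "\<And>z. z \<in> slit_disc c \<delta> \<Longrightarrow> deriv (deriv (\<lambda>z. (z - c) powr \<rho> * f z)) z
        - (\<kappa> / (z - c) ^ 2 + q z / (z - c)) * ((z - c) powr \<rho> * f z)
      = (z - c) powr \<rho> / (z - c) ^ 2 * frobenius_op \<rho> \<kappa> q c f z"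
    and holomorphic_powr_mult: "(\<lambda>z. (z - c) powr \<rho> * f z) holomorphic_on slit_disc c \<delta>"
    and deriv_powr_mult: "\<And>z. z \<in> slit_disc c \<delta> \<Longrightarrow>
      (deriv (\<lambda>z. (z - c) powr \<rho> * f z) has_field_derivative
         deriv (deriv (\<lambda>z. (z - c) powr \<rho> * f z)) z) (at z)"
proof -
  have fd: "(f has_field_derivative deriv f z) (at z)"
    "(deriv f has_field_derivative deriv (deriv f) z) (at z)" if "z \<in> slit_disc c \<delta>" for z
    using that slit_disc_subset_ball[of c \<delta>]
    by (auto intro!: holomorphic_derivI[OF f open_ball]
          holomorphic_derivI[OF holomorphic_deriv[OF f open_ball] open_ball])
  have nr: "z - c \<notin> \<real>\<^sub>\<le>\<^sub>0" "z \<noteq> c" if "z \<in> slit_disc c \<delta>" for z using that by (auto simp: slit_disc_def)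
  have d1: "((\<lambda>z. (z - c) powr \<rho> * f z) has_field_derivative
              (z - c) powr \<rho> * (\<rho> / (z - c) * f z + deriv f z)) (at z)" if "z \<in> slit_disc c \<delta>" for z
    by (rule has_field_derivative_powr_mult[OF nr(1) fd(1)]) (use that in auto)
  show hol: "(\<lambda>z. (z - c) powr \<rho> * f z) holomorphic_on slit_disc c \<delta>"
    unfolding holomorphic_on_open[OF open_slit_disc] using d1 by blast
  show "(deriv (\<lambda>z. (z - c) powr \<rho> * f z) has_field_derivative
         deriv (deriv (\<lambda>z. (z - c) powr \<rho> * f z)) z) (at z)" if "z \<in> slit_disc c \<delta>" for z
    using that by (intro holomorphic_derivI[OF holomorphic_deriv[OF hol]] open_slit_disc)
  fix z assume z: "z \<in> slit_disc c \<delta>"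
  have inner: "((\<lambda>z. \<rho> / (z - c) * f z + deriv f z) has_field_derivative
                 (- \<rho> / (z - c) ^ 2 * f z + deriv f z * (\<rho> / (z - c))) + deriv (deriv f) z) (at z)"
  proof -
    have "((\<lambda>z. \<rho> / (z - c)) has_field_derivative - \<rho> / (z - c) ^ 2) (at z)"
      using nr[OF z] by (auto intro!: derivative_eq_intros simp: power2_eq_square)
    from DERIV_add[OF DERIV_mult[OF this fd(1)[OF z]] fd(2)[OF z]] show ?thesis .
  qed
  have "deriv (deriv (\<lambda>z. (z - c) powr \<rho> * f z)) z = (z - c) powr \<rho> *
          (\<rho> / (z - c) * (\<rho> / (z - c) * f z + deriv f z) +
           ((- \<rho> / (z - c) ^ 2 * f z + deriv f z * (\<rho> / (z - c))) + deriv (deriv f) z))"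
    by (rule deriv_deriv_eqI[OF open_slit_disc z d1 has_field_derivative_powr_mult[OF nr(1)[OF z] inner]])
  thus "deriv (deriv (\<lambda>z. (z - c) powr \<rho> * f z)) z
        - (\<kappa> / (z - c) ^ 2 + q z / (z - c)) * ((z - c) powr \<rho> * f z)
      = (z - c) powr \<rho> / (z - c) ^ 2 * frobenius_op \<rho> \<kappa> q c f z"
    using nr(2)[OF z] by (simp add: frobenius_op_def power2_eq_square divide_simps) (simp add: algebra_simps)
qed

lemma powr_solution_iff:
  assumes f: "f holomorphic_on ball c \<delta>"
    and Q: "\<And>z. z \<in> slit_disc c \<delta> \<Longrightarrow> Q z = \<kappa> / (z - c) ^ 2 + q z / (z - c)"
  shows "solves_on (slit_disc c \<delta>) Q (\<lambda>z. (z - c) powr \<rho> * f z) \<longleftrightarrow>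
         (\<forall>z\<in>slit_disc c \<delta>. frobenius_op \<rho> \<kappa> q c f z = 0)"
proof -
  have "(deriv (deriv (\<lambda>z. (z - c) powr \<rho> * f z)) z = Q z * ((z - c) powr \<rho> * f z)) \<longleftrightarrow>
          frobenius_op \<rho> \<kappa> q c f z = 0" if z: "z \<in> slit_disc c \<delta>" for z
  proof -
    have "z - c \<noteq> 0" using z by (auto simp: slit_disc_def)
    thus ?thesis using powr_solution_residual[OF f z, of \<rho> \<kappa> q] Q[OF z] by (auto simp: algebra_simps)
  qed
  thus ?thesis using holomorphic_powr_mult[OF f] by (auto simp: solves_on_def)
qed

text \<open>At z = c every term of \<open>frobenius_op\<close> with a factor z - c drops out, which
  leaves (rho (rho - 1) - kappa) \<open>f c\<close>.\<close>

lemma indicial_equation: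
  assumes f: "f holomorphic_on ball c \<delta>" "f c \<noteq> 0" and q: "q holomorphic_on ball c \<delta>" and \<delta>: "\<delta> > 0"
    and Q: "\<And>z. z \<in> slit_disc c \<delta> \<Longrightarrow> Q z = \<kappa> / (z - c) ^ 2 + q z / (z - c)"
    and sol: "solves_on (slit_disc c \<delta>) Q (\<lambda>z. (z - c) powr \<rho> * f z)"
  shows "\<rho> * (\<rho> - 1) = \<kappa>"
proof -
  have "frobenius_op \<rho> \<kappa> q c f z = 0" if "z \<in> slit_disc c \<delta>" for z
    using sol powr_solution_iff[OF f(1) Q] that by blast
  hence "frobenius_op \<rho> \<kappa> q c f c = 0"
    by (rule eq_on_ball_if_eq_on_slit_disc[OF holomorphic_frobenius_op[OF f(1) q] holomorphic_on_const])
       (simp_all add: \<delta>)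
  hence "(\<rho> * (\<rho> - 1) - \<kappa>) * f c = 0" by (simp add: frobenius_op_def algebra_simps)
  thus ?thesis using f(2) by simp
qed

lemma indicial_roots:
  fixes \<rho> \<nu> :: complex
  assumes "\<rho> * (\<rho> - 1) = \<nu> * (\<nu> + 1)"
  shows "\<rho> = - \<nu> \<or> \<rho> = \<nu> + 1"
proof -
  have "(\<rho> + \<nu>) * (\<rho> - (\<nu> + 1)) = 0" using assms by (simp add: algebra_simps)
  thus ?thesis by (auto simp: add_eq_0_iff2)
qed

lemma powr_add_of_nat: "(z::complex) \<noteq> 0 \<Longrightarrow> z powr (\<rho> + of_nat m) = z powr \<rho> * z ^ m"
  by (simp add: powr_add powr_nat')

text \<open>Once the zero of \<open>f\<close> at \<open>c\<close> is absorbed into the power, the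
  exponent rho + m is an indicial root, that is, -nu or nu + 1 = -nu + (k + 1). Either root exceeds
  -nu by a natural number, and the surplus goes into the holomorphic factor.\<close>

lemma single_term_extension:
  assumes f: "f holomorphic_on ball c \<delta>" and q: "q holomorphic_on ball c \<delta>" and \<delta>: "\<delta> > 0"
    and Q: "\<And>z. z \<in> slit_disc c \<delta> \<Longrightarrow> Q z = \<nu> * (\<nu> + 1) / (z - c) ^ 2 + q z / (z - c)"
    and \<nu>: "2 * \<nu> = of_nat k"
    and sol: "solves_on (slit_disc c \<delta>) Q (\<lambda>z. (z - c) powr \<rho> * f z)"
  shows "\<exists>r u. 0 < r \<and> r \<le> \<delta> \<and> u holomorphic_on ball c r \<and>
           (\<forall>z\<in>slit_disc c r. (z - c) powr \<rho> * f z = (z - c) powr (- \<nu>) * u z)"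
proof (cases "\<exists>z\<in>ball c \<delta>. f z \<noteq> 0")
  case False
  thus ?thesis using \<delta> slit_disc_subset_ball[of c \<delta>] by (intro exI[of _ \<delta>] exI[of _ "\<lambda>_. 0"]) auto
next
  case True
  then obtain m g r where g: "0 < r" "r \<le> \<delta>" "g holomorphic_on ball c r"
    "\<And>z. z \<in> ball c r \<Longrightarrow> f z = (z - c) ^ m * g z" "\<And>z. z \<in> ball c r \<Longrightarrow> g z \<noteq> 0"
    using zero_factorization[OF f] by metis
  have eq: "(z - c) powr \<rho> * f z = (z - c) powr (\<rho> + of_nat m) * g z" if "z \<in> slit_disc c r" for z
  proof -
    have "z \<in> ball c r" "z - c \<noteq> 0" using that slit_disc_subset_ball[of c r] by auto
    thus ?thesis using g(4)[of z] by (simp add: powr_add_of_nat)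
  qed
  have "solves_on (slit_disc c r) Q (\<lambda>z. (z - c) powr (\<rho> + of_nat m) * g z)"
    by (rule solves_on_eqI[OF solves_on_subset[OF sol slit_disc_mono[OF g(2)]] open_slit_disc]) (simp add: eq)
  hence "(\<rho> + of_nat m) * (\<rho> + of_nat m - 1) = \<nu> * (\<nu> + 1)"
    by (rule indicial_equation[OF g(3) _ holomorphic_on_subset[OF q] g(1), rotated 3])
       (use g slit_disc_mono[OF g(2), of c] in \<open>auto intro!: Q\<close>)
  hence *: "\<rho> + of_nat m = - \<nu> \<or> \<rho> + of_nat m = \<nu> + 1"
    by (rule indicial_roots)
  have "of_nat (Suc k) = 2 * \<nu> + 1" by (simp add: \<nu>)
  hence "\<nu> + 1 = - \<nu> + of_nat (Suc k)" by simp
  with * have "\<rho> + of_nat m = - \<nu> + of_nat 0 \<or> \<rho> + of_nat m = - \<nu> + of_nat (Suc k)" by simp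
  then obtain l where l: "\<rho> + of_nat m = - \<nu> + of_nat l" by blast
  show ?thesis
  proof (intro exI[of _ r] exI[of _ "\<lambda>z. (z - c) ^ l * g z"] conjI ballI)
    show "(\<lambda>z. (z - c) ^ l * g z) holomorphic_on ball c r" by (intro holomorphic_intros g)
    fix z assume z: "z \<in> slit_disc c r"
    have "z - c \<noteq> 0" using z by (auto simp: slit_disc_def)
    thus "(z - c) powr \<rho> * f z = (z - c) powr (- \<nu>) * ((z - c) ^ l * g z)"
      by (simp only: eq[OF z] l powr_add_of_nat mult.assoc not_False_eq_True)
  qed (rule g(1), rule g(2))
qed

text \<open>Otherwise \<open>(z - c)\<^bsup>s\<^esup>\<close> with \<open>s \<noteq> 0\<close> would extend to a holomorphic function \<open>H\<close> with
  \<open>H c \<noteq> 0\<close>; but \<open>s H = (z - c) H'\<close>.\<close>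

lemma powr_independent:
  assumes f: "f1 holomorphic_on ball c \<delta>" "f2 holomorphic_on ball c \<delta>"
    and eq: "\<And>z. z \<in> slit_disc c \<delta> \<Longrightarrow> (z - c) powr \<rho>1 * f1 z + (z - c) powr \<rho>2 * f2 z = 0"
    and ni: "\<rho>1 - \<rho>2 \<notin> \<int>" and z: "z \<in> ball c \<delta>"
  shows "f1 z = 0"
proof (rule ccontr)
  assume "f1 z \<noteq> 0"
  hence nz1: "\<exists>z\<in>ball c \<delta>. f1 z \<noteq> 0" using z by blast
  have nz2: "\<exists>z\<in>ball c \<delta>. f2 z \<noteq> 0"
  proof (rule ccontr)
    assume "\<not> ?thesis"
    hence "f1 z = 0" if "z \<in> slit_disc c \<delta>" for z
      using eq[OF that] that slit_disc_subset_ball[of c \<delta>] by auto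
    hence "f1 z = 0"
      by (intro eq_on_ball_if_eq_on_slit_disc[OF f(1) holomorphic_on_const _ z, of 0])
    thus False using \<open>f1 z \<noteq> 0\<close> by simp
  qed
  obtain m1 g1 r1 where g1: "0 < r1" "r1 \<le> \<delta>" "g1 holomorphic_on ball c r1"
    "\<And>z. z \<in> ball c r1 \<Longrightarrow> f1 z = (z - c) ^ m1 * g1 z" "\<And>z. z \<in> ball c r1 \<Longrightarrow> g1 z \<noteq> 0"
    using zero_factorization[OF f(1) nz1] by metis
  obtain m2 g2 r2 where g2: "0 < r2" "r2 \<le> \<delta>" "g2 holomorphic_on ball c r2"
    "\<And>z. z \<in> ball c r2 \<Longrightarrow> f2 z = (z - c) ^ m2 * g2 z" "\<And>z. z \<in> ball c r2 \<Longrightarrow> g2 z \<noteq> 0"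
    using zero_factorization[OF f(2) nz2] by metis
  define r where "r = min r1 r2"
  have r: "r > 0" "r \<le> r1" "r \<le> r2" using g1 g2 by (auto simp: r_def)
  define s where "s = \<rho>1 + of_nat m1 - (\<rho>2 + of_nat m2)"
  define H where "H = (\<lambda>z. - g2 z / g1 z)"
  have H: "H holomorphic_on ball c r"
    unfolding H_def using g1 g2 r by (intro holomorphic_intros) (auto intro: holomorphic_on_subset)
  have Hs: "(z - c) powr s * 1 = H z" if z: "z \<in> slit_disc c r" for z
  proof -
    have z': "z \<in> ball c r1" "z \<in> ball c r2" "z - c \<noteq> 0" "z \<in> slit_disc c \<delta>"
      using z slit_disc_subset_ball[of c r] r g1(2) slit_disc_mono[of r \<delta> c] by auto
    have "(z - c) powr (\<rho>1 + of_nat m1) * g1 z = - ((z - c) powr (\<rho>2 + of_nat m2) * g2 z)"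
      using eq[OF z'(4)] g1(4)[OF z'(1)] g2(4)[OF z'(2)] z'(3)
      by (simp add: powr_add_of_nat eq_neg_iff_add_eq_0 mult.assoc)
    thus ?thesis unfolding s_def powr_diff H_def using g1(5)[OF z'(1)] z'(3)
      by (simp add: field_simps)
  qed
  have "s * H z = (z - c) * deriv H z" if z: "z \<in> slit_disc c r" for z
  proof -
    have zc: "z - c \<notin> \<real>\<^sub>\<le>\<^sub>0" using z by (auto simp: slit_disc_def)
    have "((\<lambda>z. (z - c) powr s * 1) has_field_derivative (z - c) powr s * (s / (z - c) * 1 + 0)) (at z)"
      by (rule has_field_derivative_powr_mult[OF zc DERIV_const])
    hence "(H has_field_derivative (z - c) powr s * (s / (z - c) * 1 + 0)) (at z)"
      by (rule has_field_derivative_transform_within_open[OF _ open_slit_disc z Hs])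
    moreover have "(H has_field_derivative deriv H z) (at z)"
      using z slit_disc_subset_ball[of c r] by (intro holomorphic_derivI[OF H open_ball]) auto
    ultimately have "deriv H z = (z - c) powr s * (s / (z - c) * 1 + 0)" by (rule DERIV_unique[symmetric])
    also have "\<dots> = s / (z - c) * H z" using Hs[OF z] by simp
    finally have *: "deriv H z = s / (z - c) * H z" .
    have "z - c \<noteq> 0" using zc by auto
    hence "(z - c) * (s / (z - c) * H z) = s * H z" by simp
    thus ?thesis unfolding * by (rule sym)
  qed
  moreover have "(\<lambda>z. s * H z) holomorphic_on ball c r" by (intro holomorphic_on_mult holomorphic_on_const H)
  moreover have "(\<lambda>z. (z - c) * deriv H z) holomorphic_on ball c r"
    by (intro holomorphic_on_mult holomorphic_on_diff holomorphic_on_ident holomorphic_on_const holomorphic_deriv H open_ball)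
  moreover have "c \<in> ball c r" using r(1) by simp
  ultimately have "s * H c = (c - c) * deriv H c"
    using eq_on_ball_if_eq_on_slit_disc[of "\<lambda>z. s * H z" c r "\<lambda>z. (z - c) * deriv H z" c] by blast
  hence "s * H c = 0" by simp
  moreover have "H c \<noteq> 0" using g1(5)[of c] g2(5)[of c] g1(1) g2(1) by (simp add: H_def)
  ultimately have "s = 0" unfolding mult_eq_0_iff by blast
  hence "\<rho>1 + of_nat m1 = \<rho>2 + of_nat m2" unfolding s_def by simp
  hence "\<rho>1 - \<rho>2 = of_nat m2 - of_nat m1" by (simp add: algebra_simps)
  hence "\<rho>1 - \<rho>2 \<in> \<int>" by simp
  thus False using ni by blast
qed

text \<open>If the two exponents differ by an integer, the terms merge into a single power.
  Otherwise \<open>powr_independent\<close>, applied to the residuals, makes each term a solution of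
  its own. Both cases end in \<open>single_term_extension\<close>.\<close>

lemma log_free_extension:
  assumes q: "q holomorphic_on ball c \<delta>" and \<delta>: "\<delta> > 0"
    and Q: "\<And>z. z \<in> slit_disc c \<delta> \<Longrightarrow> Q z = \<nu> * (\<nu> + 1) / (z - c) ^ 2 + q z / (z - c)"
    and \<nu>: "2 * \<nu> = of_nat k" and lf: "log_free_at Q c"
    and sol: "solves_on (slit_disc c \<delta>) Q w"
  shows "\<exists>r u. 0 < r \<and> r \<le> \<delta> \<and> u holomorphic_on ball c r \<and>
           (\<forall>z\<in>slit_disc c r. w z = (z - c) powr (- \<nu>) * u z)"
proof -
  from lf sol \<delta> obtain \<rho>1 \<rho>2 f1 f2 d where
    an: "f1 analytic_on {c}" "f2 analytic_on {c}" and d: "d > 0" "d \<le> \<delta>"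
    "\<And>z. z \<in> slit_disc c d \<Longrightarrow> w z = (z - c) powr \<rho>1 * f1 z + (z - c) powr \<rho>2 * f2 z"
    unfolding log_free_at_def by meson
  obtain e1 where e1: "e1 > 0" "f1 holomorphic_on ball c e1" using an(1) by (auto simp: analytic_on_def)
  obtain e2 where e2: "e2 > 0" "f2 holomorphic_on ball c e2" using an(2) by (auto simp: analytic_on_def)
  define e where "e = min d (min e1 e2)"
  have e: "e > 0" "e \<le> d" "e \<le> \<delta>" using d e1 e2 by (auto simp: e_def)
  have f: "f1 holomorphic_on ball c e" "f2 holomorphic_on ball c e"
    using e1 e2 by (auto simp: e_def intro: holomorphic_on_subset)
  have qe: "q holomorphic_on ball c e" using q by (rule holomorphic_on_subset) (use e in auto)
  have Qe: "Q z = \<nu> * (\<nu> + 1) / (z - c) ^ 2 + q z / (z - c)" if "z \<in> slit_disc c e" for z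
    using that slit_disc_mono[OF e(3), of c] by (auto intro!: Q)
  have weq: "w z = (z - c) powr \<rho>1 * f1 z + (z - c) powr \<rho>2 * f2 z" if "z \<in> slit_disc c e" for z
    using that slit_disc_mono[OF e(2), of c] by (auto intro!: d)
  have sole: "solves_on (slit_disc c e) Q w" by (rule solves_on_subset[OF sol slit_disc_mono[OF e(3)]])
  have single: ?thesis
    if h: "h holomorphic_on ball c e" and eq: "\<And>z. z \<in> slit_disc c e \<Longrightarrow> w z = (z - c) powr \<rho> * h z" for h \<rho>
  proof -
    have "solves_on (slit_disc c e) Q (\<lambda>z. (z - c) powr \<rho> * h z)"
      by (rule solves_on_eqI[OF sole open_slit_disc]) (simp add: eq)
    then obtain r u where ru: "0 < r" "r \<le> e" "u holomorphic_on ball c r"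
      "\<forall>z\<in>slit_disc c r. (z - c) powr \<rho> * h z = (z - c) powr (- \<nu>) * u z"
      using single_term_extension[OF h qe e(1) Qe \<nu>] by blast
    have "w z = (z - c) powr (- \<nu>) * u z" if "z \<in> slit_disc c r" for z
      using eq[of z] ru(4) that slit_disc_mono[OF ru(2), of c] by auto
    thus ?thesis using ru(1-3) e(3) by (intro exI[of _ r] exI[of _ u]) auto
  qed
  show ?thesis
  proof (cases "\<rho>1 - \<rho>2 \<in> \<int>")
    case True
    then obtain j where j: "\<rho>1 - \<rho>2 = of_int j" by (auto elim: Ints_cases)
    show ?thesis
    proof (cases "j \<ge> 0")
      case True
      hence \<rho>: "\<rho>1 = \<rho>2 + of_nat (nat j)" using j by (simp add: algebra_simps)
      have "w z = (z - c) powr \<rho>2 * ((z - c) ^ nat j * f1 z + f2 z)" if "z \<in> slit_disc c e" for z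
        unfolding weq[OF that] \<rho> using that by (subst powr_add_of_nat) (auto simp: slit_disc_def algebra_simps)
      thus ?thesis using f by (intro single[where h = "\<lambda>z. (z - c) ^ nat j * f1 z + f2 z" and \<rho> = \<rho>2] holomorphic_intros)
    next
      case False
      hence \<rho>: "\<rho>2 = \<rho>1 + of_nat (nat (- j))" using j by (simp add: algebra_simps)
      have "w z = (z - c) powr \<rho>1 * (f1 z + (z - c) ^ nat (- j) * f2 z)" if "z \<in> slit_disc c e" for z
        unfolding weq[OF that] \<rho> using that by (subst powr_add_of_nat) (auto simp: slit_disc_def algebra_simps)
      thus ?thesis using f by (intro single[where h = "\<lambda>z. f1 z + (z - c) ^ nat (- j) * f2 z" and \<rho> = \<rho>1] holomorphic_intros)
    qed
  next
    case False
    define \<kappa> where "\<kappa> = \<nu> * (\<nu> + 1)"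
    let ?E1 = "frobenius_op \<rho>1 \<kappa> q c f1" and ?E2 = "frobenius_op \<rho>2 \<kappa> q c f2"
    \<comment> \<open>The residual is linear in the solution, so the residuals of the two terms add
      up to that of \<open>w\<close>.\<close>
    have sum0: "(z - c) powr \<rho>1 * ?E1 z + (z - c) powr \<rho>2 * ?E2 z = 0" if z: "z \<in> slit_disc c e" for z
    proof -
      let ?w1 = "\<lambda>z. (z - c) powr \<rho>1 * f1 z" and ?w2 = "\<lambda>z. (z - c) powr \<rho>2 * f2 z"
      have d1: "((\<lambda>z. ?w1 z + ?w2 z) has_field_derivative deriv ?w1 z + deriv ?w2 z) (at z)"
        if "z \<in> slit_disc c e" for z
        by (intro DERIV_add holomorphic_derivI[OF holomorphic_powr_mult[OF f(1)] open_slit_disc that]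
              holomorphic_derivI[OF holomorphic_powr_mult[OF f(2)] open_slit_disc that])
      have "deriv (deriv (\<lambda>z. ?w1 z + ?w2 z)) z = deriv (deriv ?w1) z + deriv (deriv ?w2) z"
        by (rule deriv_deriv_eqI[OF open_slit_disc z d1, rotated])
           (intro DERIV_add deriv_powr_mult[OF f(1) z] deriv_powr_mult[OF f(2) z], assumption)
      moreover have "solves_on (slit_disc c e) Q (\<lambda>z. ?w1 z + ?w2 z)"
        by (rule solves_on_eqI[OF sole open_slit_disc]) (simp add: weq)
      ultimately have "deriv (deriv ?w1) z + deriv (deriv ?w2) z = Q z * (?w1 z + ?w2 z)"
        using z by (simp add: solves_on_def)
      hence "(deriv (deriv ?w1) z - (\<kappa> / (z - c) ^ 2 + q z / (z - c)) * ?w1 z) +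
             (deriv (deriv ?w2) z - (\<kappa> / (z - c) ^ 2 + q z / (z - c)) * ?w2 z) = 0"
        unfolding Qe[OF z] \<kappa>_def[symmetric] by (simp add: algebra_simps)
      hence "((z - c) powr \<rho>1 * ?E1 z + (z - c) powr \<rho>2 * ?E2 z) / (z - c) ^ 2 = 0"
        unfolding powr_solution_residual[OF f(1) z] powr_solution_residual[OF f(2) z]
        by (simp add: add_divide_distrib)
      moreover have "(z - c) ^ 2 \<noteq> 0" using z by (auto simp: slit_disc_def)
      ultimately show ?thesis unfolding divide_eq_0_iff by blast
    qed
    have E: "?E1 holomorphic_on ball c e" "?E2 holomorphic_on ball c e"
      by (intro holomorphic_frobenius_op f qe)+
    have Qk: "Q z = \<kappa> / (z - c) ^ 2 + q z / (z - c)" if "z \<in> slit_disc c e" for z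
      unfolding \<kappa>_def by (rule Qe[OF that])
    have ball: "z \<in> ball c e" if "z \<in> slit_disc c e" for z
      using that slit_disc_subset_ball[of c e] by blast
    have "\<forall>z\<in>slit_disc c e. ?E1 z = 0"
      using powr_independent[OF E sum0 False ball] by blast
    hence s1: "solves_on (slit_disc c e) Q (\<lambda>z. (z - c) powr \<rho>1 * f1 z)"
      by (rule powr_solution_iff[OF f(1) Qk, THEN iffD2, rotated])
    have ni: "\<rho>2 - \<rho>1 \<notin> \<int>" using False by (metis Ints_minus minus_diff_eq)
    have sum0': "(z - c) powr \<rho>2 * ?E2 z + (z - c) powr \<rho>1 * ?E1 z = 0" if "z \<in> slit_disc c e" for z
      by (subst add.commute) (rule sum0[OF that])
    have "\<forall>z\<in>slit_disc c e. ?E2 z = 0"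
      using powr_independent[OF E(2,1) sum0' ni ball] by blast
    hence s2: "solves_on (slit_disc c e) Q (\<lambda>z. (z - c) powr \<rho>2 * f2 z)"
      by (rule powr_solution_iff[OF f(2) Qk, THEN iffD2, rotated])
    obtain r1 u1 where u1: "0 < r1" "r1 \<le> e" "u1 holomorphic_on ball c r1"
      "\<forall>z\<in>slit_disc c r1. (z - c) powr \<rho>1 * f1 z = (z - c) powr (- \<nu>) * u1 z"
      using single_term_extension[OF f(1) qe e(1) Qe \<nu> s1] by blast
    obtain r2 u2 where u2: "0 < r2" "r2 \<le> e" "u2 holomorphic_on ball c r2"
      "\<forall>z\<in>slit_disc c r2. (z - c) powr \<rho>2 * f2 z = (z - c) powr (- \<nu>) * u2 z"
      using single_term_extension[OF f(2) qe e(1) Qe \<nu> s2] by blast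
    define r where "r = min r1 r2"
    have r: "r > 0" "r \<le> r1" "r \<le> r2" "r \<le> e" using u1 u2 by (auto simp: r_def)
    show ?thesis
    proof (intro exI[of _ r] exI[of _ "\<lambda>z. u1 z + u2 z"] conjI ballI)
      show "(\<lambda>z. u1 z + u2 z) holomorphic_on ball c r"
        using u1 u2 r by (intro holomorphic_intros) (auto intro: holomorphic_on_subset)
      fix z assume z: "z \<in> slit_disc c r"
      have "z \<in> slit_disc c r1" "z \<in> slit_disc c r2" "z \<in> slit_disc c e"
        using z slit_disc_mono[OF r(2), of c] slit_disc_mono[OF r(3), of c] slit_disc_mono[OF r(4), of c] by auto
      thus "w z = (z - c) powr (- \<nu>) * (u1 z + u2 z)"
        using weq u1(4) u2(4) by (simp add: algebra_simps)
    qed (use r e in auto)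
  qed
qed

section \<open>Entire solutions of the transformed equation\<close>

lemma glue_across_sphere:
  assumes f: "f holomorphic_on ball z0 r" and r: "r > 0"
    and ext: "\<And>c. dist z0 c = r \<Longrightarrow>
      \<exists>\<delta>>0. \<exists>g. g holomorphic_on ball c \<delta> \<and> (\<forall>z\<in>ball c \<delta> \<inter> ball z0 r. g z = f z)"
  shows "\<exists>r'>r. \<exists>F. F holomorphic_on ball z0 r' \<and> (\<forall>z\<in>ball z0 r. F z = f z)"
proof -
  obtain \<delta> g where \<delta>: "\<And>c. dist z0 c = r \<Longrightarrow> \<delta> c > 0"
    and g: "\<And>c. dist z0 c = r \<Longrightarrow> g c holomorphic_on ball c (\<delta> c)"
    and gf: "\<And>c z. dist z0 c = r \<Longrightarrow> z \<in> ball c (\<delta> c) \<Longrightarrow> z \<in> ball z0 r \<Longrightarrow> g c z = f z"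
    using ext by (metis IntI)
  define F where "F = (\<lambda>z. if z \<in> ball z0 r then f z
                   else g (SOME c. dist z0 c = r \<and> z \<in> ball c (\<delta> c)) z)"
  have F_eq: "F z = g c z" if c: "dist z0 c = r" and z: "z \<in> ball c (\<delta> c)" for c z
  proof (cases "z \<in> ball z0 r")
    case True
    thus ?thesis using gf[OF c z] by (simp add: F_def)
  next
    case False
    define c' where "c' = (SOME c. dist z0 c = r \<and> z \<in> ball c (\<delta> c))"
    have c': "dist z0 c' = r" "z \<in> ball c' (\<delta> c')"
      using someI[of "\<lambda>c. dist z0 c = r \<and> z \<in> ball c (\<delta> c)" c] c z by (auto simp: c'_def)
    let ?B = "ball c (\<delta> c) \<inter> ball c' (\<delta> c')"
    \<comment> \<open>Projection onto the closed disc does not increase the distance to any point of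
      the sphere. So \<open>x\<close> lies in both small discs, and their convex intersection meets
      the big disc, where both extensions agree with \<open>f\<close>.\<close>
    define x where "x = closest_point (cball z0 r) z"
    have near: "dist d x \<le> dist d z" if "dist z0 d = r" for d
      using closest_point_lipschitz[of "cball z0 r" d z] closest_point_self[of d "cball z0 r"] that r
      by (auto simp: x_def)
    have "x \<in> cball z0 r" unfolding x_def using r by (intro closest_point_in_set) auto
    hence "x \<in> closure (ball z0 r)" using r by simp
    moreover have "x \<in> ?B" using near[OF c] near[OF c'(1)] z c'(2) by auto
    ultimately have ne: "?B \<inter> ball z0 r \<noteq> {}"
      using open_Int_closure_eq_empty[of ?B "ball z0 r"] by blast
    have "g c z = g c' z"
    proof (rule analytic_continuation_open[of "?B \<inter> ball z0 r" ?B "g c" "g c'" z])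
      show "open (?B \<inter> ball z0 r)" "open ?B" by (intro open_Int open_ball)+
      show "connected ?B" by (intro convex_connected convex_Int convex_ball)
      show "g c holomorphic_on ?B" "g c' holomorphic_on ?B"
        using g[OF c] g[OF c'(1)] by (auto intro: holomorphic_on_subset)
    qed (use ne gf[OF c] gf[OF c'(1)] z c' in auto)
    thus ?thesis using False by (simp add: F_def c'_def)
  qed
  define W where "W = ball z0 r \<union> (\<Union>c\<in>sphere z0 r. ball c (\<delta> c))"
  have "F holomorphic_on (\<Union>c\<in>sphere z0 r. ball c (\<delta> c))"
  proof (rule holomorphic_on_UN_open)
    fix c assume "c \<in> sphere z0 r"
    hence c: "dist z0 c = r" by simp
    show "F holomorphic_on ball c (\<delta> c)"
      by (rule holomorphic_transform[OF g[OF c]]) (simp add: F_eq[OF c])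
  qed auto
  moreover have "F holomorphic_on ball z0 r"
    using holomorphic_cong[of "ball z0 r" "ball z0 r" F f] f by (simp add: F_def)
  ultimately have FW: "F holomorphic_on W"
    unfolding W_def by (intro holomorphic_on_Un) auto
  have "cball z0 r \<subseteq> W"
  proof
    fix z assume "z \<in> cball z0 r"
    hence "z \<in> ball z0 r \<or> dist z0 z = r" by auto
    moreover have "z \<in> sphere z0 r" "z \<in> ball z (\<delta> z)" if "dist z0 z = r"
      using that \<delta>[OF that] by auto
    ultimately show "z \<in> W" unfolding W_def by blast
  qed
  moreover have "open W" by (auto simp: W_def)
  ultimately obtain e where e: "e > 0" "(\<Union>x\<in>cball z0 r. ball x e) \<subseteq> W"
    using compact_subset_open_imp_ball_epsilon_subset[OF compact_cball] by metis
  have "ball z0 (r + e) \<subseteq> W"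
  proof
    fix z assume z: "z \<in> ball z0 (r + e)"
    \<comment> \<open>Contraction towards the centre by r / (r + e): \<open>x\<close> lands in the
      closed disc of radius r, at distance less than e from \<open>z\<close>.\<close>
    define x where "x = z0 + (r / (r + e)) *\<^sub>R (z - z0)"
    have "norm (x - z0) = (r / (r + e)) * norm (z - z0)" using r e by (simp add: x_def)
    also have "\<dots> \<le> (r / (r + e)) * (r + e)"
      using z r e by (intro mult_left_mono) (auto simp: dist_norm norm_minus_commute)
    finally have "x \<in> cball z0 r" using r e by (simp add: dist_norm norm_minus_commute)
    have "z - x = (1 - r / (r + e)) *\<^sub>R (z - z0)" by (simp add: x_def algebra_simps)
    also have "1 - r / (r + e) = e / (r + e)" using r e by (simp add: field_simps)
    finally have "norm (z - x) = (e / (r + e)) * norm (z - z0)" using r e by simp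
    also have "\<dots> < (e / (r + e)) * (r + e)"
      using z r e by (intro mult_strict_left_mono) (auto simp: dist_norm norm_minus_commute)
    finally have "z \<in> ball x e" using r e by (simp add: dist_norm norm_minus_commute)
    thus "z \<in> W" using e(2) \<open>x \<in> cball z0 r\<close> by blast
  qed
  hence "F holomorphic_on ball z0 (r + e)" using FW holomorphic_on_subset by blast
  thus ?thesis using e(1) by (intro exI[of _ "r + e"] conjI exI[of _ F]) (auto simp: F_def)
qed

text \<open>If the radius of convergence of the Taylor series were finite, the series would extend
  beyond it.\<close>

lemma entire_extension:
  assumes f: "f holomorphic_on ball z0 r0" and r0: "r0 > 0"
    and ext: "\<And>r F. r \<ge> r0 \<Longrightarrow> F holomorphic_on ball z0 r \<Longrightarrow> (\<And>z. z \<in> ball z0 r0 \<Longrightarrow> F z = f z) \<Longrightarrow>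
       \<exists>r'>r. \<exists>F'. F' holomorphic_on ball z0 r' \<and> (\<forall>z\<in>ball z0 r. F' z = F z)"
  shows "\<exists>F. F holomorphic_on UNIV \<and> (\<forall>z\<in>ball z0 r0. F z = f z)"
proof -
  define T where "T = fps_expansion f z0"
  define R where "R = fps_conv_radius T"
  define F where "F = (\<lambda>z. eval_fps T (z - z0))"
  have fe: "f holomorphic_on eball z0 (ereal r0)" using f by simp
  have R: "ereal r0 \<le> R" unfolding R_def T_def by (rule conv_radius_fps_expansion[OF fe])
  have Ff: "F z = f z" if "z \<in> ball z0 r0" for z
    unfolding F_def T_def by (rule eval_fps_expansion[OF fe]) (use that in simp)
  have Fhol: "F holomorphic_on eball z0 R"
  proof -
    have "(\<lambda>z. z - z0) ` eball z0 R \<subseteq> eball 0 (fps_conv_radius T)"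
      by (auto simp: R_def dist_norm norm_minus_commute)
    hence "(eval_fps T \<circ> (\<lambda>z. z - z0)) holomorphic_on eball z0 R"
      by (intro holomorphic_on_compose holomorphic_intros) auto
    thus ?thesis by (simp add: F_def o_def)
  qed
  show ?thesis
  proof (cases "R = \<infinity>")
    case True
    thus ?thesis using Fhol Ff by (intro exI[of _ F]) auto
  next
    case False
    with R obtain r where r: "R = ereal r" "r \<ge> r0" by (cases R) auto
    then obtain r' F' where F': "r' > r" "F' holomorphic_on ball z0 r'" "\<forall>z\<in>ball z0 r. F' z = F z"
      using ext[of r F] Fhol Ff by auto
    have "eventually (\<lambda>z. z \<in> ball z0 r0) (nhds z0)"
      using r0 by (intro eventually_nhds_in_open) auto
    hence "eventually (\<lambda>z. F' z = f z) (nhds z0)"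
      by eventually_elim (use F'(3) Ff r(2) in auto)
    hence "fps_expansion F' z0 = T" unfolding T_def by (rule fps_expansion_cong)
    moreover have "ereal r' \<le> fps_conv_radius (fps_expansion F' z0)"
      by (rule conv_radius_fps_expansion) (use F'(2) in simp)
    ultimately have "ereal r' \<le> R" by (simp add: R_def)
    thus ?thesis using r(1) F'(1) by simp
  qed
qed

text \<open>\<open>P\<close> is the set of poles and \<open>G\<close> the logarithmic derivative of
  a gauge factor, whose residue nu at a pole is minus the smaller exponent of w'' = Q w there.
  \<open>isolated_P\<close> speaks of every point of the plane, so \<open>P\<close> has no
  accumulation points.\<close>

locale apparent_singularities =
  fixes P :: "complex set" and G Q :: "complex \<Rightarrow> complex"
  assumes countable_P: "countable P"
    and isolated_P: "\<And>c. \<exists>\<delta>>0. \<forall>p\<in>P. p \<noteq> c \<longrightarrow> \<delta> \<le> dist c p"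
    and holG: "G holomorphic_on - P" and holQ: "Q holomorphic_on - P"
    and polar: "\<And>c. c \<in> P \<Longrightarrow> \<exists>\<nu> k \<delta> g q. 2 * \<nu> = of_nat k \<and> \<delta> > 0 \<and>
        g holomorphic_on ball c \<delta> \<and> q holomorphic_on ball c \<delta> \<and>
        (\<forall>z\<in>ball c \<delta> - {c}. G z = \<nu> / (z - c) + g z \<and> Q z = \<nu> * (\<nu> + 1) / (z - c) ^ 2 + q z / (z - c))"
    and log_free: "\<And>c. c \<in> P \<Longrightarrow> log_free_at Q c"
begin

text \<open>The equation for \<open>y = w g\<close>, where \<open>w'' = Q w\<close> and \<open>g' = G g\<close>. The points of \<open>P\<close> are
  removable singularities of its solutions, whereas \<open>w\<close> is in general multivalued.\<close>

definition ysol :: "complex set \<Rightarrow> (complex \<Rightarrow> complex) \<Rightarrow> bool" where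
  "ysol D y \<longleftrightarrow> y holomorphic_on D \<and>
     (\<forall>z\<in>D - P. deriv (deriv y) z = 2 * G z * deriv y z + (Q z + deriv G z - G z ^ 2) * y z)"

lemma ysol_subset: "ysol D y \<Longrightarrow> E \<subseteq> D \<Longrightarrow> ysol E y"
  unfolding ysol_def using holomorphic_on_subset by blast

lemma open_Compl_P: "open (- P)"
  unfolding open_dist
proof
  fix c assume c: "c \<in> - P"
  obtain d where d: "d > 0" "\<forall>\<omega>\<in>P. \<omega> \<noteq> c \<longrightarrow> d \<le> dist c \<omega>"
    using isolated_P by blast
  thus "\<exists>e>0. \<forall>y. dist y c < e \<longrightarrow> y \<in> - P"
    using c by (intro exI[of _ d]) (auto simp: dist_commute not_le[symmetric])
qed

lemma connected_minus_P: "open D \<Longrightarrow> connected D \<Longrightarrow> connected (D - P)"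
  by (intro connected_open_diff_countable countable_P) auto

lemma open_minus_P: "open D \<Longrightarrow> open (D - P)"
  using open_Compl_P by (simp add: Diff_eq open_Int)

lemma ysol_if_solves:
  assumes D: "open D" "D \<inter> P = {}"
    and g: "\<And>z. z \<in> D \<Longrightarrow> (g has_field_derivative G z * g z) (at z)"
    and w: "solves_on D Q w"
  shows "ysol D (\<lambda>z. w z * g z)"
proof -
  have d1: "((\<lambda>z. w z * g z) has_field_derivative deriv w z * g z + (G z * g z) * w z) (at z)" if "z \<in> D" for z
    by (rule DERIV_mult[OF solves_onD(1)[OF w D(1) that] g[OF that]])
  have dd: "deriv (deriv (\<lambda>z. w z * g z)) z = 2 * G z * deriv (\<lambda>z. w z * g z) z +
             (Q z + deriv G z - G z ^ 2) * (w z * g z)" if z: "z \<in> D" for z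
  proof -
    have dG: "(G has_field_derivative deriv G z) (at z)"
      using z D by (intro holomorphic_derivI[OF holG open_Compl_P]) auto
    have "deriv (deriv (\<lambda>z. w z * g z)) z =
       ((Q z * w z) * g z + (G z * g z) * deriv w z) +
       ((deriv G z * g z + (G z * g z) * G z) * w z + deriv w z * (G z * g z))"
      by (rule deriv_deriv_eqI[OF D(1) z d1], assumption)
         (intro DERIV_add DERIV_mult solves_onD[OF w D(1) z] g[OF z] dG)
    thus ?thesis unfolding DERIV_imp_deriv[OF d1[OF z]] by (simp add: algebra_simps power2_eq_square)
  qed
  have "(\<lambda>z. w z * g z) holomorphic_on D" unfolding holomorphic_on_open[OF D(1)] using d1 by blast
  thus ?thesis using dd by (simp add: ysol_def)
qed

lemma solves_if_ysol:
  assumes D: "open D" "D \<inter> P = {}"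
    and g: "\<And>z. z \<in> D \<Longrightarrow> (g has_field_derivative G z * g z) (at z)" "\<And>z. z \<in> D \<Longrightarrow> g z \<noteq> 0"
    and y: "ysol D y"
  shows "solves_on D Q (\<lambda>z. y z / g z)"
proof -
  have yd: "(y has_field_derivative deriv y z) (at z)"
    "(deriv y has_field_derivative deriv (deriv y) z) (at z)" if "z \<in> D" for z
    using y that D(1) unfolding ysol_def
    by (auto intro: holomorphic_derivI holomorphic_derivI[OF holomorphic_deriv])
  have d1: "((\<lambda>z. y z / g z) has_field_derivative (deriv y z - G z * y z) / g z) (at z)" if "z \<in> D" for z
    by (rule DERIV_cong[OF DERIV_divide[OF yd(1) g]])
       (use that g(2)[OF that] in \<open>auto simp: divide_simps algebra_simps\<close>)
  show ?thesis
  proof (rule solves_onI[OF D(1) d1])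
    fix z assume z: "z \<in> D"
    have dG: "(G has_field_derivative deriv G z) (at z)"
      using z D by (intro holomorphic_derivI[OF holG open_Compl_P]) auto
    have eq: "deriv (deriv y) z = 2 * G z * deriv y z + (Q z + deriv G z - G z ^ 2) * y z"
      using y z D(2) unfolding ysol_def by blast
    have "((\<lambda>z. (deriv y z - G z * y z) / g z) has_field_derivative
        ((deriv (deriv y) z - (deriv G z * y z + deriv y z * G z)) * g z - (deriv y z - G z * y z) * (G z * g z)) /
         (g z * g z)) (at z)"
      by (intro DERIV_divide DERIV_diff DERIV_mult yd dG g z)
    also have "((deriv (deriv y) z - (deriv G z * y z + deriv y z * G z)) * g z - (deriv y z - G z * y z) * (G z * g z)) /
         (g z * g z) = ((deriv (deriv y) z - (deriv G z * y z + deriv y z * G z)) - (deriv y z - G z * y z) * G z) / g z"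
      using g(2)[OF z] by (simp add: divide_simps) (simp add: algebra_simps)
    also have "\<dots> = Q z * (y z / g z)"
      unfolding eq by (simp add: algebra_simps power2_eq_square)
    finally show "((\<lambda>z. (deriv y z - G z * y z) / g z) has_field_derivative Q z * (y z / g z)) (at z)" .
  qed
qed

lemma gauge_ball:
  assumes "ball c \<delta> \<inter> P = {}" "\<delta> > 0"
  obtains g where "g c = 1" "\<And>z. z \<in> ball c \<delta> \<Longrightarrow> (g has_field_derivative G z * g z) (at z)" "\<And>z. g z \<noteq> 0"
proof -
  have "G holomorphic_on ball c \<delta>" using assms holG by (auto intro: holomorphic_on_subset)
  then obtain \<Gamma> where \<Gamma>: "\<Gamma> c = 0" "\<And>z. z \<in> ball c \<delta> \<Longrightarrow> (\<Gamma> has_field_derivative G z) (at z)"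
    using starlike_primitive[of "ball c \<delta>" c G] assms(2)
    by (metis centre_in_ball closed_segment_subset convex_ball open_ball)
  show ?thesis
    by (rule that[of "\<lambda>z. exp (\<Gamma> z)"])
       (use \<Gamma> in \<open>auto intro!: derivative_eq_intros\<close>)
qed

text \<open>Away from \<open>P\<close> a local gauge factor identifies \<open>ysol\<close> with the
  equation w'' = Q w, so existence and the Wronskian argument carry over.\<close>

lemma regular_local:
  assumes c: "c \<notin> P"
  obtains \<delta> Y1 Y2 where "\<delta> > 0" "ball c \<delta> \<inter> P = {}" "ysol (ball c \<delta>) Y1" "ysol (ball c \<delta>) Y2"
    "Y1 c = 1" "deriv Y1 c = 0" "Y2 c = 0" "deriv Y2 c = 1"
    "\<And>D y. open D \<Longrightarrow> connected D \<Longrightarrow> D \<subseteq> ball c \<delta> \<Longrightarrow> ysol D y \<Longrightarrow>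
        \<exists>c1 c2. \<forall>z\<in>D. y z = c1 * Y1 z + c2 * Y2 z"
proof -
  obtain \<delta> where \<delta>: "\<delta> > 0" "\<forall>p\<in>P. p \<noteq> c \<longrightarrow> \<delta> \<le> dist c p" using isolated_P by blast
  have disj: "ball c \<delta> \<inter> P = {}" using \<delta> c by force
  obtain g where g: "g c = 1" "\<And>z. z \<in> ball c \<delta> \<Longrightarrow> (g has_field_derivative G z * g z) (at z)" "\<And>z. g z \<noteq> 0"
    using gauge_ball[OF disj \<delta>(1)] by metis
  have Qh: "Q holomorphic_on ball c \<delta>" using disj holQ by (auto intro: holomorphic_on_subset)
  have cb: "c \<in> ball c \<delta>" using \<delta> by simp
  have seg: "closed_segment c z \<subseteq> ball c \<delta>" if "z \<in> ball c \<delta>" for z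
    using that cb by (intro closed_segment_subset convex_ball)
  note ex = ode_existence[OF open_ball cb seg Qh]
  \<comment> \<open>The slope \<open>- G c\<close> cancels the derivative of the gauge factor, so
    that \<open>Y1\<close> has derivative 0 at \<open>c\<close>.\<close>
  obtain w1 where w1: "solves_on (ball c \<delta>) Q w1" "w1 c = 1" "deriv w1 c = - G c"
    using ex[of 1 "- G c"] by blast
  obtain w2 where w2: "solves_on (ball c \<delta>) Q w2" "w2 c = 0" "deriv w2 c = 1"
    using ex[of 0 1] by blast
  have dw: "deriv (\<lambda>z. w z * g z) c = deriv w c + G c * w c" if "solves_on (ball c \<delta>) Q w" for w
    using DERIV_imp_deriv[OF DERIV_mult[OF solves_onD(1)[OF that open_ball cb] g(2)[OF cb]]] g(1) by simp
  show ?thesis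
  proof (rule that[OF \<delta>(1) disj ysol_if_solves[OF open_ball disj g(2) w1(1)] ysol_if_solves[OF open_ball disj g(2) w2(1)]])
    show "w1 c * g c = 1" "deriv (\<lambda>z. w1 z * g z) c = 0" "w2 c * g c = 0" "deriv (\<lambda>z. w2 z * g z) c = 1"
      using w1 w2 g(1) dw by auto
    fix D y assume D: "open D" "connected D" "D \<subseteq> ball c \<delta>" and y: "ysol D y"
    have "solves_on D Q (\<lambda>z. y z / g z)"
      using D(3) disj by (intro solves_if_ysol[OF D(1) _ g(2) g(3) y]) auto
    moreover have "w1 c * deriv w2 c - deriv w1 c * w2 c \<noteq> 0" using w1 w2 by simp
    ultimately obtain c1 c2 where "\<forall>z\<in>D. y z / g z = c1 * w1 z + c2 * w2 z"
      using solution_combination[OF open_ball connected_ball w1(1) w2(1) cb _ D] by blast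
    hence "\<forall>z\<in>D. y z = c1 * (w1 z * g z) + c2 * (w2 z * g z)"
      using g(3) by (simp add: field_simps)
    thus "\<exists>c1 c2. \<forall>z\<in>D. y z = c1 * (w1 z * g z) + c2 * (w2 z * g z)" by blast
  qed assumption
qed

lemma gauge_slit_disc:
  assumes g: "g holomorphic_on ball c \<delta>" and \<delta>: "\<delta> > 0"
    and G: "\<And>z. z \<in> ball c \<delta> - {c} \<Longrightarrow> G z = \<nu> / (z - c) + g z"
  obtains \<gamma> where "\<gamma> holomorphic_on ball c \<delta>"
    "\<And>z. z \<in> slit_disc c \<delta> \<Longrightarrow>
       ((\<lambda>z. (z - c) powr \<nu> * exp (\<gamma> z)) has_field_derivative G z * ((z - c) powr \<nu> * exp (\<gamma> z))) (at z)"
proof -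
  have "\<exists>\<gamma>. \<gamma> c = 0 \<and> (\<forall>z\<in>ball c \<delta>. (\<gamma> has_field_derivative g z) (at z))"
    using \<delta> by (intro starlike_primitive g open_ball closed_segment_subset convex_ball) auto
  then obtain \<gamma> where \<gamma>: "\<And>z. z \<in> ball c \<delta> \<Longrightarrow> (\<gamma> has_field_derivative g z) (at z)" by blast
  show ?thesis
  proof (rule that[of \<gamma>])
    show "\<gamma> holomorphic_on ball c \<delta>" unfolding holomorphic_on_open[OF open_ball] using \<gamma> by blast
    fix z assume z: "z \<in> slit_disc c \<delta>"
    have zz: "z - c \<notin> \<real>\<^sub>\<le>\<^sub>0" "z \<in> ball c \<delta> - {c}"
      using z slit_disc_subset_ball[of c \<delta>] by (auto simp: slit_disc_def)
    have "((\<lambda>z. exp (\<gamma> z)) has_field_derivative exp (\<gamma> z) * g z) (at z)"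
      using zz by (intro DERIV_chain2[OF DERIV_exp] \<gamma>) auto
    from has_field_derivative_powr_mult[OF zz(1) this, of \<nu>]
    show "((\<lambda>z. (z - c) powr \<nu> * exp (\<gamma> z)) has_field_derivative G z * ((z - c) powr \<nu> * exp (\<gamma> z))) (at z)"
      unfolding G[OF zz(2)] by (simp add: algebra_simps)
  qed
qed

text \<open>Both basis solutions on the slit disc are (z - c)^(-nu) times holomorphic functions, and
  the gauge factor (z - c)^nu exp(gamma) removes the power. Hence \<open>Y1\<close> and
  \<open>Y2\<close> are holomorphic at \<open>c\<close> although \<open>G\<close> and
  \<open>Q\<close> may have poles there.\<close>

lemma singular_local:
  assumes c: "c \<in> P"
  obtains \<delta> Y1 Y2 where "\<delta> > 0" "Y1 holomorphic_on ball c \<delta>" "Y2 holomorphic_on ball c \<delta>"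
    "\<And>D y. open D \<Longrightarrow> connected D \<Longrightarrow> D \<noteq> {} \<Longrightarrow> D \<subseteq> ball c \<delta> - {c} \<Longrightarrow> ysol D y \<Longrightarrow>
        \<exists>c1 c2. \<forall>z\<in>D. y z = c1 * Y1 z + c2 * Y2 z"
proof -
  obtain \<nu> k \<delta>0 g q where \<nu>: "2 * \<nu> = of_nat k" and \<delta>0: "\<delta>0 > 0"
    and hol: "g holomorphic_on ball c \<delta>0" "q holomorphic_on ball c \<delta>0"
    and GQ: "\<And>z. z \<in> ball c \<delta>0 - {c} \<Longrightarrow> G z = \<nu> / (z - c) + g z"
      "\<And>z. z \<in> ball c \<delta>0 - {c} \<Longrightarrow> Q z = \<nu> * (\<nu> + 1) / (z - c) ^ 2 + q z / (z - c)"
    using polar[OF c] by metis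
  obtain \<delta>1 where \<delta>1: "\<delta>1 > 0" "\<forall>p\<in>P. p \<noteq> c \<longrightarrow> \<delta>1 \<le> dist c p" using isolated_P by blast
  define \<epsilon> where "\<epsilon> = min \<delta>0 \<delta>1"
  have \<epsilon>: "\<epsilon> > 0" "\<epsilon> \<le> \<delta>0" using \<delta>0 \<delta>1 by (auto simp: \<epsilon>_def)
  have PB: "p = c" if "p \<in> P" "p \<in> ball c \<epsilon>" for p using that \<delta>1 by (force simp: \<epsilon>_def)
  let ?S = "slit_disc c \<epsilon>"
  have SP: "?S \<inter> P = {}" using PB slit_disc_subset_ball[of c \<epsilon>] by blast
  have S0: "?S \<subseteq> ball c \<delta>0 - {c}" using slit_disc_subset_ball[of c \<epsilon>] \<epsilon> by force
  obtain \<gamma> where \<gamma>: "\<gamma> holomorphic_on ball c \<delta>0" "\<And>z. z \<in> slit_disc c \<delta>0 \<Longrightarrow>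
      ((\<lambda>z. (z - c) powr \<nu> * exp (\<gamma> z)) has_field_derivative G z * ((z - c) powr \<nu> * exp (\<gamma> z))) (at z)"
    using gauge_slit_disc[OF hol(1) \<delta>0 GQ(1)] by blast
  define e where "e = (\<lambda>z. (z - c) powr \<nu> * exp (\<gamma> z))"
  have ed: "(e has_field_derivative G z * e z) (at z)" if "z \<in> ?S" for z
    unfolding e_def using that slit_disc_mono[OF \<epsilon>(2), of c] by (intro \<gamma>(2)) auto
  have e0: "e z \<noteq> 0" if "z \<in> ?S" for z using that by (auto simp: e_def slit_disc_def)
  define a where "a = c + of_real (\<epsilon> / 2)"
  have aS: "a \<in> ?S" unfolding a_def by (rule slit_disc_centre[OF \<epsilon>(1)])
  have Qh: "Q holomorphic_on ?S" using SP holQ by (auto intro: holomorphic_on_subset)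
  have seg: "closed_segment a z \<subseteq> ?S" if "z \<in> ?S" for z
    unfolding a_def by (rule slit_disc_starlike[OF that \<epsilon>(1)])
  note ex = ode_existence[OF open_slit_disc aS seg Qh]
  obtain w1 where w1: "solves_on ?S Q w1" "w1 a = 1" "deriv w1 a = 0" using ex[of 1 0] by blast
  obtain w2 where w2: "solves_on ?S Q w2" "w2 a = 0" "deriv w2 a = 1" using ex[of 0 1] by blast
  have lf: "\<exists>r u. 0 < r \<and> r \<le> \<epsilon> \<and> u holomorphic_on ball c r \<and>
           (\<forall>z\<in>slit_disc c r. w z = (z - c) powr (- \<nu>) * u z)" if "solves_on ?S Q w" for w
  proof (rule log_free_extension[OF _ \<epsilon>(1) _ \<nu> log_free[OF c] that])
    show "q holomorphic_on ball c \<epsilon>" using \<epsilon> by (intro holomorphic_on_subset[OF hol(2)]) auto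
    show "Q z = \<nu> * (\<nu> + 1) / (z - c) ^ 2 + q z / (z - c)" if "z \<in> ?S" for z
      using S0 that by (intro GQ(2)) auto
  qed
  obtain r1 u1 where u1: "0 < r1" "r1 \<le> \<epsilon>" "u1 holomorphic_on ball c r1"
    "\<forall>z\<in>slit_disc c r1. w1 z = (z - c) powr (- \<nu>) * u1 z" using lf[OF w1(1)] by blast
  obtain r2 u2 where u2: "0 < r2" "r2 \<le> \<epsilon>" "u2 holomorphic_on ball c r2"
    "\<forall>z\<in>slit_disc c r2. w2 z = (z - c) powr (- \<nu>) * u2 z" using lf[OF w2(1)] by blast
  define \<delta> where "\<delta> = min r1 r2"
  have \<delta>: "\<delta> > 0" "\<delta> \<le> r1" "\<delta> \<le> r2" "\<delta> \<le> \<epsilon>" using u1 u2 by (auto simp: \<delta>_def)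
  define Y1 where "Y1 = (\<lambda>z. u1 z * exp (\<gamma> z))"
  define Y2 where "Y2 = (\<lambda>z. u2 z * exp (\<gamma> z))"
  have \<gamma>h: "\<gamma> holomorphic_on ball c \<delta>" by (rule holomorphic_on_subset[OF \<gamma>(1)]) (use \<delta> \<epsilon> in auto)
  have Yh: "Y1 holomorphic_on ball c \<delta>" "Y2 holomorphic_on ball c \<delta>"
    unfolding Y1_def Y2_def using u1 u2 \<delta> by (auto intro!: holomorphic_intros \<gamma>h intro: holomorphic_on_subset)
  have Yw: "w1 z * e z = Y1 z" "w2 z * e z = Y2 z" if "z \<in> slit_disc c \<delta>" for z
  proof -
    have z: "z \<in> slit_disc c r1" "z \<in> slit_disc c r2" "z - c \<noteq> 0"
      using that slit_disc_mono[OF \<delta>(2), of c] slit_disc_mono[OF \<delta>(3), of c] by (auto simp: slit_disc_def)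
    have "(z - c) powr (- \<nu>) * (z - c) powr \<nu> = 1" using z(3) by (simp flip: powr_add)
    thus "w1 z * e z = Y1 z" "w2 z * e z = Y2 z"
      using u1(4) u2(4) z by (auto simp: e_def Y1_def Y2_def algebra_simps)
  qed
  show ?thesis
  proof (rule that[OF \<delta>(1) Yh])
    fix D y assume D: "open D" "connected D" "D \<noteq> {}" "D \<subseteq> ball c \<delta> - {c}" and y: "ysol D y"
    \<comment> \<open>\<open>D\<close> may meet the slit; a small vertical displacement leaves
      it.\<close>
    obtain z1 where z1: "z1 \<in> D \<inter> slit_disc c \<delta>"
    proof -
      obtain z where z: "z \<in> D" using D(3) by blast
      then obtain \<rho> where \<rho>: "\<rho> > 0" "ball z \<rho> \<subseteq> D" using D(1) open_contains_ball by blast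
      show ?thesis
      proof (cases "z - c \<in> \<real>\<^sub>\<le>\<^sub>0")
        case False
        thus ?thesis using that[of z] z D(4) by (auto simp: slit_disc_def)
      next
        case True
        define x where "x = z + \<i> * of_real (\<rho> / 2)"
        have "x \<in> ball z \<rho>" using \<rho> by (simp add: x_def dist_norm norm_mult)
        hence "x \<in> D" using \<rho> by blast
        moreover have "x - c \<notin> \<real>\<^sub>\<le>\<^sub>0" using True \<rho>(1) by (auto simp: x_def complex_nonpos_Reals_iff)
        ultimately show ?thesis using that[of x] D(4) by (auto simp: slit_disc_def)
      qed
    qed
    have "open (D \<inter> slit_disc c \<delta>)" using D(1) open_slit_disc by blast
    then obtain \<rho> where \<rho>: "\<rho> > 0" "ball z1 \<rho> \<subseteq> D \<inter> slit_disc c \<delta>"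
      using z1 open_contains_ball by blast
    have BS: "ball z1 \<rho> \<subseteq> ?S" using \<rho>(2) slit_disc_mono[OF \<delta>(4), of c] by blast
    have "solves_on (ball z1 \<rho>) Q (\<lambda>z. y z / e z)"
    proof (rule solves_if_ysol)
      show "ball z1 \<rho> \<inter> P = {}" using BS SP by blast
      show "ysol (ball z1 \<rho>) y" using \<rho>(2) by (intro ysol_subset[OF y]) auto
    qed (use BS ed e0 in auto)
    moreover have "w1 a * deriv w2 a - deriv w1 a * w2 a \<noteq> 0" using w1 w2 by simp
    ultimately obtain c1 c2 where c12: "\<forall>z\<in>ball z1 \<rho>. y z / e z = c1 * w1 z + c2 * w2 z"
      using solution_combination[OF open_slit_disc connected_slit_disc w1(1) w2(1) aS _ open_ball connected_ball BS]
      by blast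
    have loc: "y z = c1 * Y1 z + c2 * Y2 z" if z: "z \<in> ball z1 \<rho>" for z
    proof -
      have "z \<in> slit_disc c \<delta>" "e z \<noteq> 0" using z \<rho>(2) BS e0 by auto
      moreover have "y z / e z = c1 * w1 z + c2 * w2 z" using c12 z by blast
      ultimately show ?thesis unfolding Yw(1)[OF \<open>z \<in> slit_disc c \<delta>\<close>, symmetric] Yw(2)[OF \<open>z \<in> slit_disc c \<delta>\<close>, symmetric]
        by (simp add: field_simps)
    qed
    \<comment> \<open>The relation spreads from a small disc to all of \<open>D\<close>, even across
      the slit, because \<open>Y1\<close> and \<open>Y2\<close> are holomorphic there.\<close>
    have "y z = c1 * Y1 z + c2 * Y2 z" if "z \<in> D" for z
    proof (rule analytic_continuation_open[of "ball z1 \<rho>" D y "\<lambda>z. c1 * Y1 z + c2 * Y2 z"])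
      show "y holomorphic_on D" using y by (simp add: ysol_def)
      show "(\<lambda>z. c1 * Y1 z + c2 * Y2 z) holomorphic_on D"
        using Yh D(4) by (intro holomorphic_intros) (auto intro: holomorphic_on_subset)
    qed (use D \<rho> loc that in auto)
    thus "\<exists>c1 c2. \<forall>z\<in>D. y z = c1 * Y1 z + c2 * Y2 z" by blast
  qed
qed

text \<open>Permanence of the equation: both sides are holomorphic on \<open>D - P\<close>, which
  stays connected because \<open>P\<close> is countable.\<close>

lemma ysol_continuation:
  assumes D: "open D" "connected D" and E: "open E" "E \<noteq> {}" "E \<subseteq> D"
    and y: "y holomorphic_on D" and yE: "ysol E y"
  shows "ysol D y"
  unfolding ysol_def
proof (intro conjI ballI y)
  fix z assume z: "z \<in> D - P"
  have DP: "open (D - P)" "connected (D - P)" "open (E - P)"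
    using D E by (auto intro: open_minus_P connected_minus_P)
  \<comment> \<open>Otherwise the countable set \<open>P\<close> would contain a disc.\<close>
  have "E - P \<noteq> {}"
  proof
    assume "E - P = {}"
    hence "E \<subseteq> P" by blast
    moreover obtain x r where "r > 0" "ball x r \<subseteq> E" using E(1,2) open_contains_ball by blast
    ultimately show False
      using uncountable_ball[of r x] countable_subset[OF _ countable_P, of "ball x r"] by blast
  qed
  have h: "y holomorphic_on D - P" "deriv y holomorphic_on D - P" "deriv (deriv y) holomorphic_on D - P"
    using holomorphic_on_subset[OF y, of "D - P"] DP(1) by (auto intro: holomorphic_deriv)
  have GQ: "G holomorphic_on D - P" "deriv G holomorphic_on D - P" "Q holomorphic_on D - P"
    using holomorphic_on_subset[OF holG, of "D - P"] holomorphic_on_subset[OF holQ, of "D - P"] DP(1)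
    by (auto intro: holomorphic_deriv)
  show "deriv (deriv y) z = 2 * G z * deriv y z + (Q z + deriv G z - G z ^ 2) * y z"
    by (rule analytic_continuation_open[OF DP(3,1) \<open>E - P \<noteq> {}\<close> DP(2), where f = "deriv (deriv y)"
        and g = "\<lambda>z. 2 * G z * deriv y z + (Q z + deriv G z - G z ^ 2) * y z"])
       (use E(3) yE z h GQ in \<open>auto simp: ysol_def intro!: holomorphic_intros\<close>)
qed

text \<open>Convexity of \<open>D\<close> makes its part near \<open>c\<close> connected, so one
  pair of coefficients describes \<open>y\<close> there. The basis functions are holomorphic on the
  full disc around \<open>c\<close> and provide the extension, even at points of
  \<open>P\<close>.\<close>

lemma local_extension:
  assumes D: "open D" "convex D" "D \<noteq> {}" and c: "c \<notin> D" and y: "ysol D y"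
    and cl: "c \<in> closure D"
  shows "\<exists>\<delta>>0. \<exists>g. g holomorphic_on ball c \<delta> \<and> (\<forall>z\<in>ball c \<delta> \<inter> D. g z = y z)"
proof (cases "c \<in> P")
  case True
  then obtain \<delta> Y1 Y2 where Y: "\<delta> > 0" "Y1 holomorphic_on ball c \<delta>" "Y2 holomorphic_on ball c \<delta>"
    "\<And>D y. open D \<Longrightarrow> connected D \<Longrightarrow> D \<noteq> {} \<Longrightarrow> D \<subseteq> ball c \<delta> - {c} \<Longrightarrow> ysol D y \<Longrightarrow>
        \<exists>c1 c2. \<forall>z\<in>D. y z = c1 * Y1 z + c2 * Y2 z"
    using singular_local by metis
  have ne: "ball c \<delta> \<inter> D \<noteq> {}"
    using cl Y(1) open_Int_closure_eq_empty[of "ball c \<delta>" D] centre_in_ball[of c \<delta>] by blast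
  obtain c1 c2 where c12: "\<forall>z\<in>ball c \<delta> \<inter> D. y z = c1 * Y1 z + c2 * Y2 z"
    using Y(4)[of "ball c \<delta> \<inter> D" y] D c ne ysol_subset[OF y, of "ball c \<delta> \<inter> D"]
    by (auto simp: convex_Int convex_connected)
  have "(\<lambda>z. c1 * Y1 z + c2 * Y2 z) holomorphic_on ball c \<delta>" using Y by (intro holomorphic_intros)
  with c12 Y(1) show ?thesis by (intro exI[of _ \<delta>] conjI exI[of _ "\<lambda>z. c1 * Y1 z + c2 * Y2 z"]) auto
next
  case False
  then obtain \<delta> Y1 Y2 where Y: "\<delta> > 0" "ysol (ball c \<delta>) Y1" "ysol (ball c \<delta>) Y2"
    "\<And>D y. open D \<Longrightarrow> connected D \<Longrightarrow> D \<subseteq> ball c \<delta> \<Longrightarrow> ysol D y \<Longrightarrow>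
        \<exists>c1 c2. \<forall>z\<in>D. y z = c1 * Y1 z + c2 * Y2 z"
    using regular_local by metis
  obtain c1 c2 where c12: "\<forall>z\<in>ball c \<delta> \<inter> D. y z = c1 * Y1 z + c2 * Y2 z"
    using Y(4)[of "ball c \<delta> \<inter> D" y] D ysol_subset[OF y, of "ball c \<delta> \<inter> D"]
    by (auto simp: convex_Int convex_connected)
  have "(\<lambda>z. c1 * Y1 z + c2 * Y2 z) holomorphic_on ball c \<delta>"
    using Y(2,3) by (intro holomorphic_intros) (auto simp: ysol_def)
  with c12 Y(1) show ?thesis by (intro exI[of _ \<delta>] conjI exI[of _ "\<lambda>z. c1 * Y1 z + c2 * Y2 z"]) auto
qed

text \<open>A holomorphic extension to a larger disc is again a solution by
  \<open>ysol_continuation\<close>, and therefore continues past each boundary point by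
  \<open>local_extension\<close>. This is the induction-like hypothesis of
  \<open>entire_extension\<close>.\<close>

lemma ysol_entire_extension:
  assumes r0: "r0 > 0" and y: "ysol (ball z0 r0) y"
  obtains Y where "ysol UNIV Y" "\<And>z. z \<in> ball z0 r0 \<Longrightarrow> Y z = y z"
proof -
  have yh: "y holomorphic_on ball z0 r0" using y by (simp add: ysol_def)
  have cong: "ysol (ball z0 r0) F" if "\<And>z. z \<in> ball z0 r0 \<Longrightarrow> F z = y z" for F
    unfolding ysol_def
  proof (intro conjI ballI)
    show "F holomorphic_on ball z0 r0" by (rule holomorphic_transform[OF yh]) (simp add: that)
    fix z assume z: "z \<in> ball z0 r0 - P"
    have ev: "eventually (\<lambda>z. F z = y z) (nhds z)"
      by (rule eventually_mono[OF eventually_nhds_in_open[OF open_ball, of z z0 r0]]) (use z that in auto)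
    have "deriv F z = deriv y z" "deriv (deriv F) z = deriv (deriv y) z" "F z = y z"
      using deriv_cong_ev[OF ev refl] higher_deriv_cong_ev[OF ev refl, of 2] z that
      by (auto simp: numeral_2_eq_2)
    thus "deriv (deriv F) z = 2 * G z * deriv F z + (Q z + deriv G z - G z ^ 2) * F z"
      using y z by (simp add: ysol_def)
  qed
  have "\<exists>F. F holomorphic_on UNIV \<and> (\<forall>z\<in>ball z0 r0. F z = y z)"
  proof (rule entire_extension[OF yh r0])
    fix r F assume r: "r \<ge> r0" and F: "F holomorphic_on ball z0 r" and eq: "\<And>z. z \<in> ball z0 r0 \<Longrightarrow> F z = y z"
    have yF: "ysol (ball z0 r) F"
      by (rule ysol_continuation[OF open_ball connected_ball open_ball _ _ F cong[OF eq]]) (use r r0 in auto)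
    show "\<exists>r'>r. \<exists>F'. F' holomorphic_on ball z0 r' \<and> (\<forall>z\<in>ball z0 r. F' z = F z)"
    proof (rule glue_across_sphere[OF F])
      fix c assume c: "dist z0 c = r"
      show "\<exists>\<delta>>0. \<exists>g. g holomorphic_on ball c \<delta> \<and> (\<forall>z\<in>ball c \<delta> \<inter> ball z0 r. g z = F z)"
        by (rule local_extension[OF open_ball convex_ball _ _ yF]) (use c r r0 in auto)
    qed (use r r0 in auto)
  qed
  then obtain F where F: "F holomorphic_on UNIV" "\<And>z. z \<in> ball z0 r0 \<Longrightarrow> F z = y z" by blast
  have "ysol UNIV F"
    by (rule ysol_continuation[OF open_UNIV connected_UNIV open_ball _ _ F(1) cong[OF F(2)]]) (use r0 in auto)
  thus ?thesis using F(2) that by blast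
qed

end

section \<open>Common eigenvectors in function spaces of dimension at most two\<close>

lemma has_field_derivative_translate:
  fixes f :: "complex \<Rightarrow> complex"
  shows "(f has_field_derivative D) (at (z + c)) \<Longrightarrow> ((\<lambda>z. f (z + c)) has_field_derivative D) (at z)"
  using DERIV_shift by blast

text \<open>The bound on the dimension is expressed by \<open>dim\<close>: any two independent
  elements span. If v and T v are independent, then T (T v) = alpha v + beta T v, and s v + T v is
  an eigenvector with eigenvalue s + beta as soon as s (s + beta) = alpha.\<close>

lemma eigenvector_dim_le_2:
  fixes V :: "(complex \<Rightarrow> complex) set" and T :: "(complex \<Rightarrow> complex) \<Rightarrow> complex \<Rightarrow> complex"
  assumes comb: "\<And>f g a b. f \<in> V \<Longrightarrow> g \<in> V \<Longrightarrow> (\<lambda>z. a * f z + b * g z) \<in> V"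
    and dim: "\<And>f g h. f \<in> V \<Longrightarrow> f \<noteq> (\<lambda>_. 0) \<Longrightarrow> g \<in> V \<Longrightarrow> \<nexists>c. g = (\<lambda>z. c * f z) \<Longrightarrow> h \<in> V \<Longrightarrow>
               \<exists>a b. h = (\<lambda>z. a * f z + b * g z)"
    and T: "\<And>f. f \<in> V \<Longrightarrow> T f \<in> V"
    and lin: "\<And>f g a b. T (\<lambda>z. a * f z + b * g z) = (\<lambda>z. a * T f z + b * T g z)"
    and v: "v \<in> V" "v \<noteq> (\<lambda>_. 0)"
  obtains u \<mu> where "u \<in> V" "u \<noteq> (\<lambda>_. 0)" "T u = (\<lambda>z. \<mu> * u z)"
proof (cases "\<exists>c. T v = (\<lambda>z. c * v z)")
  case True
  thus ?thesis using that v by blast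
next
  case False
  obtain \<alpha> \<beta> where \<alpha>\<beta>: "T (T v) = (\<lambda>z. \<alpha> * v z + \<beta> * T v z)"
    using dim[OF v T[OF v(1)] False T[OF T[OF v(1)]]] by blast
  \<comment> \<open>A root of s^2 + beta s - alpha = 0.\<close>
  define s where "s = (- \<beta> + csqrt (\<beta> ^ 2 + 4 * \<alpha>)) / 2"
  have "2 * s + \<beta> = csqrt (\<beta> ^ 2 + 4 * \<alpha>)" by (simp add: s_def field_simps)
  hence "(2 * s + \<beta>) ^ 2 = \<beta> ^ 2 + 4 * \<alpha>" by simp
  hence "4 * (s * (s + \<beta>)) = 4 * \<alpha>" by (simp add: power2_eq_square algebra_simps)
  hence s: "\<alpha> = s * (s + \<beta>)" by simp
  let ?u = "\<lambda>z. s * v z + 1 * T v z"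
  show ?thesis
  proof (rule that[of ?u "s + \<beta>"])
    show "?u \<in> V" by (rule comb[OF v(1) T[OF v(1)]])
    show "?u \<noteq> (\<lambda>_. 0)"
    proof
      assume "?u = (\<lambda>_. 0)"
      hence "T v z = - s * v z" for z by (auto dest: fun_cong[of _ _ z] simp: eq_neg_iff_add_eq_0 add.commute)
      thus False using False by blast
    qed
    show "T ?u = (\<lambda>z. (s + \<beta>) * ?u z)"
      unfolding lin \<alpha>\<beta> by (rule ext) (simp add: s algebra_simps)
  qed
qed

text \<open>Let u be an eigenvector of S. If T u is not a multiple of u, then u and T u span the
  space, and T u has the same S-eigenvalue because the maps commute. So S acts as a scalar, and any
  eigenvector of T will do.\<close>

lemma common_eigenvector_dim_le_2:
  fixes V :: "(complex \<Rightarrow> complex) set" and S T :: "(complex \<Rightarrow> complex) \<Rightarrow> complex \<Rightarrow> complex"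
  assumes comb: "\<And>f g a b. f \<in> V \<Longrightarrow> g \<in> V \<Longrightarrow> (\<lambda>z. a * f z + b * g z) \<in> V"
    and dim: "\<And>f g h. f \<in> V \<Longrightarrow> f \<noteq> (\<lambda>_. 0) \<Longrightarrow> g \<in> V \<Longrightarrow> \<nexists>c. g = (\<lambda>z. c * f z) \<Longrightarrow> h \<in> V \<Longrightarrow>
               \<exists>a b. h = (\<lambda>z. a * f z + b * g z)"
    and S: "\<And>f. f \<in> V \<Longrightarrow> S f \<in> V" and T: "\<And>f. f \<in> V \<Longrightarrow> T f \<in> V"
    and linS: "\<And>f g a b. S (\<lambda>z. a * f z + b * g z) = (\<lambda>z. a * S f z + b * S g z)"
    and linT: "\<And>f g a b. T (\<lambda>z. a * f z + b * g z) = (\<lambda>z. a * T f z + b * T g z)"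
    and comm: "\<And>f. S (T f) = T (S f)"
    and v: "v \<in> V" "v \<noteq> (\<lambda>_. 0)"
  obtains u \<mu> \<nu> where "u \<in> V" "u \<noteq> (\<lambda>_. 0)" "S u = (\<lambda>z. \<mu> * u z)" "T u = (\<lambda>z. \<nu> * u z)"
proof -
  obtain u \<mu> where u: "u \<in> V" "u \<noteq> (\<lambda>_. 0)" "S u = (\<lambda>z. \<mu> * u z)"
    using eigenvector_dim_le_2[where V = V and T = S, OF comb dim S linS v] by blast
  show ?thesis
  proof (cases "\<exists>c. T u = (\<lambda>z. c * u z)")
    case True
    thus ?thesis using that u by blast
  next
    case False
    \<comment> \<open>Homogeneity of \<open>T\<close> is read off from \<open>linT\<close> with
      second coefficient 0.\<close>
    have Tu: "S (T u) = (\<lambda>z. \<mu> * T u z)"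
      unfolding comm u(3) using linT[of \<mu> u 0 u] by simp
    obtain x \<nu> where x: "x \<in> V" "x \<noteq> (\<lambda>_. 0)" "T x = (\<lambda>z. \<nu> * x z)"
      using eigenvector_dim_le_2[where V = V and T = T, OF comb dim T linT v] by blast
    obtain a b where ab: "x = (\<lambda>z. a * u z + b * T u z)"
      using dim[OF u(1,2) T[OF u(1)] False x(1)] by blast
    have "S x = (\<lambda>z. \<mu> * x z)"
      unfolding ab linS Tu u(3) by (simp add: algebra_simps)
    thus ?thesis using that x by blast
  qed
qed

context apparent_singularities
begin

section \<open>The space of entire solutions and its translations\<close>

lemma ysol_combination:
  assumes y: "ysol UNIV y1" "ysol UNIV y2"
  shows "ysol UNIV (\<lambda>z. a * y1 z + b * y2 z)"
proof -
  have h: "y1 holomorphic_on UNIV" "y2 holomorphic_on UNIV" using y by (auto simp: ysol_def)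
  have d: "(f has_field_derivative deriv f z) (at z)" "(deriv f has_field_derivative deriv (deriv f) z) (at z)"
    if "f holomorphic_on UNIV" for f z
    using that by (auto intro: holomorphic_derivI[of f UNIV] holomorphic_derivI[OF holomorphic_deriv[of f UNIV]])
  have d1: "((\<lambda>z. a * y1 z + b * y2 z) has_field_derivative a * deriv y1 z + b * deriv y2 z) (at z)" for z
    by (intro DERIV_add DERIV_cmult d h)
  have d2: "deriv (deriv (\<lambda>z. a * y1 z + b * y2 z)) z = a * deriv (deriv y1) z + b * deriv (deriv y2) z" for z
    by (rule deriv_deriv_eqI[OF open_UNIV UNIV_I d1]) (intro DERIV_add DERIV_cmult d h)
  have eq: "deriv (deriv f) z = 2 * G z * deriv f z + (Q z + deriv G z - G z ^ 2) * f z"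
    if "ysol UNIV f" "z \<in> UNIV - P" for f z
    using that unfolding ysol_def by blast
  have "(\<lambda>z. a * y1 z + b * y2 z) holomorphic_on UNIV" using h by (intro holomorphic_intros)
  moreover have "a * deriv (deriv y1) z + b * deriv (deriv y2) z =
      2 * G z * (a * deriv y1 z + b * deriv y2 z) + (Q z + deriv G z - G z ^ 2) * (a * y1 z + b * y2 z)"
    if "z \<in> UNIV - P" for z
    unfolding eq[OF y(1) that] eq[OF y(2) that] by (simp add: algebra_simps)
  ultimately show ?thesis unfolding ysol_def d2 DERIV_imp_deriv[OF d1] by blast
qed

text \<open>The coefficients with respect to the normalized local basis at \<open>c\<close> are the
  value and the slope of \<open>y\<close> there; the identity theorem does the rest.\<close>

lemma ysol_unique:
  assumes c: "c \<notin> P" and y: "ysol UNIV y" "y c = 0" "deriv y c = 0"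
  shows "y = (\<lambda>_. 0)"
proof -
  obtain \<delta> Y1 Y2 where Y: "\<delta> > 0" "ysol (ball c \<delta>) Y1" "ysol (ball c \<delta>) Y2"
    "Y1 c = 1" "deriv Y1 c = 0" "Y2 c = 0" "deriv Y2 c = 1"
    "\<And>D y. open D \<Longrightarrow> connected D \<Longrightarrow> D \<subseteq> ball c \<delta> \<Longrightarrow> ysol D y \<Longrightarrow>
        \<exists>c1 c2. \<forall>z\<in>D. y z = c1 * Y1 z + c2 * Y2 z"
    using regular_local[OF c] by metis
  obtain c1 c2 where eq: "\<And>z. z \<in> ball c \<delta> \<Longrightarrow> y z = c1 * Y1 z + c2 * Y2 z"
    using Y(8)[OF open_ball connected_ball order_refl ysol_subset[OF y(1)]] by blast
  have cb: "c \<in> ball c \<delta>" using Y(1) by simp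
  have dY: "(Y1 has_field_derivative 0) (at c)" "(Y2 has_field_derivative 1) (at c)"
    using Y(2,3) holomorphic_derivI[OF _ open_ball cb] Y(5,7) unfolding ysol_def by metis+
  have "((\<lambda>z. c1 * Y1 z + c2 * Y2 z) has_field_derivative c1 * 0 + c2 * 1) (at c)"
    by (intro DERIV_add DERIV_cmult dY)
  hence "(y has_field_derivative c1 * 0 + c2 * 1) (at c)"
    by (rule has_field_derivative_transform_within_open[OF _ open_ball cb]) (simp add: eq)
  hence "c2 = 0" using y(3) by (simp add: DERIV_imp_deriv)
  moreover have "c1 = 0" using eq[OF cb] y(2) Y(4,6) by simp
  ultimately have loc: "y z = 0" if "z \<in> ball c \<delta>" for z using eq[OF that] by simp
  have "y z = 0" for z
    by (rule analytic_continuation_open[OF open_ball open_UNIV _ connected_UNIV subset_UNIV, of c \<delta> y "\<lambda>_. 0"])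
       (use cb y(1) loc in \<open>auto simp: ysol_def\<close>)
  thus ?thesis by blast
qed

lemma exists_regular: "\<exists>c. c \<notin> P"
  using countable_P uncountable_UNIV_complex by (metis UNIV_eq_I)

lemma exists_entire_ysol:
  obtains y where "ysol UNIV y" "y \<noteq> (\<lambda>_. 0)"
proof -
  obtain c where c: "c \<notin> P" using exists_regular by blast
  then obtain \<delta> Y1 where Y: "\<delta> > 0" "ysol (ball c \<delta>) Y1" "Y1 c = 1"
    using regular_local by metis
  then obtain Y where "ysol UNIV Y" "\<And>z. z \<in> ball c \<delta> \<Longrightarrow> Y z = Y1 z"
    using ysol_entire_extension by blast
  moreover from this(2)[of c] have "Y c = 1" using Y by simp
  ultimately show ?thesis using that by fastforce
qed

text \<open>By \<open>ysol_unique\<close> a solution is determined by its initial data at one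
  regular point. If the determinant \<open>W\<close> of the data of f and g vanishes, g is a
  multiple of f; otherwise Cramer's rule gives the coefficients.\<close>

lemma ysol_dim_le_2:
  assumes f: "ysol UNIV f" "f \<noteq> (\<lambda>_. 0)" and g: "ysol UNIV g" "\<nexists>c. g = (\<lambda>z. c * f z)" and h: "ysol UNIV h"
  shows "\<exists>a b. h = (\<lambda>z. a * f z + b * g z)"
proof -
  obtain c where c: "c \<notin> P" using exists_regular by blast
  have dc: "deriv (\<lambda>z. a * u z + b * v z) c = a * deriv u c + b * deriv v c"
    if "ysol UNIV u" "ysol UNIV v" for u v a b
    using that by (intro DERIV_imp_deriv DERIV_add DERIV_cmult holomorphic_derivI[of _ UNIV]) (auto simp: ysol_def)
  define W where "W = f c * deriv g c - deriv f c * g c"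
  show ?thesis
  proof (cases "W = 0")
    case True
    have nz: "f c \<noteq> 0 \<or> deriv f c \<noteq> 0" using ysol_unique[OF c f(1)] f(2) by blast
    obtain t where t: "g c = t * f c" "deriv g c = t * deriv f c"
    proof (cases "f c = 0")
      case True
      thus ?thesis using that[of "deriv g c / deriv f c"] nz \<open>W = 0\<close> by (simp add: W_def)
    next
      case False
      thus ?thesis using that[of "g c / f c"] \<open>W = 0\<close> by (simp add: W_def field_simps)
    qed
    have "(\<lambda>z. 1 * g z + (- t) * f z) = (\<lambda>_. 0)"
      by (rule ysol_unique[OF c ysol_combination[OF g(1) f(1)]]) (simp_all only: dc[OF g(1) f(1)], simp_all add: t)
    hence "g = (\<lambda>z. t * f z)" by (auto simp: fun_eq_iff)
    thus ?thesis using g(2) by blast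
  next
    case False
    define a where "a = (h c * deriv g c - deriv h c * g c) / W"
    define b where "b = (f c * deriv h c - deriv f c * h c) / W"
    have e1: "a * f c + b * g c = h c"
    proof -
      have "a * f c + b * g c = ((h c * deriv g c - deriv h c * g c) * f c + (f c * deriv h c - deriv f c * h c) * g c) / W"
        by (simp add: a_def b_def add_divide_distrib)
      also have "(h c * deriv g c - deriv h c * g c) * f c + (f c * deriv h c - deriv f c * h c) * g c = h c * W"
        by (simp add: W_def algebra_simps)
      finally show ?thesis using False by simp
    qed
    have e2: "a * deriv f c + b * deriv g c = deriv h c"
    proof -
      have "a * deriv f c + b * deriv g c =
          ((h c * deriv g c - deriv h c * g c) * deriv f c + (f c * deriv h c - deriv f c * h c) * deriv g c) / W"
        by (simp add: a_def b_def add_divide_distrib)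
      also have "(h c * deriv g c - deriv h c * g c) * deriv f c + (f c * deriv h c - deriv f c * h c) * deriv g c = deriv h c * W"
        by (simp add: W_def algebra_simps)
      finally show ?thesis using False by simp
    qed
    let ?v = "\<lambda>z. a * f z + b * g z"
    have v: "ysol UNIV ?v" by (rule ysol_combination[OF f(1) g(1)])
    have 0: "(\<lambda>z. 1 * h z + (- 1) * ?v z) = (\<lambda>_. 0)"
      by (rule ysol_unique[OF c ysol_combination[OF h v]])
         (simp_all only: dc[OF h v] dc[OF f(1) g(1)] e1 e2, simp_all)
    have "x = y" if "1 * x + (- 1) * y = 0" for x y :: complex using that by simp
    hence "h = ?v" using fun_cong[OF 0] by blast
    thus ?thesis by blast
  qed
qed

text \<open>Adding the constant c to \<open>G\<close> multiplies a gauge factor by exp (c z), and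
  the factor \<open>exp (- c * z)\<close> undoes this.\<close>

lemma ysol_translate:
  assumes P: "\<And>z. z + \<omega> \<in> P \<longleftrightarrow> z \<in> P"
    and G: "\<And>z. z \<notin> P \<Longrightarrow> G (z + \<omega>) = G z + c" and Q: "\<And>z. z \<notin> P \<Longrightarrow> Q (z + \<omega>) = Q z"
    and y: "ysol UNIV y"
  shows "ysol UNIV (\<lambda>z. y (z + \<omega>) * exp (- c * z))"
proof -
  have h: "y holomorphic_on UNIV" using y by (simp add: ysol_def)
  have d: "((\<lambda>z. y (z + \<omega>)) has_field_derivative deriv y (z + \<omega>)) (at z)"
    "((\<lambda>z. deriv y (z + \<omega>)) has_field_derivative deriv (deriv y) (z + \<omega>)) (at z)" for z
    by (rule has_field_derivative_translate, rule holomorphic_derivI[OF _ open_UNIV UNIV_I],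
        rule h holomorphic_deriv[OF h open_UNIV])+
  have e: "((\<lambda>z. exp (- c * z)) has_field_derivative - c * exp (- c * z)) (at z)" for z
    by (auto intro!: derivative_eq_intros)
  let ?x = "\<lambda>z. y (z + \<omega>) * exp (- c * z)"
  have d1: "(?x has_field_derivative deriv y (z + \<omega>) * exp (- c * z) + (- c * exp (- c * z)) * y (z + \<omega>)) (at z)" for z
    by (rule DERIV_mult[OF d(1) e])
  have d2: "deriv (deriv ?x) z = (deriv (deriv y) (z + \<omega>) * exp (- c * z) + (- c * exp (- c * z)) * deriv y (z + \<omega>)) +
      (- c * (- c * exp (- c * z)) * y (z + \<omega>) + deriv y (z + \<omega>) * (- c * exp (- c * z)))" for z
    by (rule deriv_deriv_eqI[OF open_UNIV UNIV_I d1]) (intro DERIV_add DERIV_mult DERIV_cmult d e)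
  have "?x holomorphic_on UNIV" unfolding holomorphic_on_open[OF open_UNIV] using d1 by blast
  moreover have "deriv (deriv ?x) z = 2 * G z * deriv ?x z + (Q z + deriv G z - G z ^ 2) * ?x z" if z: "z \<notin> P" for z
  proof -
    have dG: "deriv G (z + \<omega>) = deriv G z"
    proof -
      have "((\<lambda>z. G (z + \<omega>)) has_field_derivative deriv G (z + \<omega>)) (at z)"
        by (rule has_field_derivative_translate, rule holomorphic_derivI[OF holG open_Compl_P]) (use z P in simp)
      moreover have "((\<lambda>z. G z + c) has_field_derivative deriv G z) (at z)"
        using holomorphic_derivI[OF holG open_Compl_P, of z] z by (auto intro!: derivative_eq_intros)
      hence "((\<lambda>z. G (z + \<omega>)) has_field_derivative deriv G z) (at z)"
        by (rule has_field_derivative_transform_within_open[OF _ open_Compl_P]) (use z G in auto)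
      ultimately show ?thesis by (rule DERIV_unique)
    qed
    have eq: "deriv (deriv y) (z + \<omega>) = 2 * (G z + c) * deriv y (z + \<omega>) + (Q z + deriv G z - (G z + c) ^ 2) * y (z + \<omega>)"
      using y z P[of z] G[OF z] Q[OF z] dG unfolding ysol_def by simp
    show ?thesis unfolding d2 DERIV_imp_deriv[OF d1] eq by (simp add: algebra_simps power2_eq_square)
  qed
  ultimately show ?thesis by (simp add: ysol_def)
qed

text \<open>The two compositions of the twisted translations differ only in the constants
  \<open>exp (- c2 * \<omega>1)\<close> and \<open>exp (- c1 * \<omega>2)\<close>, which
  \<open>comm\<close> makes equal.\<close>

lemma exists_multiplicative_ysol:
  assumes P: "\<And>z. z + \<omega>1 \<in> P \<longleftrightarrow> z \<in> P" "\<And>z. z + \<omega>2 \<in> P \<longleftrightarrow> z \<in> P"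
    and G: "\<And>z. z \<notin> P \<Longrightarrow> G (z + \<omega>1) = G z + c1" "\<And>z. z \<notin> P \<Longrightarrow> G (z + \<omega>2) = G z + c2"
    and Q: "\<And>z. z \<notin> P \<Longrightarrow> Q (z + \<omega>1) = Q z" "\<And>z. z \<notin> P \<Longrightarrow> Q (z + \<omega>2) = Q z"
    and comm: "exp (c1 * \<omega>2) = exp (c2 * \<omega>1)"
  obtains y \<mu>1 \<mu>2 where "ysol UNIV y" "y \<noteq> (\<lambda>_. 0)"
    "\<And>z. y (z + \<omega>1) = \<mu>1 * exp (c1 * z) * y z" "\<And>z. y (z + \<omega>2) = \<mu>2 * exp (c2 * z) * y z"
proof -
  define S where "S = (\<lambda>(y::complex \<Rightarrow> complex) z. y (z + \<omega>1) * exp (- c1 * z))"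
  define T where "T = (\<lambda>(y::complex \<Rightarrow> complex) z. y (z + \<omega>2) * exp (- c2 * z))"
  have ST: "S (T f) = T (S f)" for f
  proof
    fix z
    have "exp (- c2 * \<omega>1) = exp (- c1 * \<omega>2)" using comm by (simp add: exp_minus)
    moreover have "exp (- c2 * (z + \<omega>1)) = exp (- c2 * z) * exp (- c2 * \<omega>1)"
      "exp (- c1 * (z + \<omega>2)) = exp (- c1 * z) * exp (- c1 * \<omega>2)"
      by (simp_all only: exp_add[symmetric] ring_distribs)
    ultimately show "S (T f) z = T (S f) z" by (simp add: S_def T_def add_ac)
  qed
  obtain v where v: "v \<in> {y. ysol UNIV y}" "v \<noteq> (\<lambda>_. 0)" using exists_entire_ysol by blast
  have S_in: "S f \<in> {y. ysol UNIV y}" if "f \<in> {y. ysol UNIV y}" for f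
    using ysol_translate[OF P(1) G(1) Q(1), of f] that by (simp add: S_def)
  have T_in: "T f \<in> {y. ysol UNIV y}" if "f \<in> {y. ysol UNIV y}" for f
    using ysol_translate[OF P(2) G(2) Q(2), of f] that by (simp add: T_def)
  obtain u \<mu>1 \<mu>2 where u: "u \<in> {y. ysol UNIV y}" "u \<noteq> (\<lambda>_. 0)" "S u = (\<lambda>z. \<mu>1 * u z)" "T u = (\<lambda>z. \<mu>2 * u z)"
  proof (rule common_eigenvector_dim_le_2[where V = "{y. ysol UNIV y}" and S = S and T = T, OF _ _ S_in T_in _ _ ST v])
    show "\<And>f g a b. S (\<lambda>z. a * f z + b * g z) = (\<lambda>z. a * S f z + b * S g z)"
      "\<And>f g a b. T (\<lambda>z. a * f z + b * g z) = (\<lambda>z. a * T f z + b * T g z)"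
      by (simp_all add: S_def T_def algebra_simps)
  qed (use ysol_combination ysol_dim_le_2 in auto)
  show ?thesis
  proof (rule that[of u \<mu>1 \<mu>2])
    fix z
    show "u (z + \<omega>1) = \<mu>1 * exp (c1 * z) * u z"
      using fun_cong[OF u(3), of z] by (simp add: S_def exp_minus field_simps)
    show "u (z + \<omega>2) = \<mu>2 * exp (c2 * z) * u z"
      using fun_cong[OF u(4), of z] by (simp add: T_def exp_minus field_simps)
  qed (use u in auto)
qed

text \<open>Division by the gauge factor turns a zero of order m into a solution of w'' = Q w with
  exponent m - nu, which must be -nu or nu + 1.\<close>

lemma ysol_order:
  assumes y: "ysol UNIV y" and \<delta>: "\<delta> > 0" and hol: "g holomorphic_on ball c \<delta>" "q holomorphic_on ball c \<delta>"
    and GQ: "\<And>z. z \<in> ball c \<delta> - {c} \<Longrightarrow> G z = \<nu> / (z - c) + g z"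
      "\<And>z. z \<in> ball c \<delta> - {c} \<Longrightarrow> Q z = \<nu> * (\<nu> + 1) / (z - c) ^ 2 + q z / (z - c)"
    and disj: "(ball c \<delta> - {c}) \<inter> P = {}"
    and u: "u holomorphic_on ball c \<delta>" "u c \<noteq> 0" and yu: "\<And>z. z \<in> ball c \<delta> \<Longrightarrow> y z = (z - c) ^ m * u z"
  shows "m = 0 \<or> of_nat m = 2 * \<nu> + 1"
proof -
  let ?S = "slit_disc c \<delta>"
  have SB: "?S \<subseteq> ball c \<delta> - {c}" by (rule slit_disc_subset_ball)
  obtain \<gamma> where \<gamma>: "\<gamma> holomorphic_on ball c \<delta>" "\<And>z. z \<in> ?S \<Longrightarrow>
      ((\<lambda>z. (z - c) powr \<nu> * exp (\<gamma> z)) has_field_derivative G z * ((z - c) powr \<nu> * exp (\<gamma> z))) (at z)"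
    using gauge_slit_disc[OF hol(1) \<delta> GQ(1)] by blast
  have "solves_on ?S Q (\<lambda>z. y z / ((z - c) powr \<nu> * exp (\<gamma> z)))"
    using SB disj by (intro solves_if_ysol[OF open_slit_disc _ \<gamma>(2)] ysol_subset[OF y]) auto
  hence "solves_on ?S Q (\<lambda>z. (z - c) powr (of_nat m - \<nu>) * (u z * exp (- \<gamma> z)))"
  proof (rule solves_on_eqI[OF _ open_slit_disc])
    fix z assume z: "z \<in> ?S"
    have "z - c \<noteq> 0" "z \<in> ball c \<delta>" using z SB by auto
    thus "(z - c) powr (of_nat m - \<nu>) * (u z * exp (- \<gamma> z)) = y z / ((z - c) powr \<nu> * exp (\<gamma> z))"
      by (simp add: yu powr_diff powr_nat' exp_minus field_simps)
  qed
  hence "(of_nat m - \<nu>) * (of_nat m - \<nu> - 1) = \<nu> * (\<nu> + 1)"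
  proof (rule indicial_equation[OF _ _ hol(2) \<delta>, rotated 3])
    show "Q z = \<nu> * (\<nu> + 1) / (z - c) ^ 2 + q z / (z - c)" if "z \<in> ?S" for z
      using SB that by (intro GQ(2)) auto
    show "(\<lambda>z. u z * exp (- \<gamma> z)) holomorphic_on ball c \<delta>" by (intro holomorphic_intros u \<gamma>)
    show "u c * exp (- \<gamma> c) \<noteq> 0" using u(2) by simp
  qed
  from indicial_roots[OF this] show ?thesis by (auto simp: algebra_simps)
qed

end

section \<open>Weierstrass functions\<close>

lemma zero_in_lattice: "0 \<in> lattice \<tau>"
  unfolding lattice_def by (intro CollectI exI[of _ 0]) auto

lemma lattice_add: "x \<in> lattice \<tau> \<Longrightarrow> y \<in> lattice \<tau> \<Longrightarrow> x + y \<in> lattice \<tau>"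
  unfolding lattice_def
proof clarify
  fix a b c d :: int
  show "\<exists>e f. of_int a + of_int b * \<tau> + (of_int c + of_int d * \<tau>) = of_int e + of_int f * \<tau> \<and> True"
    by (intro exI[of _ "a + c"] exI[of _ "b + d"]) (simp add: algebra_simps)
qed

lemma lattice_minus: "x \<in> lattice \<tau> \<Longrightarrow> - x \<in> lattice \<tau>"
  unfolding lattice_def
proof clarify
  fix a b :: int
  show "\<exists>e f. - (of_int a + of_int b * \<tau>) = of_int e + of_int f * \<tau> \<and> True"
    by (intro exI[of _ "- a"] exI[of _ "- b"]) (simp add: algebra_simps)
qed

lemma lattice_minus_iff: "- x \<in> lattice \<tau> \<longleftrightarrow> x \<in> lattice \<tau>"
  using lattice_minus[of x] lattice_minus[of "- x"] by auto

lemma lattice_diff: "x \<in> lattice \<tau> \<Longrightarrow> y \<in> lattice \<tau> \<Longrightarrow> x - y \<in> lattice \<tau>"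
  using lattice_add[of x \<tau> "- y"] lattice_minus[of y] by simp

lemma lattice_add_iff: "y \<in> lattice \<tau> \<Longrightarrow> x + y \<in> lattice \<tau> \<longleftrightarrow> x \<in> lattice \<tau>"
  using lattice_add lattice_diff[of "x + y" \<tau> y] by auto

lemma lattice_diff_iff: "y \<in> lattice \<tau> \<Longrightarrow> x - y \<in> lattice \<tau> \<longleftrightarrow> x \<in> lattice \<tau>"
  using lattice_diff lattice_add[of "x - y" \<tau> y] by auto

lemma one_in_lattice: "1 \<in> lattice \<tau>"
  unfolding lattice_def by (intro CollectI exI[of _ 1] exI[of _ 0]) auto

lemma tau_in_lattice: "\<tau> \<in> lattice \<tau>"
  unfolding lattice_def by (intro CollectI exI[of _ 0] exI[of _ 1]) auto

lemma same_class_sym: "same_class \<tau> x y \<longleftrightarrow> same_class \<tau> y x"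
  using lattice_minus_iff[of "x - y" \<tau>] by (simp add: same_class_def)

lemma lattice_eq_image: "lattice \<tau> = (\<lambda>(a, b). of_int a + of_int b * \<tau>) ` UNIV"
  by (auto simp: lattice_def)

lemma countable_lattice: "countable (lattice \<tau>)"
  unfolding lattice_eq_image by (intro countable_image) auto

text \<open>One half of the exponent 3 falls to each lattice coordinate, and 3/2 > 1 still gives
  convergence.\<close>

lemma summable_on_int_powr:
  "(\<lambda>k::int. (1 + \<bar>real_of_int k\<bar>) powr - (3/2)) summable_on UNIV"
proof -
  have "summable (\<lambda>n. real (Suc n) powr - (3/2))"
    by (subst summable_Suc_iff) (simp add: summable_real_powr_iff)
  hence nat: "(\<lambda>n. real (Suc n) powr - (3/2)) summable_on UNIV"
    by (subst summable_on_UNIV_nonneg_real_iff) auto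
  have 1: "(\<lambda>k::int. (1 + \<bar>real_of_int k\<bar>) powr - (3/2)) summable_on range int"
    using nat by (subst summable_on_reindex) (auto simp: o_def add_ac)
  have 2: "(\<lambda>k::int. (1 + \<bar>real_of_int k\<bar>) powr - (3/2)) summable_on range (\<lambda>n. - int n)"
    using nat by (subst summable_on_reindex) (auto simp: o_def add_ac inj_on_def)
  have "(UNIV :: int set) = range int \<union> range (\<lambda>n. - int n)"
  proof (intro equalityI subsetI)
    fix k :: int
    show "k \<in> range int \<union> range (\<lambda>n. - int n)"
      by (cases k rule: int_cases2) auto
  qed auto
  thus ?thesis using summable_on_union[OF 1 2] by simp
qed

locale weierstrass_lattice =
  fixes \<tau> :: complex
  assumes Im_pos: "Im \<tau> > 0"
begin

abbreviation \<Lambda> :: "complex set" where "\<Lambda> \<equiv> lattice \<tau>"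

abbreviation \<sigma> :: "complex \<Rightarrow> complex" where "\<sigma> \<equiv> wsigma \<tau>"

abbreviation \<zeta> :: "complex \<Rightarrow> complex" where "\<zeta> \<equiv> wzeta \<tau>"

lemma lattice_coords:
  "inj (\<lambda>(a::int, b::int). of_int a + of_int b * \<tau>)"
proof (rule injI, clarify)
  fix a b c d :: int
  assume eq: "of_int a + of_int b * \<tau> = of_int c + of_int d * \<tau>"
  hence "Im (of_int a + of_int b * \<tau>) = Im (of_int c + of_int d * \<tau>)" by simp
  hence "b = d" using Im_pos by simp
  with eq show "a = c \<and> b = d" by simp
qed

lemma lattice_norm_lower_bound:
  obtains c where "c > 0"
    "\<And>a b :: int. c * max \<bar>real_of_int a\<bar> \<bar>real_of_int b\<bar> \<le> norm (of_int a + of_int b * \<tau>)"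
proof
  have pos: "1 + norm \<tau> > 0" by (simp add: add_pos_nonneg)
  \<comment> \<open>\<open>e\<close> separates two cases: if |b| <= e |a|, then |b tau| is at most
    |a| / 2 and the term a dominates; otherwise the imaginary part b Im tau alone gives the
    bound.\<close>
  define e where "e = 1 / (2 * (1 + norm \<tau>))"
  have e: "e > 0" "e * norm \<tau> \<le> 1/2" "e \<le> 1"
    using pos by (auto simp: e_def field_simps)
  define m where "m = min (1/2) (e * Im \<tau>)"
  have "m > 0" using e Im_pos by (auto simp: m_def)
  thus "m > 0" .
  fix a b :: int
  let ?w = "of_int a + of_int b * \<tau>"
  have im: "\<bar>real_of_int b\<bar> * Im \<tau> \<le> norm ?w"
    using abs_Im_le_cmod[of ?w] Im_pos by (simp add: abs_mult)
  have tri: "\<bar>real_of_int a\<bar> \<le> norm ?w + \<bar>real_of_int b\<bar> * norm \<tau>"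
    using norm_triangle_ineq4[of ?w "of_int b * \<tau>"] by (simp add: norm_mult)
  have B: "m * \<bar>real_of_int b\<bar> \<le> norm ?w"
  proof -
    have "m \<le> e * Im \<tau>" by (simp add: m_def)
    also have "\<dots> \<le> 1 * Im \<tau>" using e Im_pos by (intro mult_right_mono) auto
    finally have "m * \<bar>real_of_int b\<bar> \<le> Im \<tau> * \<bar>real_of_int b\<bar>" by (intro mult_right_mono) auto
    thus ?thesis using im by (simp add: mult.commute)
  qed
  have A: "m * \<bar>real_of_int a\<bar> \<le> norm ?w"
  proof (cases "\<bar>real_of_int b\<bar> \<le> e * \<bar>real_of_int a\<bar>")
    case True
    have "\<bar>real_of_int b\<bar> * norm \<tau> \<le> e * \<bar>real_of_int a\<bar> * norm \<tau>"
      using True by (intro mult_right_mono) auto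
    also have "\<dots> = (e * norm \<tau>) * \<bar>real_of_int a\<bar>" by (simp add: mult_ac)
    also have "\<dots> \<le> 1/2 * \<bar>real_of_int a\<bar>" using e by (intro mult_right_mono) auto
    finally have "1/2 * \<bar>real_of_int a\<bar> \<le> norm ?w" using tri by simp
    moreover have "m * \<bar>real_of_int a\<bar> \<le> 1/2 * \<bar>real_of_int a\<bar>"
      by (intro mult_right_mono) (auto simp: m_def)
    ultimately show ?thesis by linarith
  next
    case False
    have "m * \<bar>real_of_int a\<bar> \<le> e * Im \<tau> * \<bar>real_of_int a\<bar>"
      by (intro mult_right_mono) (auto simp: m_def)
    also have "\<dots> = Im \<tau> * (e * \<bar>real_of_int a\<bar>)" by simp
    also have "\<dots> \<le> Im \<tau> * \<bar>real_of_int b\<bar>"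
      using False Im_pos by (intro mult_left_mono) auto
    finally show ?thesis using im by (simp add: mult.commute)
  qed
  show "m * max \<bar>real_of_int a\<bar> \<bar>real_of_int b\<bar> \<le> norm ?w"
    using A B by (auto simp: max_def)
qed

lemma lattice_summable: "(\<lambda>\<omega>. 1 / norm \<omega> ^ 3) summable_on (\<Lambda> - {0})"
proof -
  obtain c where c: "c > 0"
    "\<And>a b :: int. c * max \<bar>real_of_int a\<bar> \<bar>real_of_int b\<bar> \<le> norm (of_int a + of_int b * \<tau>)"
    using lattice_norm_lower_bound by blast
  let ?f = "\<lambda>(a::int, b::int). of_int a + of_int b * \<tau>"
  let ?p = "\<lambda>k::int. (1 + \<bar>real_of_int k\<bar>) powr - (3/2)"
  have "(\<lambda>(a, b). ?p a * ?p b) summable_on (UNIV \<times> UNIV)"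
  proof (rule summable_on_SigmaI)
    show "((\<lambda>b. case (a, b) of (a, b) \<Rightarrow> ?p a * ?p b) has_sum ?p a * infsum ?p UNIV) UNIV" for a
      using has_sum_cmult_right[OF has_sum_infsum[OF summable_on_int_powr]] by simp
    show "(\<lambda>a. ?p a * infsum ?p UNIV) summable_on UNIV"
      by (intro summable_on_cmult_left summable_on_int_powr)
  qed auto
  hence "(\<lambda>(a, b). ?p a * ?p b) summable_on (UNIV - {(0,0)})"
    by (rule summable_on_subset_banach) auto
  \<comment> \<open>For M = max |a| |b| >= 1 one has (1 + |a|) (1 + |b|) <= (2 M)^2, whose power 3/2
    is 8 M^3; the lower bound c M for the norm contributes c^3.\<close>
  hence S: "(\<lambda>x. 8 / c ^ 3 * (\<lambda>(a, b). ?p a * ?p b) x) summable_on (UNIV - {(0,0)})"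
    by (rule summable_on_cmult_right)
  have "(\<lambda>x. 1 / norm (?f x) ^ 3) summable_on (UNIV - {(0,0)})"
  proof (rule summable_on_comparison_test[OF S])
    fix x :: "int \<times> int" assume x: "x \<in> UNIV - {(0,0)}"
    obtain a b where ab: "x = (a, b)" by (cases x)
    define M where "M = max \<bar>real_of_int a\<bar> \<bar>real_of_int b\<bar>"
    have M1: "M \<ge> 1" using x ab by (auto simp: M_def max_def)
    have "(1 + \<bar>real_of_int a\<bar>) * (1 + \<bar>real_of_int b\<bar>) \<le> (2 * M) * (2 * M)"
      using M1 by (intro mult_mono) (auto simp: M_def)
    hence "((1 + \<bar>real_of_int a\<bar>) * (1 + \<bar>real_of_int b\<bar>)) powr (3/2) \<le> ((2 * M) * (2 * M)) powr (3/2)"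
      by (intro powr_mono2) auto
    also have "\<dots> = (2 * M) ^ 3"
    proof -
      have "((2 * M) * (2 * M)) powr (3/2) = ((2 * M) powr 2) powr (3/2)"
        using M1 by (simp add: powr_numeral power2_eq_square)
      also have "\<dots> = (2 * M) powr 3" by (simp add: powr_powr)
      finally show ?thesis using M1 by (simp add: powr_numeral)
    qed
    finally have 1: "(1 + \<bar>real_of_int a\<bar>) powr (3/2) * (1 + \<bar>real_of_int b\<bar>) powr (3/2) \<le> 8 * M ^ 3"
      by (simp add: powr_mult power_mult_distrib)
    have "(c * M) ^ 3 \<le> norm (?f x) ^ 3"
      using c(2)[of a b] ab c(1) M1 by (intro power_mono) (auto simp: M_def)
    hence 2: "c ^ 3 * M ^ 3 \<le> norm (?f x) ^ 3" by (simp add: power_mult_distrib)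
    have pos: "0 < c ^ 3 * M ^ 3" using c M1 by simp
    define P where "P = (1 + \<bar>real_of_int a\<bar>) powr (3/2) * (1 + \<bar>real_of_int b\<bar>) powr (3/2)"
    have P: "P > 0" unfolding P_def by (intro mult_pos_pos) (auto simp: add_pos_nonneg)
    have "1 / norm (?f x) ^ 3 \<le> 1 / (c ^ 3 * M ^ 3)"
      using 2 pos by (intro frac_le) auto
    also have "\<dots> \<le> 8 / (c ^ 3 * P)"
      using 1 c(1) M1 P unfolding P_def[symmetric] by (simp add: field_simps)
    also have "\<dots> = 8 / c ^ 3 * (\<lambda>(a, b). ?p a * ?p b) x"
      unfolding ab P_def by (simp add: powr_minus field_simps)
    finally show "1 / norm (?f x) ^ 3 \<le> 8 / c ^ 3 * (\<lambda>(a, b). ?p a * ?p b) x" .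
  qed auto
  moreover have "\<Lambda> - {0} = ?f ` (UNIV - {(0,0)})"
    by (subst image_set_diff[OF lattice_coords]) (auto simp: lattice_eq_image)
  moreover have "inj_on ?f (UNIV - {(0,0)})" using lattice_coords by (rule inj_on_subset) auto
  ultimately show ?thesis by (simp add: summable_on_reindex o_def)
qed

lemma finite_lattice_cball: "finite (\<Lambda> \<inter> cball 0 R)"
proof -
  obtain c where c: "c > 0"
    "\<And>a b :: int. c * max \<bar>real_of_int a\<bar> \<bar>real_of_int b\<bar> \<le> norm (of_int a + of_int b * \<tau>)"
    using lattice_norm_lower_bound by blast
  let ?f = "\<lambda>(a::int, b::int). of_int a + of_int b * \<tau>"
  define k where "k = \<lceil>R / c\<rceil>"
  have "\<Lambda> \<inter> cball 0 R \<subseteq> ?f ` ({-k..k} \<times> {-k..k})"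
  proof
    fix z assume z: "z \<in> \<Lambda> \<inter> cball 0 R"
    then obtain a b where ab: "z = of_int a + of_int b * \<tau>" by (auto simp: lattice_def)
    have "max \<bar>real_of_int a\<bar> \<bar>real_of_int b\<bar> * c \<le> R"
      using c(2)[of a b] z ab by (simp add: mult.commute)
    hence "max \<bar>real_of_int a\<bar> \<bar>real_of_int b\<bar> \<le> R / c"
      by (subst pos_le_divide_eq[OF c(1)])
    also have "\<dots> \<le> real_of_int k" by (simp add: k_def)
    finally have "\<bar>real_of_int a\<bar> \<le> real_of_int k" "\<bar>real_of_int b\<bar> \<le> real_of_int k" by auto
    hence "\<bar>a\<bar> \<le> k" "\<bar>b\<bar> \<le> k" by linarith+
    thus "z \<in> ?f ` ({-k..k} \<times> {-k..k})" unfolding ab by (intro image_eqI[of _ _ "(a, b)"]) auto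
  qed
  thus ?thesis by (rule finite_subset) auto
qed

end

text \<open>Only the functions themselves need a majorant: uniform limits of holomorphic functions
  may be differentiated, which also yields the summability of the derivatives. This is applied in
  turn to the logarithmic terms, the zeta terms and the wp terms.\<close>

lemma has_field_derivative_infsum:
  fixes f f' :: "'a \<Rightarrow> complex \<Rightarrow> complex" and M :: "'a \<Rightarrow> real"
  assumes S: "open S" "z \<in> S"
    and deriv: "\<And>\<omega> z. \<omega> \<in> A \<Longrightarrow> z \<in> S \<Longrightarrow> (f \<omega> has_field_derivative f' \<omega> z) (at z)"
    and bound: "\<And>\<omega> z. \<omega> \<in> A \<Longrightarrow> z \<in> S \<Longrightarrow> norm (f \<omega> z) \<le> M \<omega>"
    and M: "M summable_on A"
  shows "((\<lambda>z. \<Sum>\<^sub>\<infinity>\<omega>\<in>A. f \<omega> z) has_field_derivative (\<Sum>\<^sub>\<infinity>\<omega>\<in>A. f' \<omega> z)) (at z)"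
    and "(\<lambda>\<omega>. f' \<omega> z) summable_on A"
proof -
  obtain r where r: "r > 0" "cball z r \<subseteq> S"
    using S open_contains_cball by blast
  have ul: "uniform_limit (cball z r) (\<lambda>X y. \<Sum>x\<in>X. f x y) (\<lambda>y. \<Sum>\<^sub>\<infinity>x\<in>A. f x y)
              (finite_subsets_at_top A)"
    using bound r M by (intro Weierstrass_m_test_general) auto
  have ev: "eventually (\<lambda>X. continuous_on (cball z r) (\<lambda>y. \<Sum>x\<in>X. f x y) \<and>
              (\<forall>w \<in> ball z r. ((\<lambda>y. \<Sum>x\<in>X. f x y) has_field_derivative (\<Sum>x\<in>X. f' x w)) (at w)))
              (finite_subsets_at_top A)"
  proof (rule eventually_finite_subsets_at_top_weakI)
    fix X assume X: "finite X" "X \<subseteq> A"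
    have d: "((\<lambda>y. \<Sum>x\<in>X. f x y) has_field_derivative (\<Sum>x\<in>X. f' x w)) (at w)" if "w \<in> S" for w
      using X that by (intro DERIV_sum deriv) auto
    show "continuous_on (cball z r) (\<lambda>y. \<Sum>x\<in>X. f x y) \<and>
              (\<forall>w \<in> ball z r. ((\<lambda>y. \<Sum>x\<in>X. f x y) has_field_derivative (\<Sum>x\<in>X. f' x w)) (at w))"
    proof
      have "(\<lambda>y. \<Sum>x\<in>X. f x y) holomorphic_on S"
        using d S(1) by (subst holomorphic_on_open) auto
      thus "continuous_on (cball z r) (\<lambda>y. \<Sum>x\<in>X. f x y)"
        using r(2) holomorphic_on_imp_continuous_on continuous_on_subset by blast
      show "\<forall>w \<in> ball z r. ((\<lambda>y. \<Sum>x\<in>X. f x y) has_field_derivative (\<Sum>x\<in>X. f' x w)) (at w)"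
        using d r(2) by (meson ball_subset_cball subsetD)
    qed
  qed
  obtain g' where g': "\<And>w. w \<in> ball z r \<Longrightarrow> 
      ((\<lambda>y. \<Sum>\<^sub>\<infinity>x\<in>A. f x y) has_field_derivative (g' w)) (at w) \<and>
      ((\<lambda>X. \<Sum>x\<in>X. f' x w) \<longlongrightarrow> g' w) (finite_subsets_at_top A)"
    by (rule has_complex_derivative_uniform_limit[OF ev ul _ r(1)]) auto
  have z: "z \<in> ball z r" using r by auto
  have "((\<lambda>\<omega>. f' \<omega> z) has_sum g' z) A"
    using g'[OF z] by (simp add: has_sum_def)
  thus "(\<lambda>\<omega>. f' \<omega> z) summable_on A"
    and "((\<lambda>z. \<Sum>\<^sub>\<infinity>\<omega>\<in>A. f \<omega> z) has_field_derivative (\<Sum>\<^sub>\<infinity>\<omega>\<in>A. f' \<omega> z)) (at z)"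
    using g'[OF z] by (auto simp: summable_on_def infsumI)
qed

lemma has_field_derivative_prod_log:
  fixes f g :: "'a \<Rightarrow> complex \<Rightarrow> complex"
  assumes "finite A" "\<And>x. x \<in> A \<Longrightarrow> (f x has_field_derivative g x z * f x z) (at z)"
  shows "((\<lambda>z. \<Prod>x\<in>A. f x z) has_field_derivative (\<Sum>x\<in>A. g x z) * (\<Prod>x\<in>A. f x z)) (at z)"
  using assms
proof (induction A rule: finite_induct)
  case (insert x A)
  have "((\<lambda>z. f x z * (\<Prod>x\<in>A. f x z)) has_field_derivative
          (g x z * f x z) * (\<Prod>x\<in>A. f x z) + ((\<Sum>x\<in>A. g x z) * (\<Prod>x\<in>A. f x z)) * f x z) (at z)"
    using insert by (intro DERIV_mult) auto
  thus ?case using insert(1,2) by (simp add: algebra_simps)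
qed auto

context weierstrass_lattice
begin

text \<open>
  On \<open>ball 0 R\<close> the sums and the product over the lattice are split at \<open>norm \<omega> = 2 * R\<close>. The
  logarithm of the tail of the product is a sum whose first and second derivatives are the tails
  of \<open>\<zeta>\<close> and of \<open>-\<wp>\<close>.
\<close>

definition small :: "real \<Rightarrow> complex set" where
  "small R = (\<Lambda> - {0}) \<inter> cball 0 (2 * R)"

definition big :: "real \<Rightarrow> complex set" where
  "big R = (\<Lambda> - {0}) - cball 0 (2 * R)"

definition logterm :: "complex \<Rightarrow> complex \<Rightarrow> complex" where
  "logterm \<omega> z = Ln (1 - z / \<omega>) + z / \<omega> + z ^ 2 / (2 * \<omega> ^ 2)"

definition zterm :: "complex \<Rightarrow> complex \<Rightarrow> complex" where
  "zterm \<omega> z = 1 / (z - \<omega>) + 1 / \<omega> + z / \<omega> ^ 2"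

definition pterm :: "complex \<Rightarrow> complex \<Rightarrow> complex" where
  "pterm \<omega> z = 1 / (z - \<omega>) ^ 2 - 1 / \<omega> ^ 2"

definition tail :: "real \<Rightarrow> complex \<Rightarrow> complex" where
  "tail R z = (\<Sum>\<^sub>\<infinity>\<omega>\<in>big R. logterm \<omega> z)"

definition tail1 :: "real \<Rightarrow> complex \<Rightarrow> complex" where
  "tail1 R z = (\<Sum>\<^sub>\<infinity>\<omega>\<in>big R. zterm \<omega> z)"

definition tail2 :: "real \<Rightarrow> complex \<Rightarrow> complex" where
  "tail2 R z = (\<Sum>\<^sub>\<infinity>\<omega>\<in>big R. pterm \<omega> z)"

section \<open>Estimates for the tails of the lattice sums\<close>

lemma finite_small: "finite (small R)"
  by (rule finite_subset[OF _ finite_lattice_cball[of "2 * R"]]) (auto simp: small_def)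

lemma small_Un_big: "small R \<union> big R = \<Lambda> - {0}" and small_Int_big: "small R \<inter> big R = {}"
  by (auto simp: small_def big_def)

lemma bigD:
  assumes "\<omega> \<in> big R" "z \<in> ball 0 R"
  shows "\<omega> \<noteq> 0" "norm \<omega> > 2 * norm z" "norm \<omega> > 2 * R" "norm (z - \<omega>) \<ge> norm \<omega> / 2" "z \<noteq> \<omega>"
proof -
  show 1: "\<omega> \<noteq> 0" "norm \<omega> > 2 * R" using assms by (auto simp: big_def)
  thus 2: "norm \<omega> > 2 * norm z" using assms by auto
  thus "norm (z - \<omega>) \<ge> norm \<omega> / 2"
    using norm_triangle_ineq2[of \<omega> z] by (simp add: norm_minus_commute)
  show "z \<noteq> \<omega>" using 1 2 by auto
qed

lemma zterm_deriv: "z \<noteq> \<omega> \<Longrightarrow> \<omega> \<noteq> 0 \<Longrightarrow> (zterm \<omega> has_field_derivative - pterm \<omega> z) (at z)"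
  unfolding zterm_def[abs_def] pterm_def
  by (auto intro!: derivative_eq_intros) (simp add: power2_eq_square power4_eq_xxxx)

lemma pterm_deriv: "z \<noteq> \<omega> \<Longrightarrow> (pterm \<omega> has_field_derivative - 2 / (z - \<omega>) ^ 3) (at z)"
  unfolding pterm_def[abs_def]
  by (auto intro!: derivative_eq_intros simp del: power_mult_distrib)
     (simp_all add: power2_eq_square power3_eq_cube power4_eq_xxxx divide_simps)

lemma zterm_eq: "\<omega> \<noteq> 0 \<Longrightarrow> z \<noteq> \<omega> \<Longrightarrow> zterm \<omega> z = z ^ 2 / (\<omega> ^ 2 * (z - \<omega>))"
  unfolding zterm_def by (simp add: divide_simps) (simp add: algebra_simps power2_eq_square)

lemma pterm_eq: "\<omega> \<noteq> 0 \<Longrightarrow> z \<noteq> \<omega> \<Longrightarrow> pterm \<omega> z = z * (2 * \<omega> - z) / (\<omega> ^ 2 * (z - \<omega>) ^ 2)"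
  unfolding pterm_def by (simp add: divide_simps) (simp add: algebra_simps power2_eq_square)

lemma logterm_deriv:
  assumes "\<omega> \<in> big R" "z \<in> ball 0 R"
  shows "(logterm \<omega> has_field_derivative zterm \<omega> z) (at z)"
proof -
  note * = bigD[OF assms]
  have "norm (z / \<omega>) < 1" using * by (simp add: norm_divide) (metis linorder_not_le mult_2 norm_ge_zero add_increasing2 order_trans)
  hence "Re (z / \<omega>) < 1" using complex_Re_le_cmod[of "z / \<omega>"] by linarith
  hence "1 - z / \<omega> \<notin> \<real>\<^sub>\<le>\<^sub>0" by (auto simp: complex_nonpos_Reals_iff)
  thus ?thesis unfolding logterm_def[abs_def] zterm_def
    using * by (auto intro!: derivative_eq_intros simp: divide_simps power2_eq_square) (simp add: algebra_simps)?
qed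

text \<open>The correction terms leave z^2 / (omega^2 (z - omega)), of order 1 / |omega|^3; the
  constant 2 comes from |z - omega| >= |omega| / 2.\<close>

lemma zterm_bound:
  assumes "\<omega> \<in> big R" "z \<in> ball 0 R"
  shows "norm (zterm \<omega> z) \<le> 2 * R ^ 2 * (1 / norm \<omega> ^ 3)"
proof -
  note * = bigD[OF assms]
  have "norm (zterm \<omega> z) = norm z ^ 2 / (norm \<omega> ^ 2 * norm (z - \<omega>))"
    using * by (simp add: zterm_eq norm_divide norm_mult norm_power)
  also have "\<dots> \<le> R ^ 2 / (norm \<omega> ^ 2 * (norm \<omega> / 2))"
    using * assms by (intro frac_le mult_left_mono power_mono mult_pos_pos) auto
  also have "\<dots> = 2 * R ^ 2 * (1 / norm \<omega> ^ 3)"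
    by (simp add: power2_eq_square power3_eq_cube)
  finally show ?thesis .
qed

lemma pterm_bound:
  assumes "\<omega> \<in> big R" "z \<in> ball 0 R"
  shows "norm (pterm \<omega> z) \<le> 12 * R * (1 / norm \<omega> ^ 3)"
proof -
  note * = bigD[OF assms]
  have R: "R > 0" using assms(2) by (auto intro: le_less_trans[OF norm_ge_zero])
  have "norm (2 * \<omega> - z) \<le> 3 * norm \<omega>"
    using norm_triangle_ineq4[of "2 * \<omega>" z] *(2) norm_ge_zero[of z]
    by (simp only: norm_mult norm_numeral)
  \<comment> \<open>The constant 12 is 3 times 4, from |2 omega - z| <= 3 |omega| and |z - omega|^2
    >= |omega|^2 / 4.\<close>
  hence "norm z * norm (2 * \<omega> - z) / (norm \<omega> ^ 2 * norm (z - \<omega>) ^ 2)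
          \<le> R * (3 * norm \<omega>) / (norm \<omega> ^ 2 * (norm \<omega> / 2) ^ 2)"
    using * assms R by (intro frac_le mult_left_mono mult_mono power_mono mult_pos_pos) auto
  also have "\<dots> = 12 * R * (1 / norm \<omega> ^ 3)"
    using *(1) by (simp add: power2_eq_square power3_eq_cube)
  finally show ?thesis
    using * by (simp add: pterm_eq norm_divide norm_mult norm_power)
qed

text \<open>\<open>zterm_bound\<close> is integrated from 0, where \<open>logterm\<close>
  vanishes.\<close>

lemma logterm_bound:
  assumes "\<omega> \<in> big R" "z \<in> ball 0 R"
  shows "norm (logterm \<omega> z) \<le> 2 * R ^ 3 * (1 / norm \<omega> ^ 3)"
proof -
  have R: "R > 0" using assms(2) by (auto intro: le_less_trans[OF norm_ge_zero])
  have "norm (logterm \<omega> z - logterm \<omega> 0) \<le> 2 * R ^ 2 * (1 / norm \<omega> ^ 3) * norm (z - 0)"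
    using assms R
    by (intro field_differentiable_bound[of "ball 0 R" _ "zterm \<omega>"] zterm_bound
          has_field_derivative_at_within[OF logterm_deriv]) auto
  also have "\<dots> \<le> 2 * R ^ 2 * (1 / norm \<omega> ^ 3) * R"
    using assms by (intro mult_left_mono) auto
  finally show ?thesis
    by (simp add: logterm_def power2_eq_square power3_eq_cube mult_ac)
qed

lemma summable_big: "(\<lambda>\<omega>. C * (1 / norm \<omega> ^ 3)) summable_on big R"
  by (intro summable_on_cmult_right summable_on_subset_banach[OF lattice_summable])
     (auto simp: big_def)

lemma summable_logterm: "z \<in> ball 0 R \<Longrightarrow> (\<lambda>\<omega>. logterm \<omega> z) summable_on big R"
  by (rule abs_summable_summable, rule Infinite_Sum.abs_summable_on_comparison_test'[OF summable_big[where C = "2 * R ^ 3"]])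
     (rule logterm_bound)

lemma
  assumes "z \<in> ball 0 R"
  shows tail_deriv: "(tail R has_field_derivative tail1 R z) (at z)"
    and summable_zterm: "(\<lambda>\<omega>. zterm \<omega> z) summable_on big R"
  using has_field_derivative_infsum[OF open_ball assms logterm_deriv logterm_bound summable_big]
  by (auto simp: tail_def[abs_def] tail1_def)

lemma
  assumes "z \<in> ball 0 R"
  shows tail1_deriv: "(tail1 R has_field_derivative - tail2 R z) (at z)"
    and summable_pterm: "(\<lambda>\<omega>. pterm \<omega> z) summable_on big R"
proof -
  have d: "\<And>\<omega> z. \<omega> \<in> big R \<Longrightarrow> z \<in> ball 0 R \<Longrightarrow> (zterm \<omega> has_field_derivative - pterm \<omega> z) (at z)"
    using bigD(1,5) zterm_deriv by blast
  note * = has_field_derivative_infsum[OF open_ball assms d zterm_bound summable_big]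
  from *(2) show "(\<lambda>\<omega>. pterm \<omega> z) summable_on big R"
    using summable_on_uminus by fastforce
  from *(1) show "(tail1 R has_field_derivative - tail2 R z) (at z)"
    by (simp add: tail1_def[abs_def] tail2_def infsum_uminus)
qed

lemma
  assumes "z \<in> ball 0 R"
  shows tail2_deriv: "(tail2 R has_field_derivative (\<Sum>\<^sub>\<infinity>\<omega>\<in>big R. - 2 / (z - \<omega>) ^ 3)) (at z)"
    and summable_cubes: "(\<lambda>\<omega>. - 2 / (z - \<omega>) ^ 3) summable_on big R"
proof -
  have d: "\<And>\<omega> z. \<omega> \<in> big R \<Longrightarrow> z \<in> ball 0 R \<Longrightarrow> (pterm \<omega> has_field_derivative - 2 / (z - \<omega>) ^ 3) (at z)"
    using bigD(5) pterm_deriv by blast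
  note * = has_field_derivative_infsum[OF open_ball assms d pterm_bound summable_big]
  from * show "(tail2 R has_field_derivative (\<Sum>\<^sub>\<infinity>\<omega>\<in>big R. - 2 / (z - \<omega>) ^ 3)) (at z)"
    "(\<lambda>\<omega>. - 2 / (z - \<omega>) ^ 3) summable_on big R"
    by (simp_all add: tail2_def[abs_def])
qed

lemma infsum_small_big:
  fixes f :: "complex \<Rightarrow> complex"
  assumes "f summable_on big R"
  shows "(f has_sum (sum f (small R) + infsum f (big R))) (\<Lambda> - {0})"
  unfolding small_Un_big[of R, symmetric] using small_Int_big assms
  by (intro has_sum_Un_disjoint has_sum_finite finite_small has_sum_infsum)

lemma wzeta_eq:
  "z \<in> ball 0 R \<Longrightarrow> \<zeta> z = 1 / z + (\<Sum>\<omega>\<in>small R. zterm \<omega> z) + tail1 R z"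
  unfolding wzeta_def tail1_def
  using infsumI[OF infsum_small_big[OF summable_zterm, of z R]] by (simp add: zterm_def)

lemma wp_eq:
  "z \<in> ball 0 R \<Longrightarrow> wp \<tau> z = 1 / z ^ 2 + (\<Sum>\<omega>\<in>small R. pterm \<omega> z) + tail2 R z"
  unfolding wp_def tail2_def
  using infsumI[OF infsum_small_big[OF summable_pterm, of z R]] by (simp add: pterm_def)

text \<open>The Weierstrass primary factor of genus 2, at z / omega.\<close>

definition Eterm :: "complex \<Rightarrow> complex \<Rightarrow> complex" where
  "Eterm \<omega> z = (1 - z / \<omega>) * exp (z / \<omega> + z ^ 2 / (2 * \<omega> ^ 2))"

lemma Eterm_eq_exp:
  assumes "\<omega> \<in> big R" "z \<in> ball 0 R"
  shows "Eterm \<omega> z = exp (logterm \<omega> z)"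
proof -
  have "1 - z / \<omega> \<noteq> 0" using bigD[OF assms] by (simp add: field_simps)
  thus ?thesis by (simp add: Eterm_def logterm_def exp_add)
qed

text \<open>Once a finite set contains \<open>small R\<close>, its remaining factors are
  exponentials of \<open>logterm\<close>, so the net of partial products is a constant times the
  exponential of a convergent net of partial sums.\<close>

lemma wsigma_eq:
  assumes "z \<in> ball 0 R"
  shows "\<sigma> z = z * (\<Prod>\<omega>\<in>small R. Eterm \<omega> z) * exp (tail R z)"
proof -
  let ?L = "\<Lambda> - {0}"
  \<comment> \<open>Extension by 0 lets the sum run over the same index set as the product.\<close>
  define g where "g = (\<lambda>\<omega>. if \<omega> \<in> small R then 0 else logterm \<omega> z)"
  have "(g has_sum tail R z) ?L \<longleftrightarrow> ((\<lambda>\<omega>. logterm \<omega> z) has_sum tail R z) (big R)"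
    using small_Un_big[of R] small_Int_big[of R] by (intro has_sum_cong_neutral) (auto simp: g_def)
  hence "(g has_sum tail R z) ?L"
    unfolding tail_def using summable_logterm[OF assms] by simp
  hence "((\<lambda>F. sum g F) \<longlongrightarrow> tail R z) (finite_subsets_at_top ?L)"
    by (simp add: has_sum_def)
  hence lim: "((\<lambda>F. (\<Prod>\<omega>\<in>small R. Eterm \<omega> z) * exp (sum g F)) \<longlongrightarrow>
          (\<Prod>\<omega>\<in>small R. Eterm \<omega> z) * exp (tail R z)) (finite_subsets_at_top ?L)"
    by (intro tendsto_intros)
  have "((\<lambda>F. \<Prod>\<omega>\<in>F. Eterm \<omega> z) \<longlongrightarrow>
          (\<Prod>\<omega>\<in>small R. Eterm \<omega> z) * exp (tail R z)) (finite_subsets_at_top ?L)"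
  proof (rule Lim_transform_eventually[OF lim])
    show "\<forall>\<^sub>F F in finite_subsets_at_top ?L.
            (\<Prod>\<omega>\<in>small R. Eterm \<omega> z) * exp (sum g F) = (\<Prod>\<omega>\<in>F. Eterm \<omega> z)"
      unfolding eventually_finite_subsets_at_top
    proof (intro exI[of _ "small R"] conjI allI impI)
      show "small R \<subseteq> ?L" by (auto simp: small_def)
      fix F assume F: "finite F \<and> small R \<subseteq> F \<and> F \<subseteq> ?L"
      have "sum g F = sum g (F - small R)"
        using F by (intro sum.mono_neutral_right) (auto simp: g_def)
      hence "exp (sum g F) = (\<Prod>\<omega>\<in>F - small R. exp (g \<omega>))"
        using F by (simp add: exp_sum)
      also have "\<dots> = (\<Prod>\<omega>\<in>F - small R. Eterm \<omega> z)"
        using F small_Un_big[of R] Eterm_eq_exp[OF _ assms]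
        by (intro prod.cong) (auto simp: g_def)
      finally show "(\<Prod>\<omega>\<in>small R. Eterm \<omega> z) * exp (sum g F) = (\<Prod>\<omega>\<in>F. Eterm \<omega> z)"
        using F by (simp add: prod.subset_diff[of "small R" F] mult.commute)
    qed (rule finite_small)
  qed
  hence "Lim (finite_subsets_at_top ?L) (\<lambda>F. \<Prod>\<omega>\<in>F. Eterm \<omega> z) =
          (\<Prod>\<omega>\<in>small R. Eterm \<omega> z) * exp (tail R z)"
    by (intro tendsto_Lim) auto
  thus ?thesis by (simp add: wsigma_def Eterm_def)
qed

lemma Eterm_deriv:
  assumes "\<omega> \<noteq> 0" "z \<noteq> \<omega>"
  shows "(Eterm \<omega> has_field_derivative zterm \<omega> z * Eterm \<omega> z) (at z)"
proof -
  have "(Eterm \<omega> has_field_derivative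
      (- (1 / \<omega>) + (1 - z / \<omega>) * (1 / \<omega> + z / \<omega> ^ 2)) * exp (z / \<omega> + z ^ 2 / (2 * \<omega> ^ 2))) (at z)"
  proof -
    have 1: "((\<lambda>z. 1 - z / \<omega>) has_field_derivative - (1 / \<omega>)) (at z)"
      by (auto intro!: derivative_eq_intros simp: assms)
    have 2: "((\<lambda>z. z / \<omega> + z ^ 2 / (2 * \<omega> ^ 2)) has_field_derivative 1 / \<omega> + z / \<omega> ^ 2) (at z)"
      by (auto intro!: derivative_eq_intros simp: assms power2_eq_square)
    show ?thesis
      unfolding Eterm_def[abs_def]
      by (rule DERIV_cong[OF DERIV_mult[OF 1 DERIV_chain2[OF DERIV_exp 2]]])
         (simp add: algebra_simps diff_divide_distrib power2_eq_square)
  qed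
  moreover have "- (1 / \<omega>) + (1 - z / \<omega>) * (1 / \<omega> + z / \<omega> ^ 2) = zterm \<omega> z * (1 - z / \<omega>)"
  proof -
    have "- (1 / \<omega>) = 1 / (z - \<omega>) * (1 - z / \<omega>)"
      using assms by (simp add: divide_simps)
    thus ?thesis by (simp add: zterm_def algebra_simps)
  qed
  ultimately show ?thesis by (simp add: Eterm_def mult.assoc)
qed

lemma Eterm_eq_0_iff: "\<omega> \<noteq> 0 \<Longrightarrow> Eterm \<omega> z = 0 \<longleftrightarrow> z = \<omega>"
  by (auto simp: Eterm_def)

section \<open>Zeros and derivatives of sigma, zeta and wp\<close>

lemma in_ball_succ: "z \<in> ball 0 (norm z + 1)"
  by simp

lemma wsigma_eq_0_iff: "\<sigma> z = 0 \<longleftrightarrow> z \<in> \<Lambda>"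
proof -
  have "\<sigma> z = 0 \<longleftrightarrow> z = 0 \<or> z \<in> small (norm z + 1)"
    using finite_small[of "norm z + 1"] unfolding wsigma_eq[OF in_ball_succ]
    by (auto simp: Eterm_eq_0_iff small_def)
  also have "\<dots> \<longleftrightarrow> z \<in> \<Lambda>"
    using zero_in_lattice by (auto simp: small_def)
  finally show ?thesis .
qed

lemma wsigma_deriv:
  assumes z: "z \<notin> \<Lambda>"
  shows "(\<sigma> has_field_derivative \<zeta> z * \<sigma> z) (at z)"
proof -
  define R where "R = norm z + 1"
  have zR: "z \<in> ball 0 R" by (simp add: R_def)
  have z0: "z \<noteq> 0" using z zero_in_lattice by auto
  have sm: "\<omega> \<noteq> 0 \<and> z \<noteq> \<omega>" if "\<omega> \<in> small R" for \<omega> using that z by (auto simp: small_def)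
  have "((\<lambda>z. z * (\<Prod>\<omega>\<in>small R. Eterm \<omega> z) * exp (tail R z)) has_field_derivative
     \<zeta> z * \<sigma> z) (at z)"
  proof -
    have P: "((\<lambda>z. \<Prod>\<omega>\<in>small R. Eterm \<omega> z) has_field_derivative
              (\<Sum>\<omega>\<in>small R. zterm \<omega> z) * (\<Prod>\<omega>\<in>small R. Eterm \<omega> z)) (at z)"
      using sm by (intro has_field_derivative_prod_log finite_small Eterm_deriv) auto
    show ?thesis
      unfolding wzeta_eq[OF zR] wsigma_eq[OF zR]
      by (rule DERIV_cong[OF DERIV_mult[OF DERIV_mult[OF DERIV_ident P] DERIV_chain2[OF DERIV_exp tail_deriv[OF zR]]]])
         (use z0 in \<open>simp add: field_simps\<close>)
  qed
  thus ?thesis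
    by (rule has_field_derivative_transform_within_open[OF _ open_ball zR]) (simp add: wsigma_eq)
qed

lemma holomorphic_tail: "tail R holomorphic_on ball 0 R"
  unfolding holomorphic_on_open[OF open_ball] using tail_deriv by blast

lemma holomorphic_wsigma: "\<sigma> holomorphic_on A"
proof -
  have *: "\<sigma> holomorphic_on ball 0 R" for R
  proof -
    have "(\<lambda>z. z * (\<Prod>\<omega>\<in>small R. Eterm \<omega> z) * exp (tail R z)) holomorphic_on ball 0 R"
      unfolding Eterm_def by (intro holomorphic_intros holomorphic_tail) (auto simp: small_def)
    thus ?thesis by (subst holomorphic_cong[OF refl wsigma_eq]) auto
  qed
  have "\<sigma> holomorphic_on (\<Union>R. ball 0 R)"
    using * by (intro holomorphic_on_UN_open) auto
  also have "(\<Union>R. ball 0 R) = (UNIV :: complex set)"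
    using in_ball_succ by blast
  finally show ?thesis by (rule holomorphic_on_subset) auto
qed

lemma holomorphic_wsigma' [holomorphic_intros]:
  "f holomorphic_on A \<Longrightarrow> (\<lambda>z. \<sigma> (f z)) holomorphic_on A"
  using holomorphic_on_compose[OF _ holomorphic_wsigma, of f A] by (simp add: o_def)

lemma wzeta_deriv:
  assumes z: "z \<notin> \<Lambda>"
  shows "(\<zeta> has_field_derivative - wp \<tau> z) (at z)"
proof -
  define R where "R = norm z + 1"
  have zR: "z \<in> ball 0 R" by (simp add: R_def)
  have z0: "z \<noteq> 0" using z zero_in_lattice by auto
  have sm: "\<omega> \<noteq> 0 \<and> z \<noteq> \<omega>" if "\<omega> \<in> small R" for \<omega> using that z by (auto simp: small_def)
  have "((\<lambda>z. 1 / z + (\<Sum>\<omega>\<in>small R. zterm \<omega> z) + tail1 R z) has_field_derivative - wp \<tau> z) (at z)"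
  proof -
    have 1: "((\<lambda>z. 1 / z) has_field_derivative - (1 / z ^ 2)) (at z)"
      using z0 by (auto intro!: derivative_eq_intros simp: power2_eq_square)
    have 2: "((\<lambda>z. \<Sum>\<omega>\<in>small R. zterm \<omega> z) has_field_derivative (\<Sum>\<omega>\<in>small R. - pterm \<omega> z)) (at z)"
      using sm by (intro DERIV_sum zterm_deriv) auto
    show ?thesis
      unfolding wp_eq[OF zR]
      by (rule DERIV_cong[OF DERIV_add[OF DERIV_add[OF 1 2] tail1_deriv[OF zR]]]) (simp add: sum_negf)
  qed
  thus ?thesis
    by (rule has_field_derivative_transform_within_open[OF _ open_ball zR]) (simp add: wzeta_eq)
qed

text \<open>Differentiation removes the corrections 1 / omega^2, and the term of omega = 0 joins the
  others. The resulting sum over the full lattice is visibly periodic, which is what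
  \<open>wp_periodic\<close> starts from.\<close>

lemma wp_deriv:
  assumes z: "z \<notin> \<Lambda>"
  shows "(wp \<tau> has_field_derivative (\<Sum>\<^sub>\<infinity>\<omega>\<in>\<Lambda>. - 2 / (z - \<omega>) ^ 3)) (at z)"
proof -
  define R where "R = norm z + 1"
  have zR: "z \<in> ball 0 R" by (simp add: R_def)
  have z0: "z \<noteq> 0" using z zero_in_lattice by auto
  have sm: "\<omega> \<noteq> 0 \<and> z \<noteq> \<omega>" if "\<omega> \<in> small R" for \<omega> using that z by (auto simp: small_def)
  have ins: "\<Lambda> = insert 0 (\<Lambda> - {0})" using zero_in_lattice by auto
  have "((\<lambda>\<omega>. - 2 / (z - \<omega>) ^ 3) has_sum (- 2 / (z - 0) ^ 3 + ((\<Sum>\<omega>\<in>small R. - 2 / (z - \<omega>) ^ 3) +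
          (\<Sum>\<^sub>\<infinity>\<omega>\<in>big R. - 2 / (z - \<omega>) ^ 3)))) (\<Lambda>)"
    by (subst ins, rule has_sum_insert[OF _ infsum_small_big[OF summable_cubes[OF zR]]]) simp
  hence eq: "(\<Sum>\<^sub>\<infinity>\<omega>\<in>\<Lambda>. - 2 / (z - \<omega>) ^ 3) =
      - 2 / z ^ 3 + (\<Sum>\<omega>\<in>small R. - 2 / (z - \<omega>) ^ 3) + (\<Sum>\<^sub>\<infinity>\<omega>\<in>big R. - 2 / (z - \<omega>) ^ 3)"
    by (auto dest!: infsumI simp: add.assoc)
  have "((\<lambda>z. 1 / z ^ 2) has_field_derivative - 2 / z ^ 3) (at z)"
    using z0 by (auto intro!: derivative_eq_intros simp: field_simps power2_eq_square power3_eq_cube)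
  hence "((\<lambda>z. 1 / z ^ 2 + (\<Sum>\<omega>\<in>small R. pterm \<omega> z) + tail2 R z) has_field_derivative
           (\<Sum>\<^sub>\<infinity>\<omega>\<in>\<Lambda>. - 2 / (z - \<omega>) ^ 3)) (at z)"
    unfolding eq using sm by (intro DERIV_add DERIV_sum pterm_deriv tail2_deriv zR) auto
  thus ?thesis
    by (rule has_field_derivative_transform_within_open[OF _ open_ball zR]) (simp add: wp_eq)
qed

lemma lattice_isolated: "\<exists>\<delta>>0. \<forall>\<omega>\<in>\<Lambda>. \<omega> \<noteq> c \<longrightarrow> \<delta> \<le> dist c \<omega>"
proof -
  obtain d where d: "d > 0" "\<forall>x\<in>\<Lambda> \<inter> cball 0 (norm c + 1). x \<noteq> c \<longrightarrow> d \<le> dist c x"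
    using finite_set_avoid[OF finite_lattice_cball] by blast
  have "min d 1 \<le> dist c \<omega>" if "\<omega> \<in> \<Lambda>" "\<omega> \<noteq> c" for \<omega>
  proof (cases "norm \<omega> \<le> norm c + 1")
    case False
    have "norm \<omega> - norm c \<le> dist c \<omega>"
      using norm_triangle_ineq2[of \<omega> c] by (simp add: dist_norm norm_minus_commute)
    thus ?thesis using False by linarith
  qed (use d that in auto)
  thus ?thesis using d(1) by (intro exI[of _ "min d 1"]) auto
qed

lemma open_Compl_lattice: "open (- \<Lambda>)"
  unfolding open_dist
proof
  fix c assume c: "c \<in> - \<Lambda>"
  obtain d where d: "d > 0" "\<forall>\<omega>\<in>\<Lambda>. \<omega> \<noteq> c \<longrightarrow> d \<le> dist c \<omega>"
    using lattice_isolated by blast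
  thus "\<exists>e>0. \<forall>y. dist y c < e \<longrightarrow> y \<in> - \<Lambda>"
    using c by (intro exI[of _ d]) (auto simp: dist_commute not_le[symmetric])
qed

lemma connected_Compl_lattice: "connected (- \<Lambda>)"
  unfolding Compl_eq_Diff_UNIV
  by (rule connected_open_diff_countable[OF _ open_UNIV connected_UNIV countable_lattice]) simp

lemma holomorphic_wzeta: "\<zeta> holomorphic_on - \<Lambda>"
  using wzeta_deriv open_Compl_lattice by (subst holomorphic_on_open) auto

lemma holomorphic_wp: "wp \<tau> holomorphic_on - \<Lambda>"
  using wp_deriv open_Compl_lattice by (subst holomorphic_on_open) auto

text \<open>Here t is a logarithm of sigma(z) / z, and its derivatives are the regular parts of zeta
  and, up to sign, of wp. The value \<open>deriv t 0 = 0\<close> is the source of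
  \<open>deriv2_wsigma_0\<close>.\<close>

lemma expansion_at_0:
  obtains R :: real and t :: "complex \<Rightarrow> complex" where "R > 0" "t holomorphic_on ball 0 R"
    "deriv t 0 = 0" "\<And>z::complex. z \<in> ball 0 R \<Longrightarrow> \<sigma> z = z * exp (t z)"
    "\<And>z::complex. z \<in> ball 0 R \<Longrightarrow> z \<noteq> 0 \<Longrightarrow> z \<notin> \<Lambda>"
    "\<And>z::complex. z \<in> ball 0 R \<Longrightarrow> z \<noteq> 0 \<Longrightarrow> \<zeta> z = 1 / z + deriv t z"
    "\<And>z::complex. z \<in> ball 0 R \<Longrightarrow> z \<noteq> 0 \<Longrightarrow> wp \<tau> z = 1 / z ^ 2 - deriv (deriv t) z"
proof -
  obtain d where d: "d > 0" "\<forall>\<omega>\<in>\<Lambda>. \<omega> \<noteq> 0 \<longrightarrow> d \<le> dist 0 \<omega>"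
    using lattice_isolated by blast
  \<comment> \<open>\<open>small R\<close> reaches out to 2 R, so a third of the distance makes it
    empty and no finite factors remain.\<close>
  define R where "R = d / 3"
  have R: "R > 0" using d by (simp add: R_def)
  have small: "small R = {}" using d by (force simp: small_def R_def)
  have t1: "deriv (tail R) z = tail1 R z" if "z \<in> ball 0 R" for z
    by (intro DERIV_imp_deriv tail_deriv that)
  have t2: "deriv (deriv (tail R)) z = - tail2 R z" if "z \<in> ball 0 R" for z
  proof -
    have "(deriv (tail R) has_field_derivative - tail2 R z) (at z)"
      by (rule has_field_derivative_transform_within_open[OF tail1_deriv[OF that] open_ball that])
         (simp add: t1)
    thus ?thesis by (rule DERIV_imp_deriv)
  qed
  have "deriv (tail R) 0 = 0"
    using t1[of 0] R by (simp add: tail1_def zterm_def infsum_0)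
  show ?thesis
  proof (rule that[OF R holomorphic_tail \<open>deriv (tail R) 0 = 0\<close>])
    fix z :: complex assume z: "z \<in> ball 0 R"
    show "\<sigma> z = z * exp (tail R z)" by (simp add: wsigma_eq[OF z] small)
    assume "z \<noteq> 0"
    thus "z \<notin> \<Lambda>" using d z by (force simp: R_def)
    show "\<zeta> z = 1 / z + deriv (tail R) z" by (simp add: wzeta_eq[OF z] small t1[OF z])
    show "wp \<tau> z = 1 / z ^ 2 - deriv (deriv (tail R)) z" by (simp add: wp_eq[OF z] small t2[OF z])
  qed
qed

section \<open>Parity and behaviour under lattice translations\<close>

lemma bij_betw_uminus_lattice: "bij_betw uminus (\<Lambda> - {0}) (\<Lambda> - {0})"
  by (rule bij_betwI[of _ _ _ uminus]) (auto simp: lattice_minus_iff)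

lemma wzeta_minus: "\<zeta> (- z) = - \<zeta> z"
proof -
  have "(\<Sum>\<^sub>\<infinity>\<omega>\<in>\<Lambda> - {0}. zterm \<omega> (- z)) = (\<Sum>\<^sub>\<infinity>\<omega>\<in>\<Lambda> - {0}. zterm (- \<omega>) (- z))"
    by (rule infsum_reindex_bij_betw[OF bij_betw_uminus_lattice, symmetric])
  also have "\<dots> = (\<Sum>\<^sub>\<infinity>\<omega>\<in>\<Lambda> - {0}. - zterm \<omega> z)"
  proof (rule infsum_cong)
    fix \<omega> assume "\<omega> \<in> \<Lambda> - {0}"
    have "1 / (\<omega> - z) = - (1 / (z - \<omega>))" by (simp add: divide_simps)
    thus "zterm (- \<omega>) (- z) = - zterm \<omega> z" by (simp add: zterm_def)
  qed
  finally have "(\<Sum>\<^sub>\<infinity>\<omega>\<in>\<Lambda> - {0}. zterm \<omega> (- z)) = - (\<Sum>\<^sub>\<infinity>\<omega>\<in>\<Lambda> - {0}. zterm \<omega> z)"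
    by (simp add: infsum_uminus)
  moreover have "\<zeta> x = 1 / x + (\<Sum>\<^sub>\<infinity>\<omega>\<in>\<Lambda> - {0}. zterm \<omega> x)" for x
    by (simp add: wzeta_def zterm_def)
  ultimately show ?thesis by simp
qed

lemma wp_minus: "wp \<tau> (- z) = wp \<tau> z"
proof -
  have "(\<Sum>\<^sub>\<infinity>\<omega>\<in>\<Lambda> - {0}. pterm \<omega> (- z)) = (\<Sum>\<^sub>\<infinity>\<omega>\<in>\<Lambda> - {0}. pterm (- \<omega>) (- z))"
    by (rule infsum_reindex_bij_betw[OF bij_betw_uminus_lattice, symmetric])
  also have "\<dots> = (\<Sum>\<^sub>\<infinity>\<omega>\<in>\<Lambda> - {0}. pterm \<omega> z)"
    by (rule infsum_cong) (simp add: pterm_def power2_commute)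
  finally have "(\<Sum>\<^sub>\<infinity>\<omega>\<in>\<Lambda> - {0}. pterm \<omega> (- z)) = (\<Sum>\<^sub>\<infinity>\<omega>\<in>\<Lambda> - {0}. pterm \<omega> z)" .
  moreover have "wp \<tau> x = 1 / x ^ 2 + (\<Sum>\<^sub>\<infinity>\<omega>\<in>\<Lambda> - {0}. pterm \<omega> x)" for x
    by (simp add: wp_def pterm_def)
  ultimately show ?thesis by simp
qed

text \<open>The translation constant is odd in \<open>\<omega>\<close> by additivity, and even because \<open>\<wp>\<close> is.\<close>

lemma wp_periodic:
  assumes \<omega>: "\<omega> \<in> \<Lambda>" and z: "z \<notin> \<Lambda>"
  shows "wp \<tau> (z + \<omega>) = wp \<tau> z"
proof -
  have per: "(\<Sum>\<^sub>\<infinity>v\<in>\<Lambda>. - 2 / (z + \<omega> - v) ^ 3) = (\<Sum>\<^sub>\<infinity>v\<in>\<Lambda>. - 2 / (z - v) ^ 3)" for z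
  proof -
    have "bij_betw (\<lambda>v. v + \<omega>) (\<Lambda>) (\<Lambda>)"
      by (rule bij_betwI[of _ _ _ "\<lambda>v. v - \<omega>"]) (auto intro: lattice_add lattice_diff \<omega>)
    from infsum_reindex_bij_betw[OF this, of "\<lambda>v. - 2 / (z + \<omega> - v) ^ 3"] show ?thesis by simp
  qed
  have "(\<lambda>z. wp \<tau> (z + \<omega>) - wp \<tau> z) constant_on - \<Lambda>"
  proof (rule has_field_derivative_0_imp_constant_on[OF _ connected_Compl_lattice open_Compl_lattice])
    fix z assume z: "z \<in> - \<Lambda>"
    hence z': "z + \<omega> \<notin> \<Lambda>" using \<omega> by (simp add: lattice_add_iff)
    show "((\<lambda>z. wp \<tau> (z + \<omega>) - wp \<tau> z) has_field_derivative 0) (at z)"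
      using DERIV_diff[OF has_field_derivative_translate[OF wp_deriv[OF z']] wp_deriv] z per[of z] by simp
  qed
  then obtain C where C: "\<And>z. z \<notin> \<Lambda> \<Longrightarrow> wp \<tau> (z + \<omega>) - wp \<tau> z = C"
    by (auto simp: constant_on_def)
  have "- z \<notin> \<Lambda>" "- z - \<omega> \<notin> \<Lambda>"
    using z \<omega> lattice_minus_iff[of z] lattice_diff_iff[of \<omega> \<tau> "- z"] by auto
  moreover have "wp \<tau> (- z - \<omega>) = wp \<tau> (z + \<omega>)" using wp_minus[of "z + \<omega>"] by simp
  ultimately have "wp \<tau> (- z) - wp \<tau> (z + \<omega>) = C" using C[of "- z - \<omega>"] by simp
  hence "wp \<tau> z - wp \<tau> (z + \<omega>) = C" by (simp add: wp_minus)
  with C[OF z] have "C + C = (wp \<tau> (z + \<omega>) - wp \<tau> z) + (wp \<tau> z - wp \<tau> (z + \<omega>))"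
    by simp
  hence "C = 0" by simp
  thus ?thesis using C[OF z] by simp
qed

text \<open>The quasi-period of zeta belonging to omega; \<open>wzeta_translate\<close> shows that
  the choice succeeds for lattice vectors.\<close>

definition eta :: "complex \<Rightarrow> complex" where
  "eta \<omega> = (SOME e. \<forall>z. z \<notin> \<Lambda> \<longrightarrow> \<zeta> (z + \<omega>) = \<zeta> z + e)"

lemma wzeta_translate:
  assumes \<omega>: "\<omega> \<in> \<Lambda>" and z: "z \<notin> \<Lambda>"
  shows "\<zeta> (z + \<omega>) = \<zeta> z + eta \<omega>"
proof -
  have "(\<lambda>z. \<zeta> (z + \<omega>) - \<zeta> z) constant_on - \<Lambda>"
  proof (rule has_field_derivative_0_imp_constant_on[OF _ connected_Compl_lattice open_Compl_lattice])
    fix z assume z: "z \<in> - \<Lambda>"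
    hence z': "z + \<omega> \<notin> \<Lambda>" using \<omega> by (simp add: lattice_add_iff)
    show "((\<lambda>z. \<zeta> (z + \<omega>) - \<zeta> z) has_field_derivative 0) (at z)"
      using DERIV_diff[OF has_field_derivative_translate[OF wzeta_deriv[OF z']] wzeta_deriv] z wp_periodic[OF \<omega>] by simp
  qed
  then obtain C where C: "\<And>z. z \<notin> \<Lambda> \<Longrightarrow> \<zeta> (z + \<omega>) - \<zeta> z = C"
    by (auto simp: constant_on_def)
  have "\<exists>e. \<forall>z. z \<notin> \<Lambda> \<longrightarrow> \<zeta> (z + \<omega>) = \<zeta> z + e"
    using C by (intro exI[of _ C]) (simp add: algebra_simps)
  hence "\<forall>z. z \<notin> \<Lambda> \<longrightarrow> \<zeta> (z + \<omega>) = \<zeta> z + eta \<omega>"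
    unfolding eta_def by (rule someI_ex)
  thus ?thesis using z by blast
qed

text \<open>The quotient of the two sides has logarithmic derivative zeta(z + omega) - zeta(z) - eta
  = 0 off the lattice. On the lattice both sides vanish.\<close>

lemma wsigma_translate:
  assumes \<omega>: "\<omega> \<in> \<Lambda>"
  obtains K where "K \<noteq> 0" "\<And>z. \<sigma> (z + \<omega>) = K * exp (eta \<omega> * z) * \<sigma> z"
proof -
  let ?f = "\<lambda>z. \<sigma> (z + \<omega>) / (exp (eta \<omega> * z) * \<sigma> z)"
  have "?f constant_on - \<Lambda>"
  proof (rule has_field_derivative_0_imp_constant_on[OF _ connected_Compl_lattice open_Compl_lattice])
    fix z assume z: "z \<in> - \<Lambda>"
    hence z': "z + \<omega> \<notin> \<Lambda>" using \<omega> by (simp add: lattice_add_iff)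
    have nz: "\<sigma> z \<noteq> 0" using z by (simp add: wsigma_eq_0_iff)
    have d: "((\<lambda>z. \<sigma> (z + \<omega>)) has_field_derivative (\<zeta> z + eta \<omega>) * \<sigma> (z + \<omega>)) (at z)"
      using has_field_derivative_translate[OF wsigma_deriv[OF z']] wzeta_translate[OF \<omega>] z by simp
    have d2: "((\<lambda>z. exp (eta \<omega> * z) * \<sigma> z) has_field_derivative
        (\<zeta> z + eta \<omega>) * (exp (eta \<omega> * z) * \<sigma> z)) (at z)"
      using z by (auto intro!: derivative_eq_intros wsigma_deriv simp: algebra_simps)
    show "(?f has_field_derivative 0) (at z)"
      using DERIV_divide[OF d d2] nz by simp
  qed
  then obtain K where K: "\<And>z. z \<notin> \<Lambda> \<Longrightarrow> ?f z = K"
    by (auto simp: constant_on_def)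
  have eq: "\<sigma> (z + \<omega>) = K * exp (eta \<omega> * z) * \<sigma> z" for z
  proof (cases "z \<in> \<Lambda>")
    case True
    thus ?thesis using \<omega> wsigma_eq_0_iff[of z] wsigma_eq_0_iff[of "z + \<omega>"] by (simp add: lattice_add_iff)
  next
    case False
    thus ?thesis using K[OF False] wsigma_eq_0_iff[of z] by (auto simp: field_simps)
  qed
  obtain z where z: "z \<notin> \<Lambda>"
    using countable_lattice uncountable_UNIV_complex by (metis UNIV_eq_I)
  hence "K \<noteq> 0" using K[OF z] \<omega> by (auto simp: wsigma_eq_0_iff lattice_add_iff)
  from that[OF this eq] show ?thesis .
qed

text \<open>Legendre's relation, up to a multiple of \<open>2 \<pi> \<i>\<close>: evaluate \<open>\<sigma>(z + 1 + \<tau>)\<close> in two ways.\<close>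

lemma exp_Legendre: "exp (eta 1 * \<tau>) = exp (eta \<tau>)"
proof -
  obtain K where K: "K \<noteq> 0" "\<And>z. \<sigma> (z + 1) = K * exp (eta 1 * z) * \<sigma> z"
    using wsigma_translate[OF one_in_lattice] by blast
  obtain L where L: "L \<noteq> 0" "\<And>z. \<sigma> (z + \<tau>) = L * exp (eta \<tau> * z) * \<sigma> z"
    using wsigma_translate[OF tau_in_lattice] by blast
  obtain z where z: "z \<notin> \<Lambda>"
    using countable_lattice uncountable_UNIV_complex by (metis UNIV_eq_I)
  have "\<sigma> (z + \<tau> + 1) = \<sigma> (z + 1 + \<tau>)" by (simp add: add_ac)
  hence "K * exp (eta 1 * (z + \<tau>)) * (L * exp (eta \<tau> * z) * \<sigma> z) =
         L * exp (eta \<tau> * (z + 1)) * (K * exp (eta 1 * z) * \<sigma> z)"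
    by (simp only: K(2) L(2))
  thus ?thesis using K(1) L(1) z by (simp add: wsigma_eq_0_iff exp_add ring_distribs mult_ac)
qed

section \<open>Simplicity of the zeros of sigma\<close>

lemma deriv_wsigma_0: "deriv (\<sigma>) 0 \<noteq> 0"
proof -
  obtain R t where R: "R > 0" "t holomorphic_on ball 0 R"
    "\<And>z. z \<in> ball 0 R \<Longrightarrow> \<sigma> z = z * exp (t z)"
    using expansion_at_0 by metis
  have "((\<lambda>z. z * exp (t z)) has_field_derivative exp (t 0)) (at 0)"
    using R(1) by (auto intro!: derivative_eq_intros holomorphic_derivI[OF R(2) open_ball])
  hence "(\<sigma> has_field_derivative exp (t 0)) (at 0)"
    by (rule has_field_derivative_transform_within_open[of _ _ _ "ball 0 R"]) (use R in auto)
  thus ?thesis by (simp add: DERIV_imp_deriv)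
qed

lemma wsigma_has_deriv: "(\<sigma> has_field_derivative deriv (\<sigma>) z) (at z)"
  by (rule holomorphic_derivI[OF holomorphic_wsigma[of UNIV]]) auto

lemma deriv_wsigma_nonzero:
  assumes \<omega>: "\<omega> \<in> \<Lambda>"
  shows "deriv (\<sigma>) \<omega> \<noteq> 0"
proof -
  obtain K where K: "K \<noteq> 0" "\<And>z. \<sigma> (z + \<omega>) = K * exp (eta \<omega> * z) * \<sigma> z"
    using wsigma_translate[OF \<omega>] by blast
  have "((\<lambda>z. \<sigma> (z + \<omega>)) has_field_derivative deriv (\<sigma>) (0 + \<omega>)) (at 0)"
    by (rule has_field_derivative_translate[OF wsigma_has_deriv])
  moreover have "((\<lambda>z. K * exp (eta \<omega> * z) * \<sigma> z) has_field_derivative K * deriv (\<sigma>) 0) (at 0)"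
  proof -
    have 1: "((\<lambda>z. K * exp (eta \<omega> * z)) has_field_derivative K * eta \<omega>) (at 0)"
      by (auto intro!: derivative_eq_intros)
    have "\<sigma> 0 = 0" by (simp add: wsigma_eq_0_iff zero_in_lattice)
    thus ?thesis by (intro DERIV_cong[OF DERIV_mult[OF 1 wsigma_has_deriv]]) simp
  qed
  ultimately have "deriv (\<sigma>) (0 + \<omega>) = K * deriv (\<sigma>) 0"
    unfolding K(2) by (rule DERIV_unique)
  hence "deriv (\<sigma>) \<omega> = K * deriv (\<sigma>) 0" by simp
  thus ?thesis using K(1) deriv_wsigma_0 by simp
qed

text \<open>For sigma = z exp t the second derivative at 0 is 2 exp (t 0) t'(0), and t'(0) =
  0.\<close>

lemma deriv2_wsigma_0: "deriv (deriv (\<sigma>)) 0 = 0"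
proof -
  obtain R t where R: "R > 0" "t holomorphic_on ball 0 R" "deriv t 0 = 0"
    "\<And>z. z \<in> ball 0 R \<Longrightarrow> \<sigma> z = z * exp (t z)"
    using expansion_at_0 by metis
  have z: "0 \<in> ball 0 R" using R(1) by simp
  have td: "(t has_field_derivative deriv t z) (at z)"
    "(deriv t has_field_derivative deriv (deriv t) z) (at z)" if "z \<in> ball 0 R" for z
    using that by (auto intro: holomorphic_derivI[OF R(2) open_ball]
      holomorphic_derivI[OF holomorphic_deriv[OF R(2) open_ball] open_ball])
  have e: "((\<lambda>z. exp (t z)) has_field_derivative exp (t z) * deriv t z) (at z)" if "z \<in> ball 0 R" for z
    by (rule DERIV_chain2[OF DERIV_exp td(1)[OF that]])
  have d1: "(\<sigma> has_field_derivative exp (t z) + exp (t z) * deriv t z * z) (at z)"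
    if "z \<in> ball 0 R" for z
    by (rule has_field_derivative_transform_within_open[OF _ open_ball that])
       (use DERIV_mult[OF DERIV_ident e[OF that]] R(4) in auto)
  have "deriv (deriv (\<sigma>)) 0 = exp (t 0) * deriv t 0 +
      (((exp (t 0) * deriv t 0) * deriv t 0 + deriv (deriv t) 0 * exp (t 0)) * 0 + 1 * (exp (t 0) * deriv t 0))"
    by (rule deriv_deriv_eqI[OF open_ball z d1], assumption)
       (intro DERIV_add DERIV_mult e z td DERIV_ident)
  thus ?thesis by (simp add: R(3))
qed

end

section \<open>Functions with multipliers\<close>

lemma periodic_of_int:
  fixes \<omega> :: complex
  assumes "\<And>z. g (z + \<omega>) = g z"
  shows "g (z + of_int n * \<omega>) = g z"
proof (induction n rule: int_induct[where k = 0])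
  case (step1 i)
  have "z + of_int (i + 1) * \<omega> = (z + of_int i * \<omega>) + \<omega>" by (simp add: algebra_simps)
  thus ?case using assms[of "z + of_int i * \<omega>"] step1 by (simp only:)
next
  case (step2 i)
  have "(z + of_int (i - 1) * \<omega>) + \<omega> = z + of_int i * \<omega>" by (simp add: algebra_simps)
  thus ?case using assms[of "z + of_int (i - 1) * \<omega>"] step2 by (simp only:)
qed simp

lemma holomorphic_UNIV_if_local:
  fixes q :: "complex \<Rightarrow> complex"
  assumes "\<And>c. \<exists>e>0. q holomorphic_on ball c e"
  shows "q holomorphic_on UNIV"
proof -
  have "q analytic_on UNIV" using assms by (auto simp: analytic_on_def)
  thus ?thesis by (rule analytic_imp_holomorphic)
qed

text \<open>Near a zero c of \<open>s\<close> the quotient equals that of the difference quotients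
  of \<open>f\<close> and \<open>s\<close> at c, and the second of these does not vanish since the
  zero is simple.\<close>

lemma entire_quotient_simple_zeros:
  assumes f: "f holomorphic_on UNIV" and s: "s holomorphic_on UNIV"
    and z: "\<And>z. s z = 0 \<Longrightarrow> f z = 0 \<and> deriv s z \<noteq> 0"
  obtains q where "q holomorphic_on UNIV" "\<And>z. f z = s z * q z"
proof -
  \<comment> \<open>At the zeros of \<open>s\<close> the value is the one given by l'Hopital's
    rule.\<close>
  define q where "q = (\<lambda>z. if s z = 0 then deriv f z / deriv s z else f z / s z)"
  have "q holomorphic_on UNIV"
  proof (rule holomorphic_UNIV_if_local)
    fix c
    show "\<exists>e>0. q holomorphic_on ball c e"
    proof (cases "s c = 0")
      case False
      have "isCont s c" by (rule continuous_on_interior[OF holomorphic_on_imp_continuous_on[OF s]]) simp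
      then obtain e where e: "e > 0" "\<And>z. dist c z < e \<Longrightarrow> s z \<noteq> 0"
        using continuous_at_avoid[of c s 0] False by blast
      have "(\<lambda>z. f z / s z) holomorphic_on ball c e"
        using f s e by (intro holomorphic_intros) (auto intro: holomorphic_on_subset)
      hence "q holomorphic_on ball c e"
        by (rule holomorphic_transform) (use e in \<open>simp add: q_def\<close>)
      thus ?thesis using e(1) by blast
    next
      case True
      define F where "F = (\<lambda>z. if z = c then deriv f c else (f z - f c) / (z - c))"
      define S where "S = (\<lambda>z. if z = c then deriv s c else (s z - s c) / (z - c))"
      have FS: "F holomorphic_on UNIV" "S holomorphic_on UNIV"
        unfolding F_def S_def using f s by (auto intro!: pole_lemma_open)
      have "isCont S c" by (rule continuous_on_interior[OF holomorphic_on_imp_continuous_on[OF FS(2)]]) simp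
      moreover have "S c \<noteq> 0" using z[OF True] by (simp add: S_def)
      ultimately obtain e where e: "e > 0" "\<And>z. dist c z < e \<Longrightarrow> S z \<noteq> 0"
        using continuous_at_avoid[of c S 0] by blast
      have "(\<lambda>z. F z / S z) holomorphic_on ball c e"
        using FS e by (intro holomorphic_intros) (auto intro: holomorphic_on_subset)
      hence "q holomorphic_on ball c e"
      proof (rule holomorphic_transform)
        fix x assume "x \<in> ball c e"
        hence "S x \<noteq> 0" using e by simp
        thus "F x / S x = q x"
          using True z[OF True] by (cases "x = c") (auto simp: F_def S_def q_def)
      qed
      thus ?thesis using e(1) by blast
    qed
  qed
  moreover have "f x = s x * q x" for x using z[of x] by (simp add: q_def)
  ultimately show ?thesis using that by blast
qed

context weierstrass_lattice
begin

text \<open>The values of \<open>g\<close> may be of any type: it is applied to moduli and also to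
  the truth value of \<open>f z = 0\<close>.\<close>

lemma periodic_lattice:
  assumes "\<And>z. g (z + 1) = g z" "\<And>z. g (z + \<tau>) = g z" and \<omega>: "\<omega> \<in> \<Lambda>"
  shows "g (z + \<omega>) = g z"
proof -
  obtain a b where ab: "\<omega> = of_int a + of_int b * \<tau>" using \<omega> by (auto simp: lattice_def)
  have "g (z + of_int a * 1 + of_int b * \<tau>) = g z"
    using periodic_of_int[of g \<tau> "z + of_int a * 1" b] periodic_of_int[of g 1 z a] assms by simp
  thus ?thesis by (simp add: ab add.assoc)
qed

lemma lattice_representative:
  obtains \<omega> s t where "\<omega> \<in> \<Lambda>" "s \<in> {0..1}" "t \<in> {0..1}" "z = of_real s + of_real t * \<tau> + \<omega>"
proof -
  define t where "t = Im z / Im \<tau>"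
  define s where "s = Re z - t * Re \<tau>"
  have "z = of_real s + of_real t * \<tau>"
    using Im_pos by (auto simp: complex_eq_iff s_def t_def)
  also have "\<dots> = of_real (frac s) + of_real (frac t) * \<tau> + (of_int \<lfloor>s\<rfloor> + of_int \<lfloor>t\<rfloor> * \<tau>)"
    by (simp add: frac_def algebra_simps)
  finally have "z = of_real (frac s) + of_real (frac t) * \<tau> + (of_int \<lfloor>s\<rfloor> + of_int \<lfloor>t\<rfloor> * \<tau>)" .
  moreover have "frac s \<in> {0..1}" "frac t \<in> {0..1}"
    by (auto simp: frac_ge_0 less_imp_le[OF frac_lt_1])
  moreover have "of_int \<lfloor>s\<rfloor> + of_int \<lfloor>t\<rfloor> * \<tau> \<in> \<Lambda>" unfolding lattice_def by blast
  ultimately show ?thesis using that by blast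
qed

text \<open>Multiply by an exponential to make the modulus doubly periodic, and apply Liouville's theorem.\<close>

lemma constant_multipliers_imp_exp:
  assumes f: "f holomorphic_on UNIV" and c: "c1 \<noteq> 0" "c2 \<noteq> 0"
    and f1: "\<And>z. f (z + 1) = c1 * f z" and f2: "\<And>z. f (z + \<tau>) = c2 * f z"
  obtains C h where "\<And>z. f z = C * exp (h * z)"
proof -
  \<comment> \<open>\<open>k = x + i y\<close> is determined by Re k = ln |c1| and Re (k tau) = ln
    |c2|, which is solvable because Im tau is nonzero. Then exp (- k z) cancels the moduli of both
    multipliers.\<close>
  define x where "x = ln (norm c1)"
  define y where "y = (x * Re \<tau> - ln (norm c2)) / Im \<tau>"
  define k where "k = Complex x y"
  define F where "F = (\<lambda>z. f z * exp (- k * z))"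
  have k: "Re k = ln (norm c1)" "Re (k * \<tau>) = ln (norm c2)"
    using Im_pos by (simp_all add: k_def x_def y_def)
  have F1: "norm (F (z + 1)) = norm (F z)" for z
  proof -
    have "exp (- k * (z + 1)) = exp (- k * z) * exp (- k)" by (simp add: exp_add[symmetric] algebra_simps)
    moreover have "norm (exp (- k)) = exp (- Re k)" by simp
    hence "norm (exp (- k)) = 1 / norm c1"
      unfolding k(1) using c(1) by (simp add: exp_minus field_simps)
    ultimately show ?thesis using c(1) by (simp add: F_def f1 norm_mult)
  qed
  have F2: "norm (F (z + \<tau>)) = norm (F z)" for z
  proof -
    have "exp (- k * (z + \<tau>)) = exp (- k * z) * exp (- (k * \<tau>))" by (simp add: exp_add[symmetric] algebra_simps)
    moreover have "norm (exp (- (k * \<tau>))) = exp (- Re (k * \<tau>))" by simp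
    hence "norm (exp (- (k * \<tau>))) = 1 / norm c2"
      unfolding k(2) using c(2) by (simp add: exp_minus field_simps)
    ultimately show ?thesis using c(2) by (simp add: F_def f2 norm_mult)
  qed
  define D where "D = (\<lambda>(s, t). of_real s + of_real t * \<tau>) ` ({0..1::real} \<times> {0..1::real})"
  have Fh: "F holomorphic_on UNIV" unfolding F_def using f by (intro holomorphic_intros)
  have "compact D" unfolding D_def split_def
    by (intro compact_continuous_image continuous_intros compact_Times) auto
  hence "bounded (F ` D)"
    using Fh by (intro compact_imp_bounded compact_continuous_image)
      (auto intro: holomorphic_on_imp_continuous_on holomorphic_on_subset)
  then obtain B where B: "\<And>z. z \<in> D \<Longrightarrow> norm (F z) \<le> B" by (auto simp: bounded_iff)
  have "norm (F z) \<le> B" for z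
  proof -
    obtain \<omega> s t where w: "\<omega> \<in> \<Lambda>" "s \<in> {0..1}" "t \<in> {0..1}" "z = of_real s + of_real t * \<tau> + \<omega>"
      by (rule lattice_representative)
    have "norm (F z) = norm (F (of_real s + of_real t * \<tau>))"
      unfolding w(4) by (rule periodic_lattice[of "\<lambda>z. norm (F z)", OF F1 F2 w(1)])
    also have "\<dots> \<le> B" using w by (intro B) (auto simp: D_def)
    finally show ?thesis .
  qed
  hence "F constant_on UNIV" by (intro Liouville_theorem[OF Fh]) (auto simp: bounded_iff)
  then obtain C where C: "\<And>z. F z = C" by (auto simp: constant_on_def)
  have "f z = C * exp (k * z)" for z
    using C[of z] by (auto simp: F_def exp_minus field_simps)
  thus ?thesis using that by blast
qed

section \<open>Factorization of theta functions\<close>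

lemma exists_nonlattice: "\<exists>z. z \<notin> \<Lambda>"
  using countable_lattice uncountable_UNIV_complex by (metis UNIV_eq_I)

lemma open_translate_Compl_lattice: "open {z. z - b \<notin> \<Lambda>}"
proof -
  have "{z. z - b \<notin> \<Lambda>} = (\<lambda>z. z - b) -` (- \<Lambda>)" by auto
  thus ?thesis by (simp only:) (intro open_vimage open_Compl_lattice continuous_intros)
qed

text \<open>Division by \<open>sigma (z - b)\<close> lowers the degree by one; the shift b only
  changes the constant, by \<open>exp (eta omega * b)\<close>. The relation is computed off the
  zeros of the divisor and then continued analytically.\<close>

lemma multiplicative_div_wsigma:
  assumes f: "\<And>z. f (z + \<omega>) = \<mu> * exp (of_nat (Suc M) * eta \<omega> * z) * f z" and \<omega>: "\<omega> \<in> \<Lambda>"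
    and q: "q holomorphic_on UNIV" "\<And>z. f z = \<sigma> (z - b) * q z"
  obtains \<mu>' where "\<And>z. q (z + \<omega>) = \<mu>' * exp (of_nat M * eta \<omega> * z) * q z"
proof -
  obtain K where K: "K \<noteq> 0" "\<And>z. \<sigma> (z + \<omega>) = K * exp (eta \<omega> * z) * \<sigma> z"
    using wsigma_translate[OF \<omega>] by blast
  define \<mu>' where "\<mu>' = \<mu> / K * exp (eta \<omega> * b)"
  have off: "q (z + \<omega>) = \<mu>' * exp (of_nat M * eta \<omega> * z) * q z" if z: "z \<in> {z. z - b \<notin> \<Lambda>}" for z
  proof -
    have nz: "\<sigma> (z - b) \<noteq> 0" using z by (simp add: wsigma_eq_0_iff)
    have "\<sigma> (z + \<omega> - b) = K * exp (eta \<omega> * (z - b)) * \<sigma> (z - b)"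
      using K(2)[of "z - b"] by (simp add: algebra_simps)
    hence "K * exp (eta \<omega> * (z - b)) * \<sigma> (z - b) * q (z + \<omega>) =
           \<mu> * exp (of_nat (Suc M) * eta \<omega> * z) * (\<sigma> (z - b) * q z)"
      using f[of z] q(2)[of z] q(2)[of "z + \<omega>"] by simp
    hence "(K * exp (eta \<omega> * (z - b)) * q (z + \<omega>)) * \<sigma> (z - b) =
        (\<mu> * exp (of_nat (Suc M) * eta \<omega> * z) * q z) * \<sigma> (z - b)"
      by (simp only: mult_ac)
    hence "K * exp (eta \<omega> * (z - b)) * q (z + \<omega>) = \<mu> * exp (of_nat (Suc M) * eta \<omega> * z) * q z"
      using nz by (simp only: mult_cancel_right simp_thms)
    moreover have "exp (of_nat (Suc M) * eta \<omega> * z) =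
        exp (eta \<omega> * (z - b)) * (exp (eta \<omega> * b) * exp (of_nat M * eta \<omega> * z))"
      by (simp add: exp_add[symmetric] algebra_simps)
    ultimately show ?thesis using K(1) by (simp add: \<mu>'_def field_simps)
  qed
  obtain z0 where "z0 \<notin> \<Lambda>" using exists_nonlattice by blast
  hence "z0 + b \<in> {z. z - b \<notin> \<Lambda>}" by simp
  hence ne: "{z. z - b \<notin> \<Lambda>} \<noteq> {}" by blast
  have qt: "(\<lambda>z. q (z + \<omega>)) holomorphic_on UNIV"
  proof -
    have "(\<lambda>z. z + \<omega>) holomorphic_on UNIV" by (intro holomorphic_intros)
    from holomorphic_on_compose[OF this holomorphic_on_subset[OF q(1) subset_UNIV]]
    show ?thesis by (simp add: o_def)
  qed
  have "q (z + \<omega>) = \<mu>' * exp (of_nat M * eta \<omega> * z) * q z" for z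
    by (rule analytic_continuation_open[OF open_translate_Compl_lattice open_UNIV ne connected_UNIV subset_UNIV qt _ off])
       (use q(1) in \<open>auto intro!: holomorphic_intros\<close>)
  thus ?thesis using that by blast
qed

text \<open>The reference function of the same degree is sigma^(M+1). If f had no zero, the quotient
  of sigma^(M+1) by f would be entire with constant multipliers, hence C exp (h z). Vanishing at 0
  forces C = 0, whereas the quotient is nonzero off the lattice.\<close>

lemma theta_has_zero:
  assumes f: "f holomorphic_on UNIV"
    and f1: "\<And>z. f (z + 1) = \<mu>1 * exp (of_nat (Suc M) * eta 1 * z) * f z"
    and f2: "\<And>z. f (z + \<tau>) = \<mu>2 * exp (of_nat (Suc M) * eta \<tau> * z) * f z"
  shows "\<exists>a. f a = 0"
proof (rule ccontr)
  assume "\<not> ?thesis"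
  hence nz: "f z \<noteq> 0" for z by blast
  have \<mu>: "\<mu>1 \<noteq> 0" "\<mu>2 \<noteq> 0" using f1[of 0] f2[of 0] nz by auto
  let ?g = "\<lambda>z. \<sigma> z ^ Suc M / f z"
  have g: "?g holomorphic_on UNIV" using nz by (intro holomorphic_intros f holomorphic_wsigma) auto
  have mult: "\<exists>c. c \<noteq> 0 \<and> (\<forall>z. ?g (z + \<omega>) = c * ?g z)"
    if \<omega>: "\<omega> \<in> \<Lambda>" and \<mu>: "\<mu> \<noteq> 0"
      and fw: "\<And>z. f (z + \<omega>) = \<mu> * exp (of_nat (Suc M) * eta \<omega> * z) * f z" for \<omega> \<mu>
  proof -
    obtain K where K: "K \<noteq> 0" "\<And>z. \<sigma> (z + \<omega>) = K * exp (eta \<omega> * z) * \<sigma> z"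
      using wsigma_translate[OF \<omega>] by blast
    have "?g (z + \<omega>) = (K ^ Suc M / \<mu>) * ?g z" for z
    proof -
      have "exp (eta \<omega> * z) ^ Suc M = exp (of_nat (Suc M) * eta \<omega> * z)"
        by (simp only: exp_of_nat_mult[symmetric] mult.assoc)
      hence "\<sigma> (z + \<omega>) ^ Suc M = K ^ Suc M * exp (of_nat (Suc M) * eta \<omega> * z) * \<sigma> z ^ Suc M"
        by (simp only: K(2) power_mult_distrib)
      thus ?thesis unfolding fw using \<mu> nz[of z] by (simp only:) (simp add: divide_simps)
    qed
    thus ?thesis using K(1) \<mu> by (intro exI[of _ "K ^ Suc M / \<mu>"]) auto
  qed
  obtain c1 c2 where c: "c1 \<noteq> 0" "\<And>z. ?g (z + 1) = c1 * ?g z" "c2 \<noteq> 0" "\<And>z. ?g (z + \<tau>) = c2 * ?g z"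
    using mult[OF one_in_lattice \<mu>(1) f1] mult[OF tau_in_lattice \<mu>(2) f2] by blast
  obtain C h where Ch: "\<And>z. ?g z = C * exp (h * z)"
    using constant_multipliers_imp_exp[OF g c(1,3,2,4)] by blast
  have "C = 0" using Ch[of 0] zero_in_lattice wsigma_eq_0_iff[of 0] by simp
  moreover obtain z where "z \<notin> \<Lambda>" using exists_nonlattice by blast
  ultimately show False using Ch[of z] nz[of z] by (simp add: wsigma_eq_0_iff)
qed

text \<open>Zeros congruent to some \<open>p i\<close> are moved to \<open>p i\<close> itself.\<close>

lemma theta_factorization:
  fixes p :: "'i \<Rightarrow> complex"
  assumes I: "finite I"
    and f: "f holomorphic_on UNIV" "\<exists>z. f z \<noteq> 0"
    and f1: "\<And>z. f (z + 1) = \<mu>1 * exp (of_nat M * eta 1 * z) * f z"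
    and f2: "\<And>z. f (z + \<tau>) = \<mu>2 * exp (of_nat M * eta \<tau> * z) * f z"
  shows "\<exists>k a K C h. C \<noteq> 0 \<and> (\<Sum>i\<in>I. k i) + K = M \<and>
     (\<forall>\<mu>\<in>{1..K::nat}. \<forall>i\<in>I. \<not> same_class \<tau> (a \<mu>) (p i)) \<and>
     (\<forall>z. f z = C * exp (h * z) * (\<Prod>\<mu>=1..K. \<sigma> (z - a \<mu>)) * (\<Prod>i\<in>I. \<sigma> (z - p i) ^ k i))"
  using f f1 f2
proof (induction M arbitrary: f \<mu>1 \<mu>2)
  case 0
  obtain z where z: "f z \<noteq> 0" using "0.prems"(2) by blast
  have m: "f (z + 1) = \<mu>1 * f z" "f (z + \<tau>) = \<mu>2 * f z" for z
    using "0.prems"(3,4)[of z] by simp_all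
  \<comment> \<open>Stepping back by a period from a point with \<open>f z\<close> nonzero shows
    that the multipliers are nonzero.\<close>
  have "f (z - 1 + 1) = \<mu>1 * f (z - 1)" "f (z - \<tau> + \<tau>) = \<mu>2 * f (z - \<tau>)" by (rule m)+
  hence "\<mu>1 \<noteq> 0" "\<mu>2 \<noteq> 0" using z by auto
  then obtain C h where Ch: "\<And>z. f z = C * exp (h * z)"
    using constant_multipliers_imp_exp[OF "0.prems"(1) _ _ m] by blast
  hence "C \<noteq> 0" using z by auto
  thus ?case using Ch
    by (intro exI[of _ "\<lambda>_. 0"] exI[of _ "\<lambda>_. 0"] exI[of _ 0] exI[of _ C] exI[of _ h]) simp
next
  case (Suc M)
  note f = Suc.prems(1) and f1 = Suc.prems(3) and f2 = Suc.prems(4)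
  obtain z0 where z0: "f z0 \<noteq> 0" using Suc.prems(2) by blast
  obtain a0 where a0: "f a0 = 0" using theta_has_zero[OF f f1 f2] by blast
  have "\<mu>1 \<noteq> 0" using f1[of "z0 - 1"] z0 by auto
  moreover have "\<mu>2 \<noteq> 0" using f2[of "z0 - \<tau>"] z0 by auto
  ultimately have "(f (z + 1) = 0) = (f z = 0)" "(f (z + \<tau>) = 0) = (f z = 0)" for z
    using f1[of z] f2[of z] by auto
  \<comment> \<open>The zero set is invariant under the lattice. Therefore one zero at
    \<open>b\<close> makes all of \<open>b + \<Lambda>\<close> zeros, as division by
    \<open>sigma (z - b)\<close> requires, and a zero may be replaced by any congruent
    point.\<close>
  hence zero_iff: "(f (z + \<omega>) = 0) = (f z = 0)" if "\<omega> \<in> \<Lambda>" for z \<omega>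
    using periodic_lattice[of "\<lambda>z. f z = 0", OF _ _ that] by blast
  have step: "\<exists>q \<nu>1 \<nu>2. q holomorphic_on UNIV \<and> (\<exists>z. q z \<noteq> 0) \<and> (\<forall>z. f z = \<sigma> (z - b) * q z) \<and>
      (\<forall>z. q (z + 1) = \<nu>1 * exp (of_nat M * eta 1 * z) * q z) \<and>
      (\<forall>z. q (z + \<tau>) = \<nu>2 * exp (of_nat M * eta \<tau> * z) * q z)" if b: "f b = 0" for b
  proof -
    have s: "(\<lambda>z. \<sigma> (z - b)) holomorphic_on UNIV" by (intro holomorphic_intros)
    have ds: "((\<lambda>z. \<sigma> (z - b)) has_field_derivative deriv (\<sigma>) (z - b)) (at z)" for z
      using has_field_derivative_translate[where z = z and c = "- b", OF wsigma_has_deriv] by simp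
    obtain q where q: "q holomorphic_on UNIV" "\<And>z. f z = \<sigma> (z - b) * q z"
    proof (rule entire_quotient_simple_zeros[OF f s])
      fix z assume "\<sigma> (z - b) = 0"
      hence "z - b \<in> \<Lambda>" by (simp add: wsigma_eq_0_iff)
      thus "f z = 0 \<and> deriv (\<lambda>z. \<sigma> (z - b)) z \<noteq> 0"
        using zero_iff[of "z - b" b] b by (simp add: DERIV_imp_deriv[OF ds] deriv_wsigma_nonzero)
    qed blast
    obtain \<nu>1 where "\<And>z. q (z + 1) = \<nu>1 * exp (of_nat M * eta 1 * z) * q z"
      using multiplicative_div_wsigma[OF f1 one_in_lattice q] by blast
    moreover obtain \<nu>2 where "\<And>z. q (z + \<tau>) = \<nu>2 * exp (of_nat M * eta \<tau> * z) * q z"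
      using multiplicative_div_wsigma[OF f2 tau_in_lattice q] by blast
    moreover have "q z0 \<noteq> 0" using q(2)[of z0] z0 by auto
    ultimately show ?thesis using q by blast
  qed
  show ?case
  proof (cases "\<exists>i\<in>I. same_class \<tau> a0 (p i)")
    case True
    then obtain i where i: "i \<in> I" "a0 - p i \<in> \<Lambda>" by (auto simp: same_class_def)
    have "f (p i) = 0" using zero_iff[OF i(2), of "p i"] a0 by simp
    from step[OF this] obtain q \<nu>1 \<nu>2 where q: "q holomorphic_on UNIV" "\<exists>z. q z \<noteq> 0"
      "\<And>z. f z = \<sigma> (z - p i) * q z"
      "\<And>z. q (z + 1) = \<nu>1 * exp (of_nat M * eta 1 * z) * q z"
      "\<And>z. q (z + \<tau>) = \<nu>2 * exp (of_nat M * eta \<tau> * z) * q z" by blast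
    obtain k a K C h where IH: "C \<noteq> 0" "(\<Sum>i\<in>I. k i) + K = M"
      "\<forall>\<mu>\<in>{1..K}. \<forall>i\<in>I. \<not> same_class \<tau> (a \<mu>) (p i)"
      "\<And>z. q z = C * exp (h * z) * (\<Prod>\<mu>=1..K. \<sigma> (z - a \<mu>)) * (\<Prod>i\<in>I. \<sigma> (z - p i) ^ k i)"
      using Suc.IH[OF q(1,2,4,5)] by blast
    let ?k = "k(i := Suc (k i))"
    have "(\<Sum>j\<in>I. ?k j) = Suc (\<Sum>j\<in>I. k j)"
      using I i(1) by (simp add: sum.remove[of I i] sum.remove[of I i k])
    moreover have "(\<Prod>j\<in>I. \<sigma> (z - p j) ^ ?k j) = \<sigma> (z - p i) * (\<Prod>j\<in>I. \<sigma> (z - p j) ^ k j)" for z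
      using I i(1) by (simp add: prod.remove[of I i] mult.assoc)
    ultimately show ?thesis using IH q(3)
      by (intro exI[of _ ?k] exI[of _ a] exI[of _ K] exI[of _ C] exI[of _ h]) (simp add: mult_ac)
  next
    case False
    from step[OF a0] obtain q \<nu>1 \<nu>2 where q: "q holomorphic_on UNIV" "\<exists>z. q z \<noteq> 0"
      "\<And>z. f z = \<sigma> (z - a0) * q z"
      "\<And>z. q (z + 1) = \<nu>1 * exp (of_nat M * eta 1 * z) * q z"
      "\<And>z. q (z + \<tau>) = \<nu>2 * exp (of_nat M * eta \<tau> * z) * q z" by blast
    obtain k a K C h where IH: "C \<noteq> 0" "(\<Sum>i\<in>I. k i) + K = M"
      "\<forall>\<mu>\<in>{1..K}. \<forall>i\<in>I. \<not> same_class \<tau> (a \<mu>) (p i)"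
      "\<And>z. q z = C * exp (h * z) * (\<Prod>\<mu>=1..K. \<sigma> (z - a \<mu>)) * (\<Prod>i\<in>I. \<sigma> (z - p i) ^ k i)"
      using Suc.IH[OF q(1,2,4,5)] by blast
    let ?a = "a(Suc K := a0)"
    have "(\<Prod>\<mu>=1..Suc K. \<sigma> (z - ?a \<mu>)) = (\<Prod>\<mu>=1..K. \<sigma> (z - a \<mu>)) * \<sigma> (z - a0)" for z
    proof -
      have "(\<Prod>\<mu>=1..K. \<sigma> (z - ?a \<mu>)) = (\<Prod>\<mu>=1..K. \<sigma> (z - a \<mu>))"
        by (intro prod.cong) auto
      thus ?thesis by simp
    qed
    moreover have "\<forall>\<mu>\<in>{1..Suc K}. \<forall>i\<in>I. \<not> same_class \<tau> (?a \<mu>) (p i)"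
      using IH(3) False by (auto simp: le_Suc_eq)
    ultimately show ?thesis using IH(1,2,4) q(3)
      by (intro exI[of _ k] exI[of _ ?a] exI[of _ "Suc K"] exI[of _ C] exI[of _ h]) (simp add: mult_ac)
  qed
qed

end

section \<open>The generalized Lame equation\<close>

text \<open>Log-freeness is given at the points \<open>p i\<close>, while the set of poles contains
  all their lattice translates. \<open>Q\<close> is compared only on a slit disc around
  \<open>c\<close>, since the pole itself has to be avoided.\<close>

lemma log_free_at_translate:
  assumes lf: "log_free_at Q c" and e0: "e0 > 0"
    and Q: "\<And>z. z \<in> slit_disc c e0 \<Longrightarrow> Q (z + \<omega>) = Q z"
  shows "log_free_at Q (c + \<omega>)"
  unfolding log_free_at_def
proof (intro allI impI)
  fix \<epsilon> :: real and w assume \<epsilon>: "\<epsilon> > 0" and w: "solves_on (slit_disc (c + \<omega>) \<epsilon>) Q w"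
  define e where "e = min \<epsilon> e0"
  have e: "e > 0" "e \<le> \<epsilon>" "e \<le> e0" using \<epsilon> e0 by (auto simp: e_def)
  have sh: "z + \<omega> \<in> slit_disc (c + \<omega>) \<delta> \<longleftrightarrow> z \<in> slit_disc c \<delta>" for z \<delta>
    by (simp add: slit_disc_def dist_norm)
  have "solves_on (slit_disc c e) Q (\<lambda>z. w (z + \<omega>))"
  proof (rule solves_onI[OF open_slit_disc])
    fix z assume z: "z \<in> slit_disc c e"
    have z': "z + \<omega> \<in> slit_disc (c + \<omega>) \<epsilon>" "z \<in> slit_disc c e0"
      using z sh slit_disc_mono[OF e(2), of c] slit_disc_mono[OF e(3), of c] by auto
    note d = solves_onD[OF w open_slit_disc z'(1)]
    show "((\<lambda>z. w (z + \<omega>)) has_field_derivative deriv w (z + \<omega>)) (at z)"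
      by (rule has_field_derivative_translate[OF d(1)])
    show "((\<lambda>z. deriv w (z + \<omega>)) has_field_derivative Q z * w (z + \<omega>)) (at z)"
      using has_field_derivative_translate[OF d(2)] Q[OF z'(2)] by simp
  qed
  with lf e(1) obtain \<rho>1 \<rho>2 f1 f2 \<delta> where f: "f1 analytic_on {c}" "f2 analytic_on {c}"
    and \<delta>: "\<delta> > 0" "\<delta> \<le> e"
    and eq: "\<And>z. z \<in> slit_disc c \<delta> \<Longrightarrow> w (z + \<omega>) = (z - c) powr \<rho>1 * f1 z + (z - c) powr \<rho>2 * f2 z"
    unfolding log_free_at_def by meson
  have an: "(\<lambda>z. f (z - \<omega>)) analytic_on {c + \<omega>}" if "f analytic_on {c}" for f
  proof -
    have "(f \<circ> (\<lambda>z. z - \<omega>)) analytic_on {c + \<omega>}"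
      by (rule analytic_on_compose) (use that in \<open>auto intro!: analytic_intros\<close>)
    thus ?thesis by (simp add: o_def)
  qed
  show "\<exists>\<rho>1 \<rho>2 f1 f2. f1 analytic_on {c + \<omega>} \<and> f2 analytic_on {c + \<omega>} \<and>
     (\<exists>\<delta>>0. \<delta> \<le> \<epsilon> \<and> (\<forall>z\<in>slit_disc (c + \<omega>) \<delta>.
        w z = (z - (c + \<omega>)) powr \<rho>1 * f1 z + (z - (c + \<omega>)) powr \<rho>2 * f2 z))"
  proof (intro exI conjI ballI)
    show "(\<lambda>z. f1 (z - \<omega>)) analytic_on {c + \<omega>}" "(\<lambda>z. f2 (z - \<omega>)) analytic_on {c + \<omega>}"
      by (intro an f)+
    show "\<delta> > 0" "\<delta> \<le> \<epsilon>" using \<delta> e by auto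
    fix z assume "z \<in> slit_disc (c + \<omega>) \<delta>"
    hence "z - \<omega> \<in> slit_disc c \<delta>" using sh[of "z - \<omega>" \<delta>] by simp
    from eq[OF this] show "w z = (z - (c + \<omega>)) powr \<rho>1 * f1 (z - \<omega>) + (z - (c + \<omega>)) powr \<rho>2 * f2 (z - \<omega>)"
      by (simp add: algebra_simps)
  qed
qed

locale lame_equation = weierstrass_lattice \<tau> for \<tau> :: complex +
  fixes r N :: nat and n :: "nat \<Rightarrow> real" and p A :: "nat \<Rightarrow> complex" and B :: complex
  assumes half_integral: "\<And>i. i \<in> {1..r} \<Longrightarrow> \<exists>k::nat. k \<ge> 1 \<and> n i = real k / 2"
    and total: "(\<Sum>i=1..r. n i) = real N"
    and distinct: "\<And>i j. i \<in> {1..r} \<Longrightarrow> j \<in> {1..r} \<Longrightarrow> i \<noteq> j \<Longrightarrow> \<not> same_class \<tau> (p i) (p j)"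
    and sum_A: "(\<Sum>i=1..r. A i) = 0"
    and log_free_p: "\<And>i. i \<in> {1..r} \<Longrightarrow> log_free_at (lame_potential \<tau> r n p A B) (p i)"
begin

definition P :: "complex set" where
  "P = {z. \<exists>i\<in>{1..r}. z - p i \<in> \<Lambda>}"

definition G :: "complex \<Rightarrow> complex" where
  "G z = (\<Sum>i=1..r. of_real (n i) * \<zeta> (z - p i))"

abbreviation Q :: "complex \<Rightarrow> complex" where
  "Q \<equiv> lame_potential \<tau> r n p A B"

section \<open>Periodicity and polar parts of the coefficients\<close>

lemma not_in_P: "z \<notin> P \<Longrightarrow> i \<in> {1..r} \<Longrightarrow> z - p i \<notin> \<Lambda>"
  by (auto simp: P_def)

lemma countable_P: "countable P"
proof -
  have "P = (\<Union>i\<in>{1..r}. (\<lambda>\<omega>. \<omega> + p i) ` \<Lambda>)"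
    by (force simp: P_def image_iff)
  thus ?thesis using countable_lattice by auto
qed

lemma P_translate:
  assumes "\<omega> \<in> \<Lambda>"
  shows "z + \<omega> \<in> P \<longleftrightarrow> z \<in> P"
proof -
  have "z + \<omega> - p i \<in> \<Lambda> \<longleftrightarrow> z - p i \<in> \<Lambda>" for i
    using lattice_add_iff[OF assms, of "z - p i"] by (simp add: algebra_simps)
  thus ?thesis by (simp add: P_def)
qed

lemma isolated_P: "\<exists>\<delta>>0. \<forall>z\<in>P. z \<noteq> c \<longrightarrow> \<delta> \<le> dist c z"
proof -
  have "\<exists>\<delta>>0. \<forall>\<omega>\<in>\<Lambda>. \<omega> \<noteq> c - p i \<longrightarrow> \<delta> \<le> dist (c - p i) \<omega>" for i
    by (rule lattice_isolated)
  then obtain d where d: "\<And>i. d i > 0" "\<And>i \<omega>. \<omega> \<in> \<Lambda> \<Longrightarrow> \<omega> \<noteq> c - p i \<Longrightarrow> d i \<le> dist (c - p i) \<omega>"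
    by metis
  \<comment> \<open>The element 1 keeps the set nonempty when r = 0.\<close>
  define \<delta> where "\<delta> = Min (insert 1 (d ` {1..r}))"
  have "\<delta> > 0" unfolding \<delta>_def using d(1) by (subst Min_gr_iff) auto
  moreover have "\<delta> \<le> dist c z" if z: "z \<in> P" "z \<noteq> c" for z
  proof -
    obtain i where i: "i \<in> {1..r}" "z - p i \<in> \<Lambda>" using z(1) by (auto simp: P_def)
    have "\<delta> \<le> d i" unfolding \<delta>_def using i(1) by (intro Min_le) auto
    also have "\<dots> \<le> dist (c - p i) (z - p i)" using z(2) by (intro d(2) i(2)) auto
    also have "\<dots> = dist c z" by (simp add: dist_norm)
    finally show ?thesis .
  qed
  ultimately show ?thesis by blast
qed

lemma holomorphic_shift:
  assumes f: "f holomorphic_on - \<Lambda>" and "\<And>z. z \<in> S \<Longrightarrow> z - b \<notin> \<Lambda>"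
  shows "(\<lambda>z. f (z - b)) holomorphic_on S"
proof -
  have "(f \<circ> (\<lambda>z. z - b)) holomorphic_on S"
    by (rule holomorphic_on_compose[OF _ holomorphic_on_subset[OF f]]) (use assms(2) in \<open>auto intro!: holomorphic_intros\<close>)
  thus ?thesis by (simp add: o_def)
qed

lemma holomorphic_G: "G holomorphic_on - P"
  unfolding G_def using not_in_P
  by (intro holomorphic_intros holomorphic_shift[OF holomorphic_wzeta]) auto

lemma holomorphic_Q: "Q holomorphic_on - P"
  unfolding lame_potential_def using not_in_P
  by (intro holomorphic_intros holomorphic_shift[OF holomorphic_wzeta] holomorphic_shift[OF holomorphic_wp]) auto

lemma G_translate:
  assumes \<omega>: "\<omega> \<in> \<Lambda>" and z: "z \<notin> P"
  shows "G (z + \<omega>) = G z + of_nat N * eta \<omega>"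
proof -
  have "\<zeta> (z + \<omega> - p i) = \<zeta> (z - p i) + eta \<omega>" if "i \<in> {1..r}" for i
    using wzeta_translate[OF \<omega> not_in_P[OF z that]] by (simp add: algebra_simps)
  hence "G (z + \<omega>) = (\<Sum>i=1..r. of_real (n i) * \<zeta> (z - p i) + of_real (n i) * eta \<omega>)"
    unfolding G_def by (intro sum.cong) (simp_all add: algebra_simps)
  also have "\<dots> = G z + of_real (\<Sum>i=1..r. n i) * eta \<omega>"
    by (simp add: G_def sum.distrib sum_distrib_right)
  finally show ?thesis by (simp only: total of_real_of_nat_eq)
qed

text \<open>The zeta terms shift by \<open>A i\<close> times the same quasi-period, and these shifts
  cancel because the \<open>A i\<close> add up to 0.\<close>

lemma Q_translate:
  assumes \<omega>: "\<omega> \<in> \<Lambda>" and z: "z \<notin> P"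
  shows "Q (z + \<omega>) = Q z"
proof -
  have sh: "z + \<omega> - p i = (z - p i) + \<omega>" for i by simp
  have "(\<Sum>i=1..r. A i * \<zeta> (z + \<omega> - p i)) = (\<Sum>i=1..r. A i * \<zeta> (z - p i) + A i * eta \<omega>)"
    unfolding sh using wzeta_translate[OF \<omega> not_in_P[OF z]] by (intro sum.cong) (simp_all add: algebra_simps)
  also have "\<dots> = (\<Sum>i=1..r. A i * \<zeta> (z - p i)) + (\<Sum>i=1..r. A i) * eta \<omega>"
    by (simp add: sum.distrib sum_distrib_right)
  finally have 1: "(\<Sum>i=1..r. A i * \<zeta> (z + \<omega> - p i)) = (\<Sum>i=1..r. A i * \<zeta> (z - p i))"
    unfolding sum_A by simp
  have "(\<Sum>i=1..r. of_real (n i * (n i + 1)) * wp \<tau> (z + \<omega> - p i)) =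
        (\<Sum>i=1..r. of_real (n i * (n i + 1)) * wp \<tau> (z - p i))"
    unfolding sh using wp_periodic[OF \<omega> not_in_P[OF z]] by (intro sum.cong) simp_all
  thus ?thesis unfolding lame_potential_def 1 by simp
qed

text \<open>Only the summand of index i is singular at c, since the classes of the
  \<open>p j\<close> are distinct; the expansions at 0 are moved to c by periodicity. The simple
  pole of \<open>Q\<close> is absorbed in \<open>q\<close>, whose value at c is
  \<open>A i\<close>.\<close>

lemma polar_part:
  assumes i: "i \<in> {1..r}" and c: "c - p i \<in> \<Lambda>"
  obtains \<delta> g q where "\<delta> > 0" "(ball c \<delta> - {c}) \<inter> P = {}"
    "g holomorphic_on ball c \<delta>" "q holomorphic_on ball c \<delta>"
    "\<And>z. z \<in> ball c \<delta> - {c} \<Longrightarrow> G z = of_real (n i) / (z - c) + g z"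
    "\<And>z. z \<in> ball c \<delta> - {c} \<Longrightarrow> Q z = of_real (n i) * (of_real (n i) + 1) / (z - c) ^ 2 + q z / (z - c)"
proof -
  obtain R t where R: "R > 0" and t: "t holomorphic_on ball 0 R"
    and nl: "\<And>z. z \<in> ball 0 R \<Longrightarrow> z \<noteq> 0 \<Longrightarrow> z \<notin> \<Lambda>"
    and ze: "\<And>z. z \<in> ball 0 R \<Longrightarrow> z \<noteq> 0 \<Longrightarrow> \<zeta> z = 1 / z + deriv t z"
    and pe: "\<And>z. z \<in> ball 0 R \<Longrightarrow> z \<noteq> 0 \<Longrightarrow> wp \<tau> z = 1 / z ^ 2 - deriv (deriv t) z"
    using expansion_at_0 by metis
  obtain d where d: "d > 0" "\<forall>z\<in>P. z \<noteq> c \<longrightarrow> d \<le> dist c z" using isolated_P by blast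
  define \<delta> where "\<delta> = min R d"
  have \<delta>: "\<delta> > 0" "\<delta> \<le> R" "\<delta> \<le> d" using R d by (auto simp: \<delta>_def)
  have disj: "(ball c \<delta> - {c}) \<inter> P = {}" using d(2) \<delta>(3) by force
  let ?I = "{1..r} - {i}"
  have other: "z - p j \<notin> \<Lambda>" if "j \<in> ?I" "z \<in> ball c \<delta>" for j z
  proof (cases "z = c")
    case True
    show ?thesis
    proof
      assume "z - p j \<in> \<Lambda>"
      hence "c - p j \<in> \<Lambda>" using True by simp
      hence "(c - p j) - (c - p i) \<in> \<Lambda>" by (rule lattice_diff[OF _ c])
      hence "same_class \<tau> (p i) (p j)" by (simp add: same_class_def)
      thus False using distinct[OF i, of j] that(1) by auto
    qed
  next
    case False
    hence "z \<notin> P" using disj that(2) by blast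
    thus ?thesis using that(1) by (intro not_in_P) auto
  qed
  define w where "w = c - p i"
  have w: "w \<in> \<Lambda>" using c by (simp add: w_def)
  have zi: "z - p i = (z - c) + w" for z by (simp add: w_def)
  have sh: "(\<lambda>z. f (z - c)) holomorphic_on ball c \<delta>" if "f holomorphic_on ball 0 R" for f :: "complex \<Rightarrow> complex"
  proof -
    have "(f \<circ> (\<lambda>z. z - c)) holomorphic_on ball c \<delta>"
      by (rule holomorphic_on_compose[OF _ holomorphic_on_subset[OF that]])
         (use \<delta>(2) in \<open>auto intro!: holomorphic_intros simp: dist_norm norm_minus_commute\<close>)
    thus ?thesis by (simp add: o_def)
  qed
  have t1: "(\<lambda>z. deriv t (z - c)) holomorphic_on ball c \<delta>"
    and t2: "(\<lambda>z. deriv (deriv t) (z - c)) holomorphic_on ball c \<delta>"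
    by (intro sh holomorphic_deriv t open_ball)+
  have zei: "\<zeta> (z - p i) = 1 / (z - c) + deriv t (z - c) + eta w"
    and pei: "wp \<tau> (z - p i) = 1 / (z - c) ^ 2 - deriv (deriv t) (z - c)" if z: "z \<in> ball c \<delta> - {c}" for z
  proof -
    have zc: "z - c \<in> ball 0 R" "z - c \<noteq> 0" using z \<delta>(2) by (auto simp: dist_norm norm_minus_commute)
    show "\<zeta> (z - p i) = 1 / (z - c) + deriv t (z - c) + eta w"
      unfolding zi wzeta_translate[OF w nl[OF zc]] ze[OF zc] by simp
    show "wp \<tau> (z - p i) = 1 / (z - c) ^ 2 - deriv (deriv t) (z - c)"
      unfolding zi wp_periodic[OF w nl[OF zc]] pe[OF zc] by simp
  qed
  define g where "g = (\<lambda>z. of_real (n i) * (deriv t (z - c) + eta w) + (\<Sum>j\<in>?I. of_real (n j) * \<zeta> (z - p j)))"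
  define b where "b = (\<lambda>z. - of_real (n i * (n i + 1)) * deriv (deriv t) (z - c) +
      (\<Sum>j\<in>?I. of_real (n j * (n j + 1)) * wp \<tau> (z - p j)) + A i * (deriv t (z - c) + eta w) +
      (\<Sum>j\<in>?I. A j * \<zeta> (z - p j)) + B)"
  define q where "q = (\<lambda>z. A i + (z - c) * b z)"
  have g: "g holomorphic_on ball c \<delta>" unfolding g_def
    by (intro holomorphic_intros t1 holomorphic_shift[OF holomorphic_wzeta] other)
  have b: "b holomorphic_on ball c \<delta>" unfolding b_def
    by (intro holomorphic_intros t1 t2 holomorphic_shift[OF holomorphic_wzeta] holomorphic_shift[OF holomorphic_wp] other)
  have q: "q holomorphic_on ball c \<delta>" unfolding q_def by (intro holomorphic_intros b)
  have rem: "(\<Sum>j=1..r. f j) = f i + (\<Sum>j\<in>?I. f j)" for f :: "nat \<Rightarrow> complex"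
    by (rule sum.remove) (use i in auto)
  have Gz: "G z = of_real (n i) / (z - c) + g z" if z: "z \<in> ball c \<delta> - {c}" for z
    unfolding G_def rem zei[OF z] g_def by (simp add: algebra_simps)
  have Qz: "Q z = of_real (n i) * (of_real (n i) + 1) / (z - c) ^ 2 + q z / (z - c)" if z: "z \<in> ball c \<delta> - {c}" for z
  proof -
    have "z - c \<noteq> 0" using z by auto
    hence "q z / (z - c) = A i / (z - c) + b z" by (simp add: q_def add_divide_distrib)
    thus ?thesis unfolding lame_potential_def rem zei[OF z] pei[OF z] b_def by (simp add: algebra_simps add_divide_distrib)
  qed
  show ?thesis by (rule that[OF \<delta>(1) disj g q Gz Qz])
qed

sublocale apparent_singularities P G Q
proof
  show "countable P" by (rule countable_P)
  show "\<exists>\<delta>>0. \<forall>p\<in>P. p \<noteq> c \<longrightarrow> \<delta> \<le> dist c p" for c by (rule isolated_P)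
  show "G holomorphic_on - P" "Q holomorphic_on - P" by (rule holomorphic_G holomorphic_Q)+
next
  fix c assume "c \<in> P"
  then obtain i where i: "i \<in> {1..r}" "c - p i \<in> \<Lambda>" by (auto simp: P_def)
  obtain k where k: "n i = real k / 2" using half_integral[OF i(1)] by blast
  have "2 * complex_of_real (n i) = of_real (2 * n i)" by simp
  also have "\<dots> = of_nat k" unfolding k by simp
  finally have "2 * complex_of_real (n i) = of_nat k" .
  thus "\<exists>\<nu> k \<delta> g q. 2 * \<nu> = of_nat k \<and> \<delta> > 0 \<and> g holomorphic_on ball c \<delta> \<and> q holomorphic_on ball c \<delta> \<and>
        (\<forall>z\<in>ball c \<delta> - {c}. G z = \<nu> / (z - c) + g z \<and> Q z = \<nu> * (\<nu> + 1) / (z - c) ^ 2 + q z / (z - c))"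
    using polar_part[OF i] by metis
  obtain d where d: "d > 0" "\<forall>z\<in>P. z \<noteq> p i \<longrightarrow> d \<le> dist (p i) z" using isolated_P by blast
  have "log_free_at Q (p i + (c - p i))"
  proof (rule log_free_at_translate[OF log_free_p[OF i(1)] d(1)])
    fix z assume "z \<in> slit_disc (p i) d"
    hence "z \<in> ball (p i) d - {p i}" using slit_disc_subset_ball by blast
    hence "z \<notin> P" using d(2) by force
    thus "Q (z + (c - p i)) = Q z" by (rule Q_translate[OF i(2)])
  qed
  thus "log_free_at Q c" by simp
qed

section \<open>Zeros of the multiplicative solution\<close>

lemma wsigma_factor_at_0:
  obtains R s where "R > 0" "s holomorphic_on ball 0 R" "\<And>z. z \<in> ball 0 R \<Longrightarrow> \<sigma> z = z * s z"
    "\<And>z. z \<in> ball 0 R \<Longrightarrow> s z \<noteq> 0"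
proof -
  obtain R t where R: "R > 0" "t holomorphic_on ball 0 R"
    "\<And>z. z \<in> ball 0 R \<Longrightarrow> \<sigma> z = z * exp (t z)"
    using expansion_at_0 by metis
  show ?thesis
    by (rule that[of R "\<lambda>z. exp (t z)"]) (use R in \<open>auto intro!: holomorphic_intros\<close>)
qed

text \<open>None of the other factors vanishes at \<open>p i\<close>, so the order of
  \<open>y\<close> there is exactly \<open>k i\<close> and \<open>ysol_order\<close>
  applies.\<close>

lemma exponent_at_p:
  assumes y: "ysol UNIV y" and C: "C \<noteq> 0"
    and a: "\<And>\<mu>. \<mu> \<in> {1..K::nat} \<Longrightarrow> \<not> same_class \<tau> (a \<mu>) (p i)"
    and eq: "\<And>z. y z = C * exp (h * z) * (\<Prod>\<mu>=1..K. \<sigma> (z - a \<mu>)) * (\<Prod>i=1..r. \<sigma> (z - p i) ^ k i)"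
    and i: "i \<in> {1..r}"
  shows "k i = 0 \<or> complex_of_nat (k i) = 2 * of_real (n i) + 1"
proof -
  let ?c = "p i"
  obtain \<delta>1 g q where \<delta>1: "\<delta>1 > 0" and disj: "(ball ?c \<delta>1 - {?c}) \<inter> P = {}"
    and gq: "g holomorphic_on ball ?c \<delta>1" "q holomorphic_on ball ?c \<delta>1"
    and Gz: "\<And>z. z \<in> ball ?c \<delta>1 - {?c} \<Longrightarrow> G z = of_real (n i) / (z - ?c) + g z"
    and Qz: "\<And>z. z \<in> ball ?c \<delta>1 - {?c} \<Longrightarrow> Q z = of_real (n i) * (of_real (n i) + 1) / (z - ?c) ^ 2 + q z / (z - ?c)"
    using polar_part[OF i, of ?c] zero_in_lattice by (metis diff_self)
  obtain R s where R: "R > 0" and s: "s holomorphic_on ball 0 R"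
    "\<And>z. z \<in> ball 0 R \<Longrightarrow> \<sigma> z = z * s z" "\<And>z. z \<in> ball 0 R \<Longrightarrow> s z \<noteq> 0"
    using wsigma_factor_at_0 by metis
  define \<delta> where "\<delta> = min \<delta>1 R"
  have \<delta>: "\<delta> > 0" "\<delta> \<le> \<delta>1" "\<delta> \<le> R" using \<delta>1 R by (auto simp: \<delta>_def)
  have sub: "ball ?c \<delta> \<subseteq> ball ?c \<delta>1" using \<delta> by auto
  define u where "u = (\<lambda>z. C * exp (h * z) * (\<Prod>\<mu>=1..K. \<sigma> (z - a \<mu>)) *
      (\<Prod>j\<in>{1..r} - {i}. \<sigma> (z - p j) ^ k j) * s (z - p i) ^ k i)"
  have "(s \<circ> (\<lambda>z. z - ?c)) holomorphic_on ball ?c \<delta>"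
    by (rule holomorphic_on_compose[OF _ holomorphic_on_subset[OF s(1)]])
       (use \<delta>(3) in \<open>auto intro!: holomorphic_intros simp: dist_norm norm_minus_commute\<close>)
  hence sh: "(\<lambda>z. s (z - ?c)) holomorphic_on ball ?c \<delta>" by (simp add: o_def)
  have uh: "u holomorphic_on ball ?c \<delta>" unfolding u_def by (intro holomorphic_intros sh)
  have "\<sigma> (?c - a \<mu>) \<noteq> 0" if "\<mu> \<in> {1..K}" for \<mu>
    using a[OF that] same_class_sym[of \<tau> "a \<mu>" ?c] by (simp add: wsigma_eq_0_iff same_class_def)
  moreover have "\<sigma> (?c - p j) \<noteq> 0" if "j \<in> {1..r} - {i}" for j
    using distinct[OF i, of j] that by (auto simp: wsigma_eq_0_iff same_class_def)
  moreover have "s (?c - ?c) \<noteq> 0" using s(3)[of 0] R by simp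
  ultimately have u0: "u ?c \<noteq> 0" using C by (simp add: u_def prod_zero_iff)
  have yu: "y z = (z - ?c) ^ k i * u z" if "z \<in> ball ?c \<delta>" for z
  proof -
    have "z - ?c \<in> ball 0 R" using that \<delta>(3) by (simp add: dist_norm norm_minus_commute)
    hence "\<sigma> (z - ?c) ^ k i = (z - ?c) ^ k i * s (z - ?c) ^ k i"
      using s(2) by (simp add: power_mult_distrib)
    moreover have "(\<Prod>j=1..r. \<sigma> (z - p j) ^ k j) =
        \<sigma> (z - ?c) ^ k i * (\<Prod>j\<in>{1..r} - {i}. \<sigma> (z - p j) ^ k j)"
      by (rule prod.remove) (use i in auto)
    ultimately show ?thesis unfolding eq u_def by (simp add: mult_ac)
  qed
  show ?thesis
    by (rule ysol_order[OF y \<delta>(1) holomorphic_on_subset[OF gq(1) sub] holomorphic_on_subset[OF gq(2) sub]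
          Gz Qz _ uh u0 yu]) (use sub disj in auto)
qed

lemma wsigma_shift_has_deriv:
  "((\<lambda>z. \<sigma> (z - b)) has_field_derivative deriv (\<sigma>) (z - b)) (at z)"
  using has_field_derivative_translate[where z = z and c = "- b", OF wsigma_has_deriv] by simp

text \<open>Two congruent zeros would make \<open>y\<close> vanish together with its derivative at a
  regular point, contrary to \<open>ysol_unique\<close>.\<close>

lemma zeros_distinct:
  assumes y: "ysol UNIV y" "y \<noteq> (\<lambda>_. 0)"
    and a: "\<And>\<mu> i. \<mu> \<in> {1..K::nat} \<Longrightarrow> i \<in> {1..r} \<Longrightarrow> \<not> same_class \<tau> (a \<mu>) (p i)"
    and eq: "\<And>z. y z = C * exp (h * z) * (\<Prod>\<mu>=1..K. \<sigma> (z - a \<mu>)) * (\<Prod>i=1..r. \<sigma> (z - p i) ^ k i)"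
    and \<mu>\<nu>: "\<mu> \<in> {1..K}" "\<nu> \<in> {1..K}" "\<mu> \<noteq> \<nu>"
  shows "\<not> same_class \<tau> (a \<mu>) (a \<nu>)"
proof
  assume sc: "same_class \<tau> (a \<mu>) (a \<nu>)"
  let ?c = "a \<mu>"
  define W where "W = (\<lambda>z. C * exp (h * z) * (\<Prod>\<xi>\<in>{1..K} - {\<mu>} - {\<nu>}. \<sigma> (z - a \<xi>)) * (\<Prod>i=1..r. \<sigma> (z - p i) ^ k i))"
  have Wh: "W holomorphic_on UNIV" unfolding W_def by (intro holomorphic_intros)
  have yW: "y z = \<sigma> (z - a \<mu>) * (\<sigma> (z - a \<nu>) * W z)" for z
  proof -
    have "(\<Prod>\<xi>=1..K. \<sigma> (z - a \<xi>)) = \<sigma> (z - a \<mu>) * (\<Prod>\<xi>\<in>{1..K} - {\<mu>}. \<sigma> (z - a \<xi>))"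
      by (rule prod.remove) (use \<mu>\<nu> in auto)
    also have "(\<Prod>\<xi>\<in>{1..K} - {\<mu>}. \<sigma> (z - a \<xi>)) =
        \<sigma> (z - a \<nu>) * (\<Prod>\<xi>\<in>{1..K} - {\<mu>} - {\<nu>}. \<sigma> (z - a \<xi>))"
      by (rule prod.remove) (use \<mu>\<nu> in auto)
    finally show ?thesis unfolding eq W_def by (simp add: mult_ac)
  qed
  have z: "\<sigma> (?c - a \<mu>) = 0" "\<sigma> (?c - a \<nu>) = 0"
    using sc zero_in_lattice by (simp_all add: wsigma_eq_0_iff same_class_def)
  have d: "((\<lambda>z. \<sigma> (z - a \<nu>) * W z) has_field_derivative
      deriv (\<sigma>) (?c - a \<nu>) * W ?c + deriv W ?c * \<sigma> (?c - a \<nu>)) (at ?c)"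
    by (intro DERIV_mult wsigma_shift_has_deriv holomorphic_derivI[OF Wh open_UNIV UNIV_I])
  have "(y has_field_derivative deriv (\<sigma>) (?c - a \<mu>) * (\<sigma> (?c - a \<nu>) * W ?c) +
      (deriv (\<sigma>) (?c - a \<nu>) * W ?c + deriv W ?c * \<sigma> (?c - a \<nu>)) * \<sigma> (?c - a \<mu>)) (at ?c)"
    unfolding yW[abs_def] by (rule DERIV_mult[OF wsigma_shift_has_deriv d])
  hence "deriv y ?c = 0" unfolding z by (intro DERIV_imp_deriv) simp
  moreover have "y ?c = 0" unfolding yW z by simp
  moreover have "?c \<notin> P" using a[OF \<mu>\<nu>(1)] by (auto simp: P_def same_class_def)
  ultimately show False using ysol_unique y by blast
qed

text \<open>Compare the equation for \<open>y\<close> at a simple zero \<open>a \<mu>\<close> with \<open>y = \<sigma>(z - a \<mu>) W\<close>: since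
  \<open>\<sigma>''(0) = 0\<close>, the logarithmic derivative of \<open>W\<close> at \<open>a \<mu>\<close> is \<open>G (a \<mu>)\<close>.\<close>

lemma zero_equation:
  assumes y: "ysol UNIV y" and C: "C \<noteq> 0"
    and a: "\<And>\<mu> i. \<mu> \<in> {1..K::nat} \<Longrightarrow> i \<in> {1..r} \<Longrightarrow> \<not> same_class \<tau> (a \<mu>) (p i)"
    and dist: "\<And>\<mu> \<nu>. \<mu> \<in> {1..K} \<Longrightarrow> \<nu> \<in> {1..K} \<Longrightarrow> \<mu> \<noteq> \<nu> \<Longrightarrow> \<not> same_class \<tau> (a \<mu>) (a \<nu>)"
    and eq: "\<And>z. y z = C * exp (h * z) * (\<Prod>\<mu>=1..K. \<sigma> (z - a \<mu>)) * (\<Prod>i=1..r. \<sigma> (z - p i) ^ k i)"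
    and \<mu>: "\<mu> \<in> {1..K}"
  shows "h + (\<Sum>\<nu>\<in>{1..K} - {\<mu>}. \<zeta> (a \<mu> - a \<nu>)) + (\<Sum>i=1..r. of_nat (k i) * \<zeta> (a \<mu> - p i)) = G (a \<mu>)"
proof -
  let ?c = "a \<mu>"
  have cP: "?c \<notin> P" using a[OF \<mu>] by (auto simp: P_def same_class_def)
  define W where "W = (\<lambda>z. C * exp (h * z) * (\<Prod>\<nu>\<in>{1..K} - {\<mu>}. \<sigma> (z - a \<nu>)) * (\<Prod>i=1..r. \<sigma> (z - p i) ^ k i))"
  have Wh: "W holomorphic_on UNIV" unfolding W_def by (intro holomorphic_intros)
  have yW: "y = (\<lambda>z. \<sigma> (z - ?c) * W z)"
  proof
    fix z
    have "(\<Prod>\<nu>=1..K. \<sigma> (z - a \<nu>)) = \<sigma> (z - ?c) * (\<Prod>\<nu>\<in>{1..K} - {\<mu>}. \<sigma> (z - a \<nu>))"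
      by (rule prod.remove) (use \<mu> in auto)
    thus "y z = \<sigma> (z - ?c) * W z" unfolding eq W_def by (simp add: mult_ac)
  qed
  have nl: "?c - a \<nu> \<notin> \<Lambda>" if "\<nu> \<in> {1..K} - {\<mu>}" for \<nu>
    using dist[OF \<mu>, of \<nu>] that by (auto simp: same_class_def)
  have nlp: "?c - p i \<notin> \<Lambda>" if "i \<in> {1..r}" for i using not_in_P[OF cP that] .
  have W0: "W ?c \<noteq> 0"
    using C nl nlp by (auto simp: W_def wsigma_eq_0_iff)
  define \<rho> where "\<rho> = h + (\<Sum>\<nu>\<in>{1..K} - {\<mu>}. \<zeta> (?c - a \<nu>)) + (\<Sum>i=1..r. of_nat (k i) * \<zeta> (?c - p i))"
  have sd: "((\<lambda>z. \<sigma> (z - b)) has_field_derivative \<zeta> (?c - b) * \<sigma> (?c - b)) (at ?c)"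
    if "?c - b \<notin> \<Lambda>" for b
    using has_field_derivative_translate[where z = ?c and c = "- b", OF wsigma_deriv] that by simp
  have "(W has_field_derivative \<rho> * W ?c) (at ?c)"
  proof -
    have 1: "((\<lambda>z. C * exp (h * z)) has_field_derivative h * (C * exp (h * ?c))) (at ?c)"
      by (auto intro!: derivative_eq_intros)
    have 2: "((\<lambda>z. \<Prod>\<nu>\<in>{1..K} - {\<mu>}. \<sigma> (z - a \<nu>)) has_field_derivative
        (\<Sum>\<nu>\<in>{1..K} - {\<mu>}. \<zeta> (?c - a \<nu>)) * (\<Prod>\<nu>\<in>{1..K} - {\<mu>}. \<sigma> (?c - a \<nu>))) (at ?c)"
      using nl by (intro has_field_derivative_prod_log[of _ "\<lambda>\<nu> z. \<sigma> (z - a \<nu>)" "\<lambda>\<nu> z. \<zeta> (z - a \<nu>)"] sd) auto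
    have 3: "((\<lambda>z. \<Prod>i=1..r. \<sigma> (z - p i) ^ k i) has_field_derivative
        (\<Sum>i=1..r. of_nat (k i) * \<zeta> (?c - p i)) * (\<Prod>i=1..r. \<sigma> (?c - p i) ^ k i)) (at ?c)"
    proof (rule has_field_derivative_prod_log[of _ "\<lambda>i z. \<sigma> (z - p i) ^ k i" "\<lambda>i z. of_nat (k i) * \<zeta> (z - p i)"])
      fix i assume i: "i \<in> {1..r}"
      show "((\<lambda>z. \<sigma> (z - p i) ^ k i) has_field_derivative
          of_nat (k i) * \<zeta> (?c - p i) * \<sigma> (?c - p i) ^ k i) (at ?c)"
        using DERIV_power[OF sd[OF nlp[OF i]], of "k i"]
        by (rule DERIV_cong) (cases "k i"; simp)
    qed simp
    from DERIV_mult[OF DERIV_mult[OF 1 2] 3] show ?thesis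
      unfolding W_def \<rho>_def by (rule DERIV_cong) (simp add: algebra_simps)
  qed
  hence dW: "deriv W ?c = \<rho> * W ?c" by (rule DERIV_imp_deriv)
  have Wd: "(W has_field_derivative deriv W z) (at z)" "(deriv W has_field_derivative deriv (deriv W) z) (at z)" for z
    by (intro holomorphic_derivI[OF Wh open_UNIV UNIV_I]
          holomorphic_derivI[OF holomorphic_deriv[OF Wh open_UNIV] open_UNIV UNIV_I])+
  have s2: "((\<lambda>z. deriv (\<sigma>) (z - ?c)) has_field_derivative deriv (deriv (\<sigma>)) (z - ?c)) (at z)" for z
    using has_field_derivative_translate[where z = z and c = "- ?c",
       OF holomorphic_derivI[OF holomorphic_deriv[OF holomorphic_wsigma open_UNIV] open_UNIV UNIV_I]] by simp
  have d1: "(y has_field_derivative deriv (\<sigma>) (z - ?c) * W z + deriv W z * \<sigma> (z - ?c)) (at z)" for z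
    unfolding yW by (rule DERIV_mult[OF wsigma_shift_has_deriv Wd(1)])
  have d2: "deriv (deriv y) ?c = (deriv (deriv (\<sigma>)) (?c - ?c) * W ?c + deriv W ?c * deriv (\<sigma>) (?c - ?c)) +
      (deriv (deriv W) ?c * \<sigma> (?c - ?c) + deriv (\<sigma>) (?c - ?c) * deriv W ?c)"
    by (rule deriv_deriv_eqI[OF open_UNIV UNIV_I d1]) (intro DERIV_add DERIV_mult s2 Wd wsigma_shift_has_deriv)
  have s0: "\<sigma> 0 = 0" using zero_in_lattice by (simp add: wsigma_eq_0_iff)
  have "deriv (deriv y) ?c = 2 * G ?c * deriv y ?c + (Q ?c + deriv G ?c - G ?c ^ 2) * y ?c"
    using y cP unfolding ysol_def by blast
  moreover have "deriv y ?c = deriv (\<sigma>) 0 * W ?c" using DERIV_imp_deriv[OF d1[of ?c]] s0 by simp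
  moreover have "y ?c = 0" using s0 by (simp add: yW)
  moreover have "deriv (deriv y) ?c = 2 * deriv (\<sigma>) 0 * (\<rho> * W ?c)"
    using d2 s0 by (simp add: deriv2_wsigma_0 dW)
  ultimately have "2 * deriv (\<sigma>) 0 * W ?c * \<rho> = 2 * deriv (\<sigma>) 0 * W ?c * G ?c"
    by (simp add: mult_ac)
  hence "\<rho> = G ?c" using deriv_wsigma_0 W0 by simp
  thus ?thesis by (simp add: \<rho>_def)
qed

text \<open>Summed over all mu, the terms \<open>zeta (a mu - a nu)\<close> form an antisymmetric
  double sum, which vanishes; K times h is left.\<close>

lemma parameter_formula:
  fixes a :: "nat \<Rightarrow> complex"
  assumes eq: "\<And>\<mu>. \<mu> \<in> {1..K} \<Longrightarrow> h + (\<Sum>\<nu>\<in>{1..K} - {\<mu>}. \<zeta> (a \<mu> - a \<nu>)) = E \<mu>" and K: "K > 0"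
  shows "h = 1 / of_nat K * (\<Sum>\<mu>=1..K. E \<mu>)"
proof -
  \<comment> \<open>Oddness also holds for the default value at the pole, so the diagonal may be
    added to the double sum.\<close>
  have z0: "\<zeta> 0 = 0" using wzeta_minus[of 0] by simp
  define S where "S = (\<Sum>\<mu>=1..K. \<Sum>\<nu>=1..K. \<zeta> (a \<mu> - a \<nu>))"
  have "S = (\<Sum>\<nu>=1..K. \<Sum>\<mu>=1..K. \<zeta> (a \<mu> - a \<nu>))" unfolding S_def by (rule sum.swap)
  also have "\<dots> = (\<Sum>\<nu>=1..K. \<Sum>\<mu>=1..K. - \<zeta> (a \<nu> - a \<mu>))"
    using wzeta_minus by (intro sum.cong refl) (metis minus_diff_eq)
  also have "\<dots> = - S" by (simp add: S_def sum_negf)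
  finally have S: "S = 0" by simp
  have "(\<Sum>\<nu>\<in>{1..K} - {\<mu>}. \<zeta> (a \<mu> - a \<nu>)) = (\<Sum>\<nu>=1..K. \<zeta> (a \<mu> - a \<nu>))" if "\<mu> \<in> {1..K}" for \<mu>
  proof -
    have "(\<Sum>\<nu>=1..K. \<zeta> (a \<mu> - a \<nu>)) =
        \<zeta> (a \<mu> - a \<mu>) + (\<Sum>\<nu>\<in>{1..K} - {\<mu>}. \<zeta> (a \<mu> - a \<nu>))"
      by (rule sum.remove) (use that in auto)
    thus ?thesis by (simp add: z0)
  qed
  hence "(\<Sum>\<mu>=1..K. E \<mu>) = (\<Sum>\<mu>=1..K. h + (\<Sum>\<nu>=1..K. \<zeta> (a \<mu> - a \<nu>)))"
    using eq by (intro sum.cong) auto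
  also have "\<dots> = of_nat K * h + S" by (simp add: sum.distrib S_def)
  finally show ?thesis using K S by simp
qed

text \<open>The logarithms in a branch define a gauge factor on \<open>U\<close>: \<open>L i\<close>
  has derivative \<open>zeta (z - p i)\<close>, so g = exp of the sum of \<open>n i * L i\<close>
  satisfies g' = G g, and y / g is a constant multiple of the branch.\<close>

lemma branch_solves:
  assumes y: "ysol UNIV y" and C: "C \<noteq> 0"
    and eq: "\<And>z. y z = C * exp (h * z) * (\<Prod>\<mu>=1..K::nat. \<sigma> (z - a \<mu>)) * (\<Prod>i=1..r. \<sigma> (z - p i) ^ k i)"
    and U: "open U" "U \<inter> P = {}"
    and w: "hh_branch_on \<tau> r (\<lambda>i. of_real (n i) - of_nat (k i)) p K a h U w"
  shows "solves_on U Q w"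
proof -
  obtain L where L: "\<And>i. i \<in> {1..r} \<Longrightarrow> L i holomorphic_on U"
      "\<And>i z. i \<in> {1..r} \<Longrightarrow> z \<in> U \<Longrightarrow> exp (L i z) = \<sigma> (z - p i)"
    and wz: "\<And>z. z \<in> U \<Longrightarrow> w z = exp (h * z) * (\<Prod>\<mu>=1..K. \<sigma> (z - a \<mu>)) /
          (\<Prod>i=1..r. exp ((of_real (n i) - of_nat (k i)) * L i z))"
    using w unfolding hh_branch_on_def by blast
  have dL: "(L i has_field_derivative \<zeta> (z - p i)) (at z)" if i: "i \<in> {1..r}" and z: "z \<in> U" for i z
  proof -
    have nl: "z - p i \<notin> \<Lambda>" by (rule not_in_P[OF _ i]) (use U(2) z in blast)
    have d: "(L i has_field_derivative deriv (L i) z) (at z)" by (rule holomorphic_derivI[OF L(1)[OF i] U(1) z])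
    have "((\<lambda>z. \<sigma> (z - p i)) has_field_derivative exp (L i z) * deriv (L i) z) (at z)"
      by (rule has_field_derivative_transform_within_open[OF DERIV_chain2[OF DERIV_exp d] U(1) z]) (rule L(2)[OF i])
    moreover have "((\<lambda>z. \<sigma> (z - p i)) has_field_derivative \<zeta> (z - p i) * \<sigma> (z - p i)) (at z)"
      using has_field_derivative_translate[where z = z and c = "- p i", OF wsigma_deriv] nl by simp
    ultimately have "exp (L i z) * deriv (L i) z = \<zeta> (z - p i) * exp (L i z)"
      unfolding L(2)[OF i z] by (rule DERIV_unique)
    hence "deriv (L i) z = \<zeta> (z - p i)" by simp
    thus ?thesis using d by simp
  qed
  define g where "g = (\<lambda>z. exp (\<Sum>i=1..r. of_real (n i) * L i z))"
  have dg: "(g has_field_derivative G z * g z) (at z)" if z: "z \<in> U" for z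
  proof -
    have "((\<lambda>z. \<Sum>i=1..r. of_real (n i) * L i z) has_field_derivative G z) (at z)"
      unfolding G_def by (intro DERIV_sum DERIV_cmult dL z)
    from DERIV_chain2[OF DERIV_exp this] show ?thesis by (simp add: g_def mult.commute)
  qed
  have g0: "g z \<noteq> 0" for z unfolding g_def by (rule exp_not_eq_zero)
  have sol: "solves_on U Q (\<lambda>z. y z / g z)"
    by (rule solves_if_ysol[OF U dg g0 ysol_subset[OF y subset_UNIV]])
  have eqw: "y z / g z = C * w z" if z: "z \<in> U" for z
  proof -
    have "(\<Prod>i=1..r. \<sigma> (z - p i) ^ k i) = (\<Prod>i=1..r. exp (of_nat (k i) * L i z))"
      using L(2) z by (intro prod.cong refl) (simp add: exp_of_nat_mult)
    also have "\<dots> / g z = (\<Prod>i=1..r. exp (of_nat (k i) * L i z) / exp (of_real (n i) * L i z))"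
      by (simp add: g_def exp_sum prod_dividef)
    also have "\<dots> = (\<Prod>i=1..r. inverse (exp ((of_real (n i) - of_nat (k i)) * L i z)))"
      by (intro prod.cong refl) (simp add: exp_diff[symmetric] exp_minus[symmetric] algebra_simps)
    also have "\<dots> = 1 / (\<Prod>i=1..r. exp ((of_real (n i) - of_nat (k i)) * L i z))"
      by (simp add: inverse_eq_divide prod_dividef)
    finally have q: "(\<Prod>i=1..r. \<sigma> (z - p i) ^ k i) / g z =
        1 / (\<Prod>i=1..r. exp ((of_real (n i) - of_nat (k i)) * L i z))" .
    have "y z / g z = C * exp (h * z) * (\<Prod>\<mu>=1..K. \<sigma> (z - a \<mu>)) *
        ((\<Prod>i=1..r. \<sigma> (z - p i) ^ k i) / g z)"
      unfolding eq by simp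
    thus ?thesis unfolding q wz[OF z] by simp
  qed
  show ?thesis
  proof (rule solves_onI[OF U(1)])
    fix z assume z: "z \<in> U"
    note d = solves_onD[OF sol U(1) z]
    show "(w has_field_derivative 1 / C * deriv (\<lambda>z. y z / g z) z) (at z)"
      by (rule has_field_derivative_transform_within_open[OF DERIV_cmult[OF d(1)] U(1) z])
         (use C in \<open>simp add: eqw\<close>)
    show "((\<lambda>z. 1 / C * deriv (\<lambda>z. y z / g z) z) has_field_derivative Q z * w z) (at z)"
      by (rule DERIV_cong[OF DERIV_cmult[OF d(2)]]) (use C z in \<open>simp add: eqw\<close>)
  qed
qed

lemma branch_exists:
  assumes U: "open U" "simply_connected U" "U \<inter> P = {}"
  shows "\<exists>w. hh_branch_on \<tau> r m p K a h U w"
proof -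
  have "\<exists>L. L holomorphic_on U \<and> (\<forall>z\<in>U. exp (L z) = \<sigma> (z - p i))" if i: "i \<in> {1..r}" for i
  proof -
    have hol: "(\<lambda>z. \<sigma> (z - p i)) holomorphic_on U" by (intro holomorphic_intros)
    have nz: "\<sigma> (z - p i) \<noteq> 0" if "z \<in> U" for z
      using not_in_P[OF _ i, of z] U(3) that by (auto simp: wsigma_eq_0_iff)
    obtain L where "L holomorphic_on U" "\<And>z. z \<in> U \<Longrightarrow> \<sigma> (z - p i) = exp (L z)"
      using simply_connected_imp_holomorphic_log[OF hol U(2) open_imp_locally_path_connected[OF U(1)] nz]
      by blast
    thus ?thesis by (intro exI[of _ L]) simp
  qed
  hence "\<forall>i\<in>{1..r}. \<exists>L. L holomorphic_on U \<and> (\<forall>z\<in>U. exp (L z) = \<sigma> (z - p i))" by blast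
  from bchoice[OF this]
  obtain L where L: "\<forall>i\<in>{1..r}. L i holomorphic_on U \<and> (\<forall>z\<in>U. exp (L i z) = \<sigma> (z - p i))" ..
  show ?thesis
    unfolding hh_branch_on_def
    by (intro exI[of _ "\<lambda>z. exp (h * z) * (\<Prod>\<mu>=1..K. \<sigma> (z - a \<mu>)) / (\<Prod>i=1..r. exp (m i * L i z))"]
          exI[of _ L] conjI L) simp
qed

text \<open>The weights balance because \<open>y\<close> has degree \<open>N\<close>: subtracting
  the orders \<open>k i\<close> at the \<open>p i\<close> leaves the number \<open>K\<close> of
  remaining zeros, which is the new total weight. The possible types \<open>n i\<close> and
  \<open>- n i - 1\<close> are nonzero since \<open>n i > 0\<close>.\<close>

lemma hermite_halphen_solution:
  "\<exists>N' n' a h. N' \<le> N \<and> hh_data \<tau> r n' p N' a h \<and> hh_solves \<tau> r n' p N' a h Q"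
proof -
  \<comment> \<open>The N-th power of Legendre's relation; this is where integrality of the total
    weight enters.\<close>
  have comm: "exp (of_nat N * eta 1 * \<tau>) = exp (of_nat N * eta \<tau> * 1)"
    using exp_Legendre by (simp only: mult.assoc exp_of_nat_mult mult_1_right)
  obtain y \<mu>1 \<mu>2 where y: "ysol UNIV y" "y \<noteq> (\<lambda>_. 0)"
    and m: "\<And>z. y (z + 1) = \<mu>1 * exp (of_nat N * eta 1 * z) * y z"
      "\<And>z. y (z + \<tau>) = \<mu>2 * exp (of_nat N * eta \<tau> * z) * y z"
    using exists_multiplicative_ysol[OF P_translate[OF one_in_lattice] P_translate[OF tau_in_lattice]
        G_translate[OF one_in_lattice] G_translate[OF tau_in_lattice]
        Q_translate[OF one_in_lattice] Q_translate[OF tau_in_lattice] comm] by blast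
  have "y holomorphic_on UNIV" "\<exists>z. y z \<noteq> 0" using y by (auto simp: ysol_def)
  then obtain k a K C h where C: "C \<noteq> 0" and sum: "(\<Sum>i=1..r. k i) + K = N"
    and a: "\<And>\<mu> i. \<mu> \<in> {1..K::nat} \<Longrightarrow> i \<in> {1..r} \<Longrightarrow> \<not> same_class \<tau> (a \<mu>) (p i)"
    and eq: "\<And>z. y z = C * exp (h * z) * (\<Prod>\<mu>=1..K. \<sigma> (z - a \<mu>)) * (\<Prod>i=1..r. \<sigma> (z - p i) ^ k i)"
    using theta_factorization[OF _ _ _ m, of "{1..r}" p] by blast
  define n' where "n' = (\<lambda>i. complex_of_real (n i) - of_nat (k i))"
  note dist = zeros_distinct[OF y a eq]
  have "hh_data \<tau> r n' p K a h"
    unfolding hh_data_def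
  proof (intro conjI ballI impI)
    fix i assume i: "i \<in> {1..r}"
    have "n i > 0" using half_integral[OF i] by auto
    show "n' i \<noteq> 0"
      using exponent_at_p[OF y(1) C a[OF _ i] eq i]
    proof
      assume "k i = 0"
      thus ?thesis using \<open>n i > 0\<close> by (simp add: n'_def)
    next
      assume "complex_of_nat (k i) = 2 * of_real (n i) + 1"
      hence "n' i = of_real (- n i - 1)" by (simp add: n'_def)
      moreover have "- n i - 1 \<noteq> 0" using \<open>n i > 0\<close> by simp
      ultimately show ?thesis by (simp only: of_real_eq_0_iff not_False_eq_True)
    qed
  next
    have "(\<Sum>i=1..r. n' i) = of_real (\<Sum>i=1..r. n i) - of_nat (\<Sum>i=1..r. k i)"
      by (simp add: n'_def sum_subtractf)
    also have "\<dots> = of_nat N - of_nat (\<Sum>i=1..r. k i)" by (simp only: total of_real_of_nat_eq)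
    also have "\<dots> = of_nat K" unfolding sum[symmetric] by simp
    finally show "(\<Sum>i=1..r. n' i) = of_nat K" .
  next
    assume K: "K > 0"
    show "h = 1 / of_nat K * (\<Sum>\<mu>=1..K. \<Sum>i=1..r. n' i * \<zeta> (a \<mu> - p i))"
    proof (rule parameter_formula[OF _ K])
      fix \<mu> assume \<mu>: "\<mu> \<in> {1..K}"
      have "h + (\<Sum>\<nu>\<in>{1..K} - {\<mu>}. \<zeta> (a \<mu> - a \<nu>)) =
          G (a \<mu>) - (\<Sum>i=1..r. of_nat (k i) * \<zeta> (a \<mu> - p i))"
        using zero_equation[OF y(1) C a dist eq \<mu>] by (simp add: algebra_simps)
      also have "\<dots> = (\<Sum>i=1..r. n' i * \<zeta> (a \<mu> - p i))"
        by (simp add: G_def n'_def sum_subtractf algebra_simps)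
      finally show "h + (\<Sum>\<nu>\<in>{1..K} - {\<mu>}. \<zeta> (a \<mu> - a \<nu>)) = (\<Sum>i=1..r. n' i * \<zeta> (a \<mu> - p i))" .
    qed
  qed (use a dist in auto)
  moreover have "hh_solves \<tau> r n' p K a h Q"
    unfolding hh_solves_def
  proof (intro allI impI conjI)
    fix U assume U: "open U \<and> simply_connected U \<and> (\<forall>z\<in>U. \<forall>i\<in>{1..r}. \<not> same_class \<tau> z (p i))"
    hence UP: "U \<inter> P = {}" by (auto simp: P_def same_class_def)
    show "\<exists>w. hh_branch_on \<tau> r n' p K a h U w" using U UP by (intro branch_exists) auto
    fix w assume "hh_branch_on \<tau> r n' p K a h U w"
    thus "solves_on U Q w"
      using branch_solves[OF y(1) C eq _ UP] U unfolding n'_def by blast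
  qed
  moreover have "K \<le> N" using sum by simp
  ultimately show ?thesis by blast
qed

end

theorem proposition2p8:
  fixes \<tau> :: complex and r N :: nat and n :: "nat \<Rightarrow> real"
    and p A :: "nat \<Rightarrow> complex" and B :: complex
  assumes "Im \<tau> > 0"
    and "\<forall>i\<in>{1..r}. \<exists>k::nat. k \<ge> 1 \<and> n i = real k / 2"
    and "(\<Sum>i=1..r. n i) = real N" and "N \<ge> 1"
    and "\<forall>i\<in>{1..r}. \<forall>j\<in>{1..r}. i \<noteq> j \<longrightarrow> \<not> same_class \<tau> (p i) (p j)"
    and "(\<Sum>i=1..r. A i) = 0"
    and "\<forall>i\<in>{1..r}. log_free_at (lame_potential \<tau> r n p A B) (p i)"
  shows "\<exists>N' n' a h. N' \<le> N \<and> hh_data \<tau> r n' p N' a h \<and>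
           hh_solves \<tau> r n' p N' a h (lame_potential \<tau> r n p A B)"
proof -
  interpret lame_equation \<tau> r N n p A B
    by unfold_locales (use assms in auto)
  show ?thesis by (rule hermite_halphen_solution)
qed

end
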